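(* There is a universal constant $c>0$ such that for every integer $k\geq 3$ there exists a constant $C(k)>0$, depending only on $k$, with the following property: for all natural numbers $D$ and $m\geq 2$ satisfying $D\geq c\,m^4\sqrt{\log m}$, there exists a $k$-player quantum XOR game $G\neq 0$ with local dimension $D$ (that is, $\mathcal H_{A_1}=\cdots=\mathcal H_{A_k}=\mathbb C^D$) such that $$\beta^*(G)\geq C(k)\,m^{\frac{k}{2}-1}(\log m)^{-\frac{k}{2}}\,\beta_{SEP}(G),$$ where $\beta^*(G)$ is the entangled bias of $G$ and $\beta_{SEP}(G)$ is the bias of $G$ when the players are restricted to separable strategies.
   Context: Quantum XOR games. Let $\mathcal H_{A_1},\dots,\mathcal H_{A_k}$ be finite-dimensional complex Hilbert spaces. A $k$-player quantum XOR game is given by $k$-partite quantum states $(\rho_x)_{x=1}^N$ (positive semidefinite trace-one operators on $\mathcal H_{A_1}\otimes\cdots\otimes\mathcal H_{A_k}$), signs $(c_x)_{x=1}^N\in\{-1,1\}^N$ and a probability distribution $(p_x)_{x=1}^N$. The game is identified with the self-adjoint operator $G=\sum_{x=1}^N c_xp_x\rho_x$, which has trace norm at most $1$; conversely every self-adjoint operator on $\mathcal H_{A_1}\otimes\cdots\otimes\mathcal H_{A_k}$ of trace norm at most $1$ is of this form, so quantum XOR games are identified with such operators. Strategies and bias. A strategy $\mathcal P$ assigns (linearly) to each state $\rho$ on $\mathcal H_{A_1}\otimes\cdots\otimes\mathcal H_{A_k}$ a probability distribution $(P(a_1,\dots,a_k|\rho))_{a_1,\dots,a_k=\pm1}$.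 The players win on question $x$ if $a_1\cdots a_k=c_x$. The bias of $\mathcal P$ is $\beta(G;\mathcal P)=\sum_{x}p_xc_x\sum_{a_1,\dots,a_k=\pm1}a_1\cdots a_k\,P(a_1,\dots,a_k|\rho_x)$ (winning probability minus losing probability). Entangled strategies. These are of the form $P(a_1,\dots,a_k|\rho)=\mathrm{tr}\big((E_1^{a_1}\otimes\cdots\otimes E_k^{a_k})(\rho\otimes\rho')\big)$, where $\mathcal H_{A_i'}$ are finite-dimensional complex Hilbert spaces, $\rho'$ is a quantum state on $\mathcal H_{A_1'}\otimes\cdots\otimes\mathcal H_{A_k'}$ and $(E_i^{a_i})_{a_i=\pm1}$ is a POVM on $\mathcal H_{A_i}\otimes\mathcal H_{A_i'}$ for each $i$ (tensor factors being reordered in the obvious way). The entangled bias $\beta^*(G)$ is the supremum of $\beta(G;\mathcal P)$ over all entangled strategies. Separable strategies. These are of the form $P(a_1,\dots,a_k|\rho)=\mathrm{tr}(E_{a_1,\dots,a_k}\rho)$ with $E_{a_1,\dots,a_k}=\sum_{i\in I}P_i^{1,a_1}\otimes\cdots\otimes P_i^{k,a_k}$, where $I$ is a finite set, each $P_i^{j,a_j}\in\mathcal B(\mathcal H_{A_j})$ ($i\in I$, $1\le j\le k$, $a_j=\pm1$) is positive semidefinite, and $\sum_{i\in I}\sum_{a_1,\dots,a_k=\pm1}P_i^{1,a_1}\otimes\cdots\otimes P_i^{k,a_k}$ is the identity operator. $\beta_{SEP}(G)$ is the supremum of $\beta(G;\mathcal P)$ over all separable strategies. *)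

theory Defs
  imports Complex_Main "HOL-Library.FuncSet" "HOL-Library.Nonpos_Ints"
begin

text \<open>
  The number of players, the local dimensions and the dimensions of the auxiliary spaces are
  quantified inside the main statement, so Hilbert spaces cannot be encoded by types. An operator
  on the space with orthonormal basis indexed by a finite set \<open>I\<close> is given by its matrix
  \<open>A :: 'i \<Rightarrow> 'i \<Rightarrow> complex\<close>; only the entries with both indices in \<open>I\<close> are ever
  used.
\<close>

type_synonym 'i cop = "'i \<Rightarrow> 'i \<Rightarrow> complex"

definition op_trace :: "'i set \<Rightarrow> 'i cop \<Rightarrow> complex" where
  "op_trace I A = (\<Sum>i\<in>I. A i i)"

definition op_mult :: "'i set \<Rightarrow> 'i cop \<Rightarrow> 'i cop \<Rightarrow> 'i cop" where
  "op_mult I A B = (\<lambda>i j. \<Sum>l\<in>I. A i l * B l j)"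

definition op_id :: "'i cop" where
  "op_id = (\<lambda>i j. if i = j then 1 else 0)"

definition op_eq_on :: "'i set \<Rightarrow> 'i cop \<Rightarrow> 'i cop \<Rightarrow> bool" where
  "op_eq_on I A B \<longleftrightarrow> (\<forall>i\<in>I. \<forall>j\<in>I. A i j = B i j)"

definition psd :: "'i set \<Rightarrow> 'i cop \<Rightarrow> bool" where
  "psd I A \<longleftrightarrow> (\<forall>v :: 'i \<Rightarrow> complex. (\<Sum>i\<in>I. \<Sum>j\<in>I. cnj (v i) * A i j * v j) \<in> \<real>\<^sub>\<ge>\<^sub>0)"

definition qstate :: "'i set \<Rightarrow> 'i cop \<Rightarrow> bool" where
  "qstate I A \<longleftrightarrow> psd I A \<and> op_trace I A = 1"

definition povm :: "'i set \<Rightarrow> (int \<Rightarrow> 'i cop) \<Rightarrow> bool" where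
  "povm I E \<longleftrightarrow> (\<forall>a\<in>{-1, 1}. psd I (E a)) \<and> op_eq_on I (\<lambda>i j. \<Sum>a\<in>{-1, 1}. E a i j) op_id"

text \<open>
  The players are \<open>j < k\<close>. The tensor product of \<open>\<complex>\<^bsup>n 0\<^esup>, \<dots>, \<complex>\<^bsup>n (k-1)\<^esup>\<close> has its product
  basis indexed by the multi-indices in \<open>multi k n\<close>.
\<close>

definition multi :: "nat \<Rightarrow> (nat \<Rightarrow> nat) \<Rightarrow> (nat \<Rightarrow> nat) set" where
  "multi k n = (\<Pi>\<^sub>E j\<in>{..<k}. {..<n j})"

definition tensor :: "nat \<Rightarrow> (nat \<Rightarrow> 'i cop) \<Rightarrow> (nat \<Rightarrow> 'i) cop" where
  "tensor k A = (\<lambda>f g. \<Prod>j<k. A j (f j) (g j))"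

definition tensor2 :: "'i cop \<Rightarrow> 'l cop \<Rightarrow> ('i \<times> 'l) cop" where
  "tensor2 A B = (\<lambda>(i, i') (j, j'). A i j * B i' j')"

text \<open>
  \<open>tensor_regroup k E\<close> is the tensor product of operators \<open>E j\<close> on
  \<open>H\<^sub>j \<otimes> H'\<^sub>j\<close> after reordering the factors, i.e. regarded as an operator on
  \<open>(H\<^sub>0 \<otimes> \<dots> \<otimes> H\<^bsub>k-1\<^esub>) \<otimes> (H'\<^sub>0 \<otimes> \<dots> \<otimes> H'\<^bsub>k-1\<^esub>)\<close>.
\<close>

definition tensor_regroup ::
    "nat \<Rightarrow> (nat \<Rightarrow> (nat \<times> nat) cop) \<Rightarrow> ((nat \<Rightarrow> nat) \<times> (nat \<Rightarrow> nat)) cop" where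
  "tensor_regroup k E =
    (\<lambda>(f, f') (g, g'). tensor k E (\<lambda>j. (f j, f' j)) (\<lambda>j. (g j, g' j)))"

definition answers :: "nat \<Rightarrow> (nat \<Rightarrow> int) set" where
  "answers k = (\<Pi>\<^sub>E j\<in>{..<k}. {-1, 1})"

record xor_game =
  num_questions :: nat
  question :: "nat \<Rightarrow> (nat \<Rightarrow> nat) cop"
  sign :: "nat \<Rightarrow> int"
  prob :: "nat \<Rightarrow> real"

definition quantum_xor_game :: "nat \<Rightarrow> (nat \<Rightarrow> nat) \<Rightarrow> xor_game \<Rightarrow> bool" where
  "quantum_xor_game k n G \<longleftrightarrow>
    (\<forall>x<num_questions G. qstate (multi k n) (question G x) \<and> sign G x \<in> {-1, 1} \<and> prob G x \<ge> 0)
    \<and> (\<Sum>x<num_questions G. prob G x) = 1"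

text \<open>The self-adjoint operator with which a game is identified.\<close>

definition game_operator :: "xor_game \<Rightarrow> (nat \<Rightarrow> nat) cop" where
  "game_operator G =
    (\<lambda>f g. \<Sum>x<num_questions G. of_int (sign G x) * of_real (prob G x) * question G x f g)"

text \<open>A strategy \<open>P\<close> gives the probability \<open>P \<rho> a\<close> of the answers \<open>a\<close> on the state \<open>\<rho>\<close>.\<close>

type_synonym strategy = "(nat \<Rightarrow> nat) cop \<Rightarrow> (nat \<Rightarrow> int) \<Rightarrow> real"

definition bias :: "nat \<Rightarrow> xor_game \<Rightarrow> strategy \<Rightarrow> real" where
  "bias k G P = (\<Sum>x<num_questions G. prob G x * of_int (sign G x) *
    (\<Sum>a\<in>answers k. of_int (\<Prod>j<k. a j) * P (question G x) a))"

text \<open>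
  In both classes of strategies the trace is a real number whenever \<open>\<rho>\<close> is a state, so
  taking \<open>Re\<close> only converts the type.
\<close>

definition entangled_strategies :: "nat \<Rightarrow> (nat \<Rightarrow> nat) \<Rightarrow> strategy set" where
  "entangled_strategies k n = {P. \<exists>(d :: nat \<Rightarrow> nat) \<rho>' (E :: nat \<Rightarrow> int \<Rightarrow> (nat \<times> nat) cop).
    qstate (multi k d) \<rho>' \<and>
    (\<forall>j<k. povm ({..<n j} \<times> {..<d j}) (E j)) \<and>
    P = (\<lambda>\<rho> a. let I = multi k n \<times> multi k d in
      Re (op_trace I (op_mult I (tensor_regroup k (\<lambda>j. E j (a j))) (tensor2 \<rho> \<rho>'))))}"

definition separable_strategies :: "nat \<Rightarrow> (nat \<Rightarrow> nat) \<Rightarrow> strategy set" where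
  "separable_strategies k n = {P. \<exists>(S :: nat set) (Q :: nat \<Rightarrow> nat \<Rightarrow> int \<Rightarrow> nat cop).
    finite S \<and>
    (\<forall>s\<in>S. \<forall>j<k. \<forall>b\<in>{-1, 1}. psd {..<n j} (Q s j b)) \<and>
    op_eq_on (multi k n)
      (\<lambda>f g. \<Sum>s\<in>S. \<Sum>a\<in>answers k. tensor k (\<lambda>j. Q s j (a j)) f g) op_id \<and>
    P = (\<lambda>\<rho> a. Re (op_trace (multi k n)
      (op_mult (multi k n) (\<lambda>f g. \<Sum>s\<in>S. tensor k (\<lambda>j. Q s j (a j)) f g) \<rho>)))}"

text \<open>
  For a game with all \<open>n j > 0\<close> the sets below are nonempty and contained in
  \<open>{-1..1}\<close>, so the real suprema are the genuine ones.
\<close>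

definition entangled_bias :: "nat \<Rightarrow> (nat \<Rightarrow> nat) \<Rightarrow> xor_game \<Rightarrow> real" where
  "entangled_bias k n G = (SUP P\<in>entangled_strategies k n. bias k G P)"

definition separable_bias :: "nat \<Rightarrow> (nat \<Rightarrow> nat) \<Rightarrow> xor_game \<Rightarrow> real" where
  "separable_bias k n G = (SUP P\<in>separable_strategies k n. bias k G P)"

end

theory Submission
  imports Defs "HOL-Analysis.L2_Norm"
begin

text \<open>
  Let \<open>X\<^sub>a\<close>, for \<open>a = (p, q)\<close> with \<open>p, q < m\<^sup>2\<close>, be random sign matrices of size
  \<open>d \<approx> D / 2\<close>, let \<open>g\<close> and \<open>g'\<close> be \<open>k\<close>-tensors of random signs over \<open>m\<^sup>2\<close> indices, and put
  \<open>t\<^sub>a = g\<^sub>p g'\<^sub>q\<close> for a tuple \<open>a\<close> of pairs \<open>(p\<^sub>j, q\<^sub>j)\<close>. The game is a multiple of the sum of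
  \<open>t\<^sub>a X\<^bsub>a 0\<^esub> \<otimes> \<dots> \<otimes> X\<^bsub>a (k-1)\<^esub>\<close> over all \<open>a\<close>, where each \<open>X\<^sub>a\<close> is placed off the diagonal of a
  \<open>2 \<times> 2\<close> block matrix to make it symmetric.

  A separable strategy is a combination of product vectors, and on a product vector \<open>x\<close> the game
  takes the value \<open>t(B\<^sub>0, \<dots>, B\<^bsub>k-1\<^esub>)\<close> with \<open>B\<^sub>j(a) = \<langle>x\<^sub>j, X\<^sub>a x\<^sub>j\<rangle>\<close>, a vector of norm \<open>O(\<surd>d)\<close>. So the separable
  bias is governed by the injective norm of \<open>t\<close> over Hilbert spaces. Entangled players measure
  \<open>\<Sum> X\<^bsub>pq\<^esub> \<otimes> e\<^bsub>pq\<^esub>\<close>, of norm \<open>O(m \<surd>d)\<close>, in the state \<open>g \<oplus> g'\<close>; as the \<open>X\<^sub>a\<close> are almost orthogonal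
  once \<open>D\<close> exceeds \<open>m\<^sup>4 \<surd>log m\<close>, this yields the full \<open>\<parallel>t\<parallel>\<^sup>2\<close> up to constants.

  The injective norm of \<open>t\<close> is the supremum of \<open>\<langle>g, (B\<^sub>0 \<otimes> \<dots> \<otimes> B\<^bsub>k-1\<^esub>) g'\<rangle>\<close> over matrices of Hilbert--Schmidt
  norm \<open>1\<close>. Split each \<open>B\<^sub>j\<close> into a part of rank at most \<open>m\<close> and a part of operator norm at most
  \<open>1 / \<surd>m\<close>. If some \<open>B\<^sub>j\<close> has small operator norm, then the vector paired with \<open>g\<close> is short; if all of
  them have low rank, then they admit a small net. A union bound gives \<open>O(m\<^bsup>5/2\<^esup> \<surd>log m)\<close> in both
  cases, so the ratio of the biases is about \<open>m\<^bsup>k - 5/2\<^esup>\<close>, and \<open>k - 5/2 \<ge> k/2 - 1\<close> for \<open>k \<ge> 3\<close>.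
\<close>

section \<open>Random signs and nets\<close>

text \<open>Two obstacles shape the proof. The cross terms of a pure state g + g' only test
  coefficients of the form g_p g'_q, whence the pairs (p, q) and the product form of t. For such t
  the obvious bounds on the injective norm are too weak. Cauchy-Schwarz gives m^(k+1). A union bound
  over nets of Hilbert-Schmidt balls has entropy of order m^4 log m and standard deviation of order
  m, the injective norm of g'; it gives m^3 sqrt(log m), hence a ratio of about m^(k-3), which fails
  for k = 3. Splitting at rank R repairs this: a slot of small operator norm divides the deviation
  by sqrt R, which gives m^3 / sqrt R, while matrices of rank R have only about m^2 R parameters,
  which gives m^2 sqrt R. The two balance at R = m with m^(5/2), and k - 5/2 = k/2 - 1 exactly when
  k = 3. The lower bound on D makes the m^4 sign matrices almost orthogonal: the correlations of all
  pairs, at most m^8 of them, must stay below d^2 / (2 m^4). All probabilities are proportions in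
  finite sets of sign patterns.\<close>

lemma two_power_fact_le: "2 ^ n * fact n \<le> (fact (2 * n) :: real)"
proof (induction n)
  case (Suc n)
  have "2 ^ Suc n * fact (Suc n) = (2 * (real n + 1)) * (2 ^ n * fact n :: real)"
    by (simp add: algebra_simps)
  also have "\<dots> \<le> (2 * (real n + 1)) * fact (2 * n)"
    by (intro mult_left_mono Suc.IH) auto
  also have "\<dots> \<le> (2 * (real n + 1)) * ((2 * real n + 1) * fact (2 * n))"
    by (intro mult_left_mono) auto
  also have "\<dots> = fact (2 * Suc n)"
    by (simp add: algebra_simps)
  finally show ?case .
qed auto

text \<open>Term by term: the coefficient of x^(2n) is 1/(2n)! on the left and 1/(2^n n!) on the
  right. This is the subgaussian bound for a single random sign.\<close>

lemma cosh_le_exp_half_square: "cosh x \<le> exp (x\<^sup>2 / 2)" for x :: real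
proof (rule sums_le)
  let ?f = "\<lambda>n. if even n then x ^ n /\<^sub>R fact n else 0"
  have "strict_mono (\<lambda>n::nat. 2 * n)" by (auto intro: strict_monoI)
  moreover have "\<And>n. n \<notin> range (\<lambda>n::nat. 2 * n) \<Longrightarrow> ?f n = 0" by auto
  ultimately have "(\<lambda>n. ?f (2 * n)) sums cosh x"
    using sums_mono_reindex[of "\<lambda>n::nat. 2 * n" ?f "cosh x"] cosh_converges[of x] by metis
  then show "(\<lambda>n. x ^ (2 * n) /\<^sub>R fact (2 * n)) sums cosh x" by simp
  show "(\<lambda>n. (x\<^sup>2 / 2) ^ n /\<^sub>R fact n) sums exp (x\<^sup>2 / 2)"
    by (rule exp_converges)
  show "x ^ (2 * n) /\<^sub>R fact (2 * n) \<le> (x\<^sup>2 / 2) ^ n /\<^sub>R fact n" for n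
  proof -
    have "x ^ (2 * n) / fact (2 * n) \<le> x ^ (2 * n) / (2 ^ n * fact n)"
      by (intro divide_left_mono two_power_fact_le) (auto simp: power_mult)
    also have "\<dots> = (x\<^sup>2 / 2) ^ n / fact n"
      by (simp only: power_divide power_mult divide_divide_eq_left)
    finally show ?thesis
      unfolding real_scaleR_def divide_inverse by (simp only: mult.commute)
  qed
qed

text \<open>Extensional functions form a finite set, so proportions of it serve as probabilities,
  and independence of the coordinates is the exchange of product and sum over
  \<open>PiE\<close>.\<close>

definition signs :: "'a set \<Rightarrow> ('a \<Rightarrow> real) set" where
  "signs I = (\<Pi>\<^sub>E i\<in>I. {-1, 1})"

lemma finite_signs: "finite I \<Longrightarrow> finite (signs I)"
  unfolding signs_def by (rule finite_PiE) auto

lemma card_signs: "finite I \<Longrightarrow> card (signs I) = 2 ^ card I"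
  unfolding signs_def by (subst card_PiE) (auto simp: card_insert_if numeral_2_eq_2)

lemma signs_power2: "s \<in> signs I \<Longrightarrow> i \<in> I \<Longrightarrow> (s i)\<^sup>2 = 1"
  unfolding signs_def by (auto dest!: PiE_mem)

text \<open>The moment generating function factors over the coordinates, and each factor is a cosh.
  The injection \<open>e\<close> lets a form read only some coordinates, under an indexing of its
  own; later one sign family is read in two ways at once.\<close>

lemma sum_signs_exp:
  assumes fin: "finite I" and inj: "inj_on e F" and sub: "e ` F \<subseteq> I"
  shows "(\<Sum>s\<in>signs I. exp (\<Sum>f\<in>F. s (e f) * c f)) \<le> real (card (signs I)) * exp ((\<Sum>f\<in>F. (c f)\<^sup>2) / 2)"
proof -
  \<comment> \<open>The coefficients transported along \<open>e\<close>, and zero off its range,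
    where the factor is just 2.\<close>
  define x where "x i = (if i \<in> e ` F then c (inv_into F e i) else 0)" for i
  have red: "(\<Sum>i\<in>I. h i (x i)) = (\<Sum>f\<in>F. h (e f) (c f))" if "\<And>i. h i 0 = 0" for h :: "'a \<Rightarrow> real \<Rightarrow> real"
  proof -
    have "(\<Sum>i\<in>I. h i (x i)) = (\<Sum>i\<in>e ` F. h i (x i))"
      by (rule sum.mono_neutral_right) (use fin sub that in \<open>auto simp: x_def\<close>)
    also have "\<dots> = (\<Sum>f\<in>F. h (e f) (x (e f)))"
      by (rule sum.reindex_cong[OF inj]) auto
    finally show ?thesis using inj by (simp add: x_def)
  qed
  have "(\<Sum>s\<in>signs I. exp (\<Sum>f\<in>F. s (e f) * c f)) = (\<Sum>s\<in>signs I. \<Prod>i\<in>I. exp (s i * x i))"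
    using fin red[of "\<lambda>i y. s i * y" for s] by (intro sum.cong refl) (simp add: exp_sum[symmetric])
  also have "\<dots> = (\<Prod>i\<in>I. \<Sum>b\<in>{-1, 1}. exp (b * x i))"
    unfolding signs_def by (rule prod_sum_PiE[symmetric]) (use fin in auto)
  also have "\<dots> \<le> (\<Prod>i\<in>I. 2 * exp ((x i)\<^sup>2 / 2))"
  proof (rule prod_mono, safe)
    fix i assume "i \<in> I"
    show "(\<Sum>b\<in>{-1, 1}. exp (b * x i)) \<le> 2 * exp ((x i)\<^sup>2 / 2)"
      using cosh_le_exp_half_square[of "x i"] by (simp add: cosh_def)
  qed (auto intro: sum_nonneg)
  also have "\<dots> = real (card (signs I)) * exp ((\<Sum>i\<in>I. (x i)\<^sup>2) / 2)"
    using fin by (simp add: prod.distrib card_signs exp_sum sum_divide_distrib)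
  also have "(\<Sum>i\<in>I. (x i)\<^sup>2) = (\<Sum>f\<in>F. (c f)\<^sup>2)"
    using red[of "\<lambda>i y. y\<^sup>2"] by simp
  finally show ?thesis .
qed

text \<open>Markov's inequality for exp(\<lambda> \<phi>) at \<lambda> = t / v, which minimises
  \<lambda>^2 v / 2 - \<lambda> t.\<close>

lemma card_le_exp_moment:
  fixes \<phi> :: "'a \<Rightarrow> real"
  assumes fin: "finite S" and "v > 0" "t \<ge> 0"
    and mom: "(\<Sum>s\<in>S. exp (t / v * \<phi> s)) \<le> w * exp ((t / v)\<^sup>2 * v / 2)"
  shows "real (card {s \<in> S. \<phi> s > t}) \<le> w * exp (- t\<^sup>2 / (2 * v))"
proof -
  have "real (card {s \<in> S. \<phi> s > t}) * exp (t / v * t) = (\<Sum>s\<in>{s \<in> S. \<phi> s > t}. exp (t / v * t))"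
    by simp
  also have "\<dots> \<le> (\<Sum>s\<in>{s \<in> S. \<phi> s > t}. exp (t / v * \<phi> s))"
    by (intro sum_mono) (use assms in \<open>auto intro!: divide_right_mono mult_left_mono\<close>)
  also have "\<dots> \<le> (\<Sum>s\<in>S. exp (t / v * \<phi> s))"
    by (intro sum_mono2) (use fin in auto)
  also note mom
  finally have "real (card {s \<in> S. \<phi> s > t}) \<le> w * (exp ((t / v)\<^sup>2 * v / 2) * exp (- (t / v * t)))"
    by (simp add: exp_minus field_simps)
  also have "exp ((t / v)\<^sup>2 * v / 2) * exp (- (t / v * t)) = exp (- t\<^sup>2 / (2 * v))"
    using \<open>v > 0\<close> by (simp add: exp_add[symmetric] power2_eq_square field_simps)
  finally show ?thesis .
qed

text \<open>Hoeffding's inequality; the one-sided bound is applied to \<open>c\<close> and to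
  \<open>- c\<close>. Only an upper bound \<open>v\<close> on the variance enters, so that one
  \<open>v\<close> can serve a whole net.\<close>

lemma card_signs_tail:
  assumes "finite I" "inj_on e F" "e ` F \<subseteq> I" and v: "(\<Sum>f\<in>F. (c f)\<^sup>2) \<le> v" "v > 0" and "t \<ge> 0"
  shows "real (card {s \<in> signs I. \<bar>\<Sum>f\<in>F. s (e f) * c f\<bar> > t})
    \<le> 2 * real (card (signs I)) * exp (- t\<^sup>2 / (2 * v))"
proof -
  have one_sided: "real (card {s \<in> signs I. (\<Sum>f\<in>F. s (e f) * c f) > t})
      \<le> real (card (signs I)) * exp (- t\<^sup>2 / (2 * v))" if "(\<Sum>f\<in>F. (c f)\<^sup>2) \<le> v" for c
  proof (rule card_le_exp_moment)
    have "(\<Sum>s\<in>signs I. exp (t / v * (\<Sum>f\<in>F. s (e f) * c f)))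
      = (\<Sum>s\<in>signs I. exp (\<Sum>f\<in>F. s (e f) * (t / v * c f)))"
      by (simp add: sum_distrib_left mult_ac)
    also have "\<dots> \<le> real (card (signs I)) * exp ((\<Sum>f\<in>F. (t / v * c f)\<^sup>2) / 2)"
      by (rule sum_signs_exp) (use assms in auto)
    also have "(\<Sum>f\<in>F. (t / v * c f)\<^sup>2) = (t / v)\<^sup>2 * (\<Sum>f\<in>F. (c f)\<^sup>2)"
      by (simp only: power_mult_distrib sum_distrib_left)
    also have "real (card (signs I)) * exp ((t / v)\<^sup>2 * (\<Sum>f\<in>F. (c f)\<^sup>2) / 2)
        \<le> real (card (signs I)) * exp ((t / v)\<^sup>2 * v / 2)"
      using that by (intro mult_left_mono exp_mono divide_right_mono) auto
    finally show "(\<Sum>s\<in>signs I. exp (t / v * (\<Sum>f\<in>F. s (e f) * c f)))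
      \<le> real (card (signs I)) * exp ((t / v)\<^sup>2 * v / 2)"
      .
  qed (use assms finite_signs in \<open>auto simp: less_imp_le\<close>)
  have "{s \<in> signs I. \<bar>\<Sum>f\<in>F. s (e f) * c f\<bar> > t}
    = {s \<in> signs I. (\<Sum>f\<in>F. s (e f) * c f) > t} \<union> {s \<in> signs I. (\<Sum>f\<in>F. s (e f) * - c f) > t}"
    by (simp only: mult_minus_right sum_negf) (auto simp: abs_if)
  then have "card {s \<in> signs I. \<bar>\<Sum>f\<in>F. s (e f) * c f\<bar> > t}
    \<le> card {s \<in> signs I. (\<Sum>f\<in>F. s (e f) * c f) > t} + card {s \<in> signs I. (\<Sum>f\<in>F. s (e f) * - c f) > t}"
    by (simp only: card_Un_le)
  then have "real (card {s \<in> signs I. \<bar>\<Sum>f\<in>F. s (e f) * c f\<bar> > t})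
    \<le> real (card {s \<in> signs I. (\<Sum>f\<in>F. s (e f) * c f) > t}) + real (card {s \<in> signs I. (\<Sum>f\<in>F. s (e f) * - c f) > t})"
    by linarith
  with one_sided[of c] one_sided[of "\<lambda>f. - c f"] v show ?thesis by simp
qed

lemma card_UN_le_real:
  assumes "finite L" "\<And>l. l \<in> L \<Longrightarrow> real (card (B l)) \<le> w"
  shows "real (card (\<Union>l\<in>L. B l)) \<le> real (card L) * w"
proof -
  have "real (card (\<Union>l\<in>L. B l)) \<le> (\<Sum>l\<in>L. real (card (B l)))"
    using card_UN_le[OF \<open>finite L\<close>, of B] by (metis of_nat_le_iff of_nat_sum)
  also have "\<dots> \<le> (\<Sum>l\<in>L. w)" by (intro sum_mono assms)
  finally show ?thesis by simp
qed

lemma card_signs_tail_family: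
  assumes "finite I" "inj_on e F" "e ` F \<subseteq> I" "finite L"
    and v: "\<And>l. l \<in> L \<Longrightarrow> (\<Sum>f\<in>F. (c l f)\<^sup>2) \<le> v" "v > 0" and "t \<ge> 0"
  shows "real (card {s \<in> signs I. \<exists>l\<in>L. \<bar>\<Sum>f\<in>F. s (e f) * c l f\<bar> > t})
    \<le> real (card L) * (2 * real (card (signs I)) * exp (- t\<^sup>2 / (2 * v)))"
proof -
  have "{s \<in> signs I. \<exists>l\<in>L. \<bar>\<Sum>f\<in>F. s (e f) * c l f\<bar> > t}
    = (\<Union>l\<in>L. {s \<in> signs I. \<bar>\<Sum>f\<in>F. s (e f) * c l f\<bar> > t})" by auto
  then show ?thesis
    using card_UN_le_real[OF \<open>finite L\<close>, of "\<lambda>l. {s \<in> signs I. \<bar>\<Sum>f\<in>F. s (e f) * c l f\<bar> > t}"]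
      card_signs_tail[OF assms(1-3) v \<open>t \<ge> 0\<close>] by simp
qed

lemma L2_set_power2: "(L2_set f A)\<^sup>2 = (\<Sum>i\<in>A. (f i)\<^sup>2)"
  unfolding L2_set_def by (simp add: sum_nonneg)

lemma L2_set_le_iff: "b \<ge> 0 \<Longrightarrow> L2_set f A \<le> b \<longleftrightarrow> (\<Sum>i\<in>A. (f i)\<^sup>2) \<le> b\<^sup>2"
  by (metis L2_set_nonneg L2_set_power2 abs_le_square_iff abs_of_nonneg)

lemma L2_set_scale: "L2_set (\<lambda>i. r * f i) A = \<bar>r\<bar> * L2_set f A"
  unfolding L2_set_def
  by (simp add: power_mult_distrib real_sqrt_mult flip: sum_distrib_left)

lemma abs_sum_mult_le_L2: "\<bar>\<Sum>i\<in>A. f i * g i\<bar> \<le> L2_set f A * L2_set g A"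
proof -
  have "\<bar>\<Sum>i\<in>A. f i * g i\<bar> \<le> (\<Sum>i\<in>A. \<bar>f i\<bar> * \<bar>g i\<bar>)"
    using sum_abs[of "\<lambda>i. f i * g i" A] by (simp add: abs_mult)
  then show ?thesis using L2_set_mult_ineq[of f g A] by linarith
qed

section \<open>Lattice points in Euclidean balls, and nets\<close>

lemma abs_le_square: "\<bar>z\<bar> \<le> z\<^sup>2" for z :: int
proof (cases "z = 0")
  case False
  then have "1 * \<bar>z\<bar> \<le> \<bar>z\<bar> * \<bar>z\<bar>" by (intro mult_right_mono) auto
  then show ?thesis by (simp add: power2_eq_square)
qed auto

lemma sum_symmetric_geometric:
  fixes r :: real
  assumes "r \<noteq> 1"
  shows "(\<Sum>z\<in>{- int K..int K}. r ^ nat \<bar>z\<bar>) = (1 + r - 2 * r ^ Suc K) / (1 - r)"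
proof (induction K)
  case 0
  show ?case using assms by (simp add: field_simps)
next
  case (Suc K)
  have "{- int (Suc K)..int (Suc K)} = insert (int (Suc K)) (insert (- int (Suc K)) {- int K..int K})"
    by auto
  then have "(\<Sum>z\<in>{- int (Suc K)..int (Suc K)}. r ^ nat \<bar>z\<bar>)
    = 2 * r ^ Suc K + (\<Sum>z\<in>{- int K..int K}. r ^ nat \<bar>z\<bar>)"
    by (simp add: nat_add_distrib)
  then show ?case using assms Suc.IH by (simp add: field_simps)
qed

text \<open>Since z^2 is at least |z| for integers, the Gaussian sum is dominated by a geometric
  series of ratio exp(-\<theta>), uniformly in the cutoff \<open>K\<close>.\<close>

lemma sum_gaussian_integers_le:
  fixes \<theta> :: real
  assumes "0 < \<theta>" "\<theta> \<le> 1"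
  shows "(\<Sum>z\<in>{- int K..int K}. exp (- \<theta> * (real_of_int z)\<^sup>2)) \<le> 3 / \<theta>"
proof -
  define r where "r = exp (- \<theta>)"
  have "exp \<theta> \<ge> 1 + \<theta>" by (rule exp_ge_add_one_self)
  then have r: "r > 0" "r < 1" "r * (1 + \<theta>) \<le> 1"
    using assms by (auto simp: r_def exp_minus field_simps)
  have "exp (- \<theta> * (real_of_int z)\<^sup>2) \<le> r ^ nat \<bar>z\<bar>" for z
  proof -
    have "real_of_int \<bar>z\<bar> \<le> (real_of_int z)\<^sup>2" by (metis abs_le_square of_int_le_iff of_int_power)
    then have "\<theta> * real (nat \<bar>z\<bar>) \<le> \<theta> * (real_of_int z)\<^sup>2" using assms by simp
    then show ?thesis by (simp add: r_def exp_of_nat_mult[symmetric] mult.commute)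
  qed
  then have "(\<Sum>z\<in>{- int K..int K}. exp (- \<theta> * (real_of_int z)\<^sup>2)) \<le> (\<Sum>z\<in>{- int K..int K}. r ^ nat \<bar>z\<bar>)"
    by (intro sum_mono)
  also have "\<dots> \<le> (1 + r) / (1 - r)"
    using r by (subst sum_symmetric_geometric) (auto intro!: divide_right_mono)
  also have "\<dots> \<le> 3 / \<theta>"
  proof -
    have "r \<le> 1 / (1 + \<theta>)" using r assms by (simp add: field_simps)
    moreover have "1 / (1 + \<theta>) \<le> 1 - \<theta> / 2"
      using assms mult_mono[of \<theta> 1 \<theta> 1] by (simp add: field_simps)
    ultimately have "\<theta> \<le> 2 - 2 * r" by simp
    moreover have "r * \<theta> \<le> 1 - r" using r by (simp add: algebra_simps)
    ultimately have "(1 + r) * \<theta> \<le> 3 * (1 - r)" by (simp add: algebra_simps)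
    then show ?thesis using r assms by (simp add: divide_le_eq le_divide_eq)
  qed
  finally show ?thesis .
qed

text \<open>Exponential weights replace volumes: a vector in the ball has weight exp(-\<theta>
  |z|^2) at least exp(-4 card I), and the total weight factors into one-dimensional Gaussian sums.
  The bound is uniform in the size \<open>K\<close> of the box.\<close>

lemma card_bounded_integer_vectors:
  fixes \<theta> :: real
  assumes "finite I" "0 < \<theta>" "\<theta> \<le> 1"
  shows "real (card {z \<in> (\<Pi>\<^sub>E i\<in>I. {- int K..int K}). (\<Sum>i\<in>I. (real_of_int (z i))\<^sup>2) \<le> 4 * real (card I) / \<theta>})
    \<le> (300 / \<theta>) ^ card I" (is "real (card ?Z) \<le> _")
proof -
  let ?P = "\<Pi>\<^sub>E i\<in>I. {- int K..int K}"
  have finP: "finite ?P" using assms by (intro finite_PiE) auto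
  have "real (card ?Z) * exp (- 4 * real (card I)) = (\<Sum>z\<in>?Z. exp (- 4 * real (card I)))" by simp
  also have "\<dots> \<le> (\<Sum>z\<in>?Z. exp (- \<theta> * (\<Sum>i\<in>I. (real_of_int (z i))\<^sup>2)))"
    by (intro sum_mono) (use assms in \<open>auto simp: field_simps\<close>)
  also have "\<dots> \<le> (\<Sum>z\<in>?P. exp (- \<theta> * (\<Sum>i\<in>I. (real_of_int (z i))\<^sup>2)))"
    by (intro sum_mono2) (use finP in auto)
  also have "\<dots> = (\<Sum>z\<in>?P. \<Prod>i\<in>I. exp (- \<theta> * (real_of_int (z i))\<^sup>2))"
    using assms by (simp add: exp_sum[symmetric] sum_distrib_left)
  also have "\<dots> = (\<Prod>i\<in>I. \<Sum>z\<in>{- int K..int K}. exp (- \<theta> * (real_of_int z)\<^sup>2))"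
    by (rule prod_sum_PiE[symmetric]) (use assms in auto)
  also have "\<dots> \<le> (\<Prod>i\<in>I. 3 / \<theta>)"
    by (intro prod_mono conjI sum_nonneg sum_gaussian_integers_le) (use assms in auto)
  finally have *: "real (card ?Z) * exp (- 4 * real (card I)) \<le> (3 / \<theta>) ^ card I" by simp
  \<comment> \<open>The resulting base is 3 exp 4, at most 243, rounded up to 300.\<close>
  have "exp (4::real) = exp 1 ^ 4" by (simp add: exp_of_nat_mult[symmetric])
  also have "\<dots> \<le> 3 ^ 4" using exp_le by (intro power_mono) auto
  finally have e4: "exp (4::real) \<le> 81" by simp
  have "exp (4 * real (card I)) = exp 4 ^ card I" by (simp add: exp_of_nat_mult[symmetric] mult.commute)
  then have "real (card ?Z) \<le> (3 / \<theta>) ^ card I * exp 4 ^ card I"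
    using * by (simp add: exp_minus field_simps)
  also have "\<dots> = (3 / \<theta> * exp 4) ^ card I" by (simp only: power_mult_distrib)
  also have "\<dots> \<le> (300 / \<theta>) ^ card I"
    using e4 assms by (intro power_mono) (auto simp: field_simps)
  finally show ?thesis .
qed

text \<open>Net points may lie outside the ball. Later only those of norm at most 2 are kept, which
  suffices when \<open>\<eta>\<close> is at most 1.\<close>

definition is_net :: "real \<Rightarrow> 'a set \<Rightarrow> ('a \<Rightarrow> real) set \<Rightarrow> bool" where
  "is_net \<eta> I N \<longleftrightarrow> finite N \<and> (\<forall>x. L2_set x I \<le> 1 \<longrightarrow> (\<exists>y\<in>N. L2_set (\<lambda>i. x i - y i) I \<le> \<eta>))"

text \<open>Rounding down to the lattice of mesh \<eta> / sqrt d moves each coordinate by at most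
  the mesh, hence the vector by at most \<eta>, and leaves it with norm at most 2. The power
  \<eta>^2 in the count costs only a constant factor in the logarithm.\<close>

lemma L2_net_exists:
  fixes \<eta> :: real
  assumes fin: "finite I" "I \<noteq> {}" and eta: "0 < \<eta>" "\<eta> \<le> 1"
  obtains N where "is_net \<eta> I N" "real (card N) \<le> (300 / \<eta>\<^sup>2) ^ card I"
proof -
  define d where "d = real (card I)"
  have d: "d > 0" using fin by (simp add: d_def card_gt_0_iff)
  define \<delta> where "\<delta> = \<eta> / sqrt d"
  have delta: "\<delta> > 0" "d * \<delta>\<^sup>2 = \<eta>\<^sup>2" using d eta by (auto simp: \<delta>_def power_divide)
  \<comment> \<open>Large enough for the box to contain every integer vector of squared norm at most
    4 d / \<eta>^2, because |z_i| is at most z_i^2.\<close>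
  define K where "K = nat \<lceil>4 * d / \<eta>\<^sup>2\<rceil>"
  have K: "4 * d / \<eta>\<^sup>2 \<le> real K" unfolding K_def by linarith
  let ?Z = "{z \<in> (\<Pi>\<^sub>E i\<in>I. {- int K..int K}). (\<Sum>i\<in>I. (real_of_int (z i))\<^sup>2) \<le> 4 * real (card I) / \<eta>\<^sup>2}"
  define N where "N = (\<lambda>z i. \<delta> * real_of_int (z i)) ` ?Z"
  have finZ: "finite ?Z"
    using fin by (intro finite_subset[OF _ finite_PiE[of I "\<lambda>_. {- int K..int K}"]]) auto
  have "\<eta>\<^sup>2 \<le> 1" using eta by (simp add: power_le_one)
  then have "real (card ?Z) \<le> (300 / \<eta>\<^sup>2) ^ card I"
    using fin eta by (intro card_bounded_integer_vectors) auto
  moreover have "card N \<le> card ?Z" unfolding N_def by (rule card_image_le[OF finZ])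
  ultimately have "real (card N) \<le> (300 / \<eta>\<^sup>2) ^ card I" by linarith
  moreover have "\<exists>y\<in>N. L2_set (\<lambda>i. x i - y i) I \<le> \<eta>" if x: "L2_set x I \<le> 1" for x
  proof -
    define z where "z = restrict (\<lambda>i. \<lfloor>x i / \<delta>\<rfloor>) I"
    define y where "y = (\<lambda>i. \<delta> * real_of_int (z i))"
    have "\<bar>x i - y i\<bar> \<le> \<delta>" if "i \<in> I" for i
    proof -
      have "0 \<le> x i / \<delta> - of_int \<lfloor>x i / \<delta>\<rfloor>" "x i / \<delta> - of_int \<lfloor>x i / \<delta>\<rfloor> \<le> 1" by linarith+
      moreover have "x i - y i = \<delta> * (x i / \<delta> - of_int \<lfloor>x i / \<delta>\<rfloor>)"
        using that delta by (simp add: y_def z_def algebra_simps)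
      ultimately show ?thesis using delta by (simp add: abs_mult)
    qed
    then have "(\<Sum>i\<in>I. (x i - y i)\<^sup>2) \<le> (\<Sum>i\<in>I. \<delta>\<^sup>2)"
      using delta by (intro sum_mono) (metis abs_le_square_iff abs_of_pos)
    also have "\<dots> = \<eta>\<^sup>2" using delta by (simp add: d_def)
    finally have xy: "L2_set (\<lambda>i. x i - y i) I \<le> \<eta>" using eta by (subst L2_set_le_iff) auto
    have "L2_set y I \<le> L2_set x I + L2_set (\<lambda>i. - 1 * (x i - y i)) I"
      using L2_set_triangle_ineq[of x "\<lambda>i. - 1 * (x i - y i)" I] by simp
    also have "\<dots> \<le> 2" using xy x eta unfolding L2_set_scale by simp
    finally have "(\<Sum>i\<in>I. (y i)\<^sup>2) \<le> 4" by (subst (asm) L2_set_le_iff) auto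
    then have "\<delta>\<^sup>2 * (\<Sum>i\<in>I. (real_of_int (z i))\<^sup>2) \<le> 4"
      by (simp add: y_def power_mult_distrib sum_distrib_left)
    moreover have "\<delta>\<^sup>2 = \<eta>\<^sup>2 / d" using delta d by (simp add: field_simps)
    ultimately have z2: "(\<Sum>i\<in>I. (real_of_int (z i))\<^sup>2) \<le> 4 * d / \<eta>\<^sup>2"
      using d eta by (simp add: field_simps)
    have "z i \<in> {- int K..int K}" if "i \<in> I" for i
    proof -
      have "(real_of_int (z i))\<^sup>2 \<le> (\<Sum>i\<in>I. (real_of_int (z i))\<^sup>2)"
        using fin that by (intro member_le_sum) auto
      then have "(real_of_int (z i))\<^sup>2 \<le> real K" using z2 K by linarith
      then have "(z i)\<^sup>2 \<le> int K" by (metis of_int_le_iff of_int_of_nat_eq of_int_power)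
      then have "\<bar>z i\<bar> \<le> int K" using abs_le_square[of "z i"] by linarith
      then show ?thesis by auto
    qed
    then have "z \<in> ?Z" using z2 by (auto simp: z_def d_def)
    then have "y \<in> N" by (auto simp: N_def y_def)
    with xy show ?thesis by blast
  qed
  ultimately show ?thesis using that[of N] finZ by (auto simp: is_net_def N_def)
qed

section \<open>Multilinear forms\<close>

lemma sum_rotate: "(\<Sum>x\<in>A. \<Sum>y\<in>B. \<Sum>z\<in>C. \<phi> x y z) = (\<Sum>z\<in>C. \<Sum>x\<in>A. \<Sum>y\<in>B. \<phi> x y z)"
  by (simp add: sum.swap[of _ C])

lemma sum_PiE_insert:
  assumes "j \<notin> J"
  shows "(\<Sum>f\<in>Pi\<^sub>E (insert j J) A. \<phi> f) = (\<Sum>f\<in>Pi\<^sub>E J A. \<Sum>i\<in>A j. \<phi> (f(j := i)))"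
proof -
  have "(\<Sum>f\<in>Pi\<^sub>E (insert j J) A. \<phi> f) = (\<Sum>(i, f)\<in>A j \<times> Pi\<^sub>E J A. \<phi> (f(j := i)))"
    unfolding PiE_insert_eq using assms
    by (subst sum.reindex[OF inj_combinator]) (auto simp: case_prod_unfold)
  also have "\<dots> = (\<Sum>f\<in>Pi\<^sub>E J A. \<Sum>i\<in>A j. \<phi> (f(j := i)))"
    by (subst sum.swap) (simp add: sum.cartesian_product)
  finally show ?thesis .
qed

lemma sum_PiE_pairs:
  "(\<Sum>f\<in>(\<Pi>\<^sub>E j\<in>J. A j \<times> B j). \<phi> f)
    = (\<Sum>p\<in>Pi\<^sub>E J A. \<Sum>q\<in>Pi\<^sub>E J B. \<phi> (\<lambda>j\<in>J. (p j, q j)))"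
proof -
  have "(\<Sum>f\<in>(\<Pi>\<^sub>E j\<in>J. A j \<times> B j). \<phi> f)
    = (\<Sum>(p, q)\<in>Pi\<^sub>E J A \<times> Pi\<^sub>E J B. \<phi> (\<lambda>j\<in>J. (p j, q j)))"
    by (rule sum.reindex_bij_witness[of _ "\<lambda>(p, q). \<lambda>j\<in>J. (p j, q j)"
          "\<lambda>f. (\<lambda>j\<in>J. fst (f j), \<lambda>j\<in>J. snd (f j))"])
       (auto simp: PiE_iff fun_eq_iff extensional_def mem_Times_iff intro!: arg_cong[of _ _ \<phi>])
  then show ?thesis by (simp add: sum.cartesian_product)
qed

text \<open>The least constant bounding |mlf J A T x| by the product of the norms of the slots is
  the injective norm of the tensor \<open>T\<close>; the norm bounds below take this form.\<close>

definition mlf :: "'j set \<Rightarrow> ('j \<Rightarrow> 'i set) \<Rightarrow> (('j \<Rightarrow> 'i) \<Rightarrow> real) \<Rightarrow> ('j \<Rightarrow> 'i \<Rightarrow> real) \<Rightarrow> real" where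
  "mlf J A T x = (\<Sum>f\<in>Pi\<^sub>E J A. T f * (\<Prod>j\<in>J. x j (f j)))"

lemma mlf_cong:
  assumes "\<And>j i. j \<in> J \<Longrightarrow> i \<in> A j \<Longrightarrow> x j i = y j i"
  shows "mlf J A T x = mlf J A T y"
proof -
  have "(\<Prod>j\<in>J. x j (f j)) = (\<Prod>j\<in>J. y j (f j))" if "f \<in> Pi\<^sub>E J A" for f
    using that by (intro prod.cong refl assms) auto
  then show ?thesis unfolding mlf_def by simp
qed

lemma prod_fun_upd_remove:
  assumes "finite J" "j \<in> J"
  shows "(\<Prod>l\<in>J. (x(j := v)) l (f l)) = v (f j) * (\<Prod>l\<in>J - {j}. x l (f l))"
proof -
  have "(\<Prod>l\<in>J. (x(j := v)) l (f l)) = v (f j) * (\<Prod>l\<in>J - {j}. (x(j := v)) l (f l))"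
    using assms by (subst prod.remove[of _ j]) auto
  also have "(\<Prod>l\<in>J - {j}. (x(j := v)) l (f l)) = (\<Prod>l\<in>J - {j}. x l (f l))"
    by (rule prod.cong) auto
  finally show ?thesis .
qed

text \<open>Linearity in slot \<open>j\<close>: the coefficients are the values at the standard
  basis vectors. They form a vector whose norm can then be bounded by duality.\<close>

lemma mlf_slot:
  assumes "finite J" "j \<in> J" "finite (A j)"
  shows "mlf J A T (x(j := v)) = (\<Sum>i\<in>A j. mlf J A T (x(j := (\<lambda>i'. of_bool (i' = i)))) * v i)"
proof -
  have "mlf J A T (x(j := v)) = (\<Sum>f\<in>Pi\<^sub>E J A. T f * (v (f j) * (\<Prod>l\<in>J - {j}. x l (f l))))"
    unfolding mlf_def prod_fun_upd_remove[OF assms(1,2)] ..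
  also have "\<dots> = (\<Sum>f\<in>Pi\<^sub>E J A. \<Sum>i\<in>A j. T f * (of_bool (f j = i) * (\<Prod>l\<in>J - {j}. x l (f l))) * v i)"
  proof (rule sum.cong[OF refl])
    fix f assume "f \<in> Pi\<^sub>E J A"
    then have "f j \<in> A j" using assms by auto
    have "(\<Sum>i\<in>A j. T f * (of_bool (f j = i) * (\<Prod>l\<in>J - {j}. x l (f l))) * v i)
      = (\<Sum>i\<in>A j. if i = f j then T f * (\<Prod>l\<in>J - {j}. x l (f l)) * v i else 0)"
      by (rule sum.cong) auto
    also have "\<dots> = T f * (v (f j) * (\<Prod>l\<in>J - {j}. x l (f l)))"
      using \<open>f j \<in> A j\<close> assms by (simp add: mult_ac)
    finally show "T f * (v (f j) * (\<Prod>l\<in>J - {j}. x l (f l)))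
      = (\<Sum>i\<in>A j. T f * (of_bool (f j = i) * (\<Prod>l\<in>J - {j}. x l (f l))) * v i)" by simp
  qed
  also have "\<dots> = (\<Sum>i\<in>A j. (\<Sum>f\<in>Pi\<^sub>E J A. T f * (of_bool (f j = i) * (\<Prod>l\<in>J - {j}. x l (f l)))) * v i)"
    unfolding sum_distrib_right by (rule sum.swap)
  also have "\<dots> = (\<Sum>i\<in>A j. mlf J A T (x(j := (\<lambda>i'. of_bool (i' = i)))) * v i)"
    unfolding mlf_def prod_fun_upd_remove[OF assms(1,2)] ..
  finally show ?thesis .
qed

lemma mlf_add:
  assumes "finite J" "j \<in> J" "finite (A j)"
  shows "mlf J A T (x(j := (\<lambda>i. u i + v i))) = mlf J A T (x(j := u)) + mlf J A T (x(j := v))"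
  unfolding mlf_slot[OF assms(1,2), where A=A, OF assms(3), of T x u]
    mlf_slot[OF assms(1,2), where A=A, OF assms(3), of T x v]
    mlf_slot[OF assms(1,2), where A=A, OF assms(3), of T x "\<lambda>i. u i + v i"]
  by (simp only: ring_distribs sum.distrib)

text \<open>Duality and absorption: \<open>c\<close> is tested on a net point near c / |c|, and the
  rounding error, at most |c| / 2, is moved to the other side.\<close>

lemma L2_le_of_net:
  assumes fin: "finite I" and net: "is_net \<eta> I N" "\<eta> \<le> 1 / 2" and t: "t \<ge> 0"
    and bnd: "\<And>y. y \<in> N \<Longrightarrow> L2_set y I \<le> 2 \<Longrightarrow> \<bar>\<Sum>i\<in>I. c i * y i\<bar> \<le> t"
  shows "L2_set c I \<le> 2 * t"
proof (cases "L2_set c I = 0")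
  case False
  define r where "r = L2_set c I"
  have r: "r > 0" using False L2_set_nonneg[of c I] by (simp add: r_def order_less_le)
  define x where "x = (\<lambda>i. (1 / r) * c i)"
  have x: "L2_set x I = 1" unfolding x_def L2_set_scale using r by (simp add: r_def)
  then obtain y where y: "y \<in> N" "L2_set (\<lambda>i. x i - y i) I \<le> \<eta>"
    using net(1) unfolding is_net_def by (metis order.refl)
  have "L2_set y I \<le> L2_set x I + L2_set (\<lambda>i. - 1 * (x i - y i)) I"
    using L2_set_triangle_ineq[of x "\<lambda>i. - 1 * (x i - y i)" I] by simp
  also have "\<dots> \<le> 2" unfolding L2_set_scale using x y net by simp
  finally have "\<bar>\<Sum>i\<in>I. c i * y i\<bar> \<le> t" by (rule bnd[OF y(1)])
  moreover have "\<bar>\<Sum>i\<in>I. c i * (x i - y i)\<bar> \<le> r * (1 / 2)"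
    using abs_sum_mult_le_L2[of c "\<lambda>i. x i - y i" I] y net r
    by (metis (no_types, lifting) r_def dual_order.trans mult_left_mono less_imp_le)
  moreover have "(\<Sum>i\<in>I. c i * y i) + (\<Sum>i\<in>I. c i * (x i - y i)) = (\<Sum>i\<in>I. c i * x i)"
    by (simp add: sum.distrib[symmetric] algebra_simps)
  moreover have "(\<Sum>i\<in>I. c i * x i) = r"
  proof -
    have "(\<Sum>i\<in>I. c i * x i) = (1 / r) * (\<Sum>i\<in>I. (c i)\<^sup>2)"
      by (simp add: x_def sum_distrib_left power2_eq_square)
    also have "(\<Sum>i\<in>I. (c i)\<^sup>2) = r\<^sup>2" by (simp add: r_def L2_set_power2)
    finally show ?thesis using r by (simp add: power2_eq_square)
  qed
  ultimately show ?thesis using r_def by linarith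
qed (use t in simp)

text \<open>The slots are released from their nets one at a time. Releasing a slot applies
  \<open>L2_le_of_net\<close> to the linear functional in that slot and costs a factor 2.\<close>

lemma mlf_le_of_nets:
  assumes fin: "finite J" "\<And>j. j \<in> J \<Longrightarrow> finite (A j)" and t: "t \<ge> 0"
    and net: "\<And>j. j \<in> J \<Longrightarrow> is_net (1 / 2) (A j) (N j)"
    and bnd: "\<And>y. (\<And>j. j \<in> J \<Longrightarrow> y j \<in> N j \<and> L2_set (y j) (A j) \<le> 2) \<Longrightarrow> \<bar>mlf J A T y\<bar> \<le> t"
  shows "\<bar>mlf J A T x\<bar> \<le> 2 ^ card J * t * (\<Prod>j\<in>J. L2_set (x j) (A j))"
proof -
  have "\<bar>mlf J A T x\<bar> \<le> 2 ^ card S * t * (\<Prod>j\<in>S. L2_set (x j) (A j))"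
    if "S \<subseteq> J" "\<And>j. j \<in> J - S \<Longrightarrow> x j \<in> N j \<and> L2_set (x j) (A j) \<le> 2" for S x
    using finite_subset[OF that(1) fin(1)] that
  proof (induction S arbitrary: x rule: finite_induct)
    case empty
    then show ?case using bnd[of x] by auto
  next
    case (insert j S)
    have j: "j \<in> J" using insert.prems by auto
    let ?c = "\<lambda>i. mlf J A T (x(j := (\<lambda>i'. of_bool (i' = i))))"
    let ?b = "2 ^ card S * t * (\<Prod>j\<in>S. L2_set (x j) (A j))"
    have "L2_set ?c (A j) \<le> 2 * ?b"
    proof (rule L2_le_of_net[OF fin(2)[OF j] net[OF j]])
      fix y assume y: "y \<in> N j" "L2_set y (A j) \<le> 2"
      have "\<bar>mlf J A T (x(j := y))\<bar> \<le> 2 ^ card S * t * (\<Prod>l\<in>S. L2_set ((x(j := y)) l) (A l))"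
        using insert.prems y by (intro insert.IH) auto
      also have "(\<Prod>l\<in>S. L2_set ((x(j := y)) l) (A l)) = (\<Prod>l\<in>S. L2_set (x l) (A l))"
        using insert.hyps by (intro prod.cong) auto
      finally show "\<bar>\<Sum>i\<in>A j. ?c i * y i\<bar> \<le> ?b"
        unfolding mlf_slot[OF fin(1) j, where A=A, OF fin(2)[OF j], of T x y] .
    qed (use t in \<open>auto intro!: mult_nonneg_nonneg prod_nonneg\<close>)
    moreover have "mlf J A T x = (\<Sum>i\<in>A j. ?c i * x j i)"
      using mlf_slot[OF fin(1) j, where A=A, OF fin(2)[OF j], of T x "x j"]
      unfolding fun_upd_triv .
    ultimately have "\<bar>mlf J A T x\<bar> \<le> 2 * ?b * L2_set (x j) (A j)"
      using abs_sum_mult_le_L2[of ?c "x j" "A j"] mult_right_mono[of "L2_set ?c (A j)" "2 * ?b" "L2_set (x j) (A j)"]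
      by simp
    then show ?case using insert.hyps by (simp add: mult_ac)
  qed
  from this[of J x] show ?thesis by simp
qed

text \<open>2^s comes from releasing \<open>s\<close> slots from their nets, 4^s bounds the variance
  for net vectors of norm at most 2, 8 d bounds the logarithm of the number of net tuples, and the
  added 4 makes the failure probability small.\<close>

definition net_bound :: "nat \<Rightarrow> real \<Rightarrow> real" where
  "net_bound s d = 2 ^ s * sqrt (2 * 4 ^ s * (8 * d + 4))"

lemma prod_sum_squares_PiE:
  assumes "finite J" "\<And>j. j \<in> J \<Longrightarrow> finite (A j)"
  shows "(\<Sum>f\<in>Pi\<^sub>E J A. (\<Prod>j\<in>J. y j (f j))\<^sup>2) = (\<Prod>j\<in>J. (L2_set (y j) (A j))\<^sup>2 :: real)"
  using assms by (simp add: L2_set_power2 prod_sum_PiE prod_power_distrib)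

lemma exp_numeral_ge: "(5 / 2) ^ n \<le> exp (real n)"
proof -
  have "5 / 2 \<le> exp (1::real)" using exp_lower_Taylor_quadratic[of 1] by simp
  then have "(5 / 2) ^ n \<le> exp (1::real) ^ n" by (intro power_mono) auto
  then show ?thesis by (simp add: exp_of_nat_mult[symmetric])
qed

text \<open>A random sign tensor has injective norm of the order of the square root of the sum of
  its dimensions: Hoeffding for each tuple of net vectors, then a union bound.\<close>

lemma random_tensor_norm:
  assumes fin: "finite J" "\<And>j. j \<in> J \<Longrightarrow> finite (A j) \<and> A j \<noteq> {}"
    and Om: "finite \<Omega>" "inj_on e (Pi\<^sub>E J A)" "e ` Pi\<^sub>E J A \<subseteq> \<Omega>"
  shows "real (card {s \<in> signs \<Omega>. \<not> (\<forall>x. \<bar>mlf J A (\<lambda>f. s (e f)) x\<bar>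
      \<le> net_bound (card J) (\<Sum>j\<in>J. real (card (A j))) * (\<Prod>j\<in>J. L2_set (x j) (A j)))})
    \<le> real (card (signs \<Omega>)) / 8" (is "real (card ?Bad) \<le> _")
proof -
  define d where "d = (\<Sum>j\<in>J. real (card (A j)))"
  define v where "v = (4::real) ^ card J"
  define t where "t = sqrt (2 * v * (8 * d + 4))"
  have d: "d \<ge> 0" by (simp add: d_def sum_nonneg)
  then have t: "t \<ge> 0" "t\<^sup>2 = 2 * v * (8 * d + 4)" by (auto simp: t_def v_def)
  have "\<exists>N. is_net (1 / 2) (A j) N \<and> real (card N) \<le> 1200 ^ card (A j)" if j: "j \<in> J" for j
  proof -
    obtain N where "is_net (1 / 2) (A j) N" "real (card N) \<le> (300 / (1 / 2)\<^sup>2) ^ card (A j)"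
      by (rule L2_net_exists[of "A j" "1 / 2"]) (use fin(2)[OF j] in auto)
    then show ?thesis by (auto simp: power_divide)
  qed
  then obtain N where N: "\<And>j. j \<in> J \<Longrightarrow> is_net (1 / 2) (A j) (N j)"
    "\<And>j. j \<in> J \<Longrightarrow> real (card (N j)) \<le> 1200 ^ card (A j)" by metis
  define N' where "N' j = {y \<in> N j. L2_set y (A j) \<le> 2}" for j
  define L where "L = Pi\<^sub>E J N'"
  have finN: "j \<in> J \<Longrightarrow> finite (N j)" for j using N by (simp add: is_net_def)
  then have finL: "finite L" unfolding L_def N'_def using fin by (intro finite_PiE) auto
  have "real (card L) = (\<Prod>j\<in>J. real (card (N' j)))"
    unfolding L_def using fin by (simp add: card_PiE)
  also have "\<dots> \<le> (\<Prod>j\<in>J. exp (8 * real (card (A j))))"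
  proof (intro prod_mono conjI)
    fix j assume j: "j \<in> J"
    have "card (N' j) \<le> card (N j)" unfolding N'_def using finN[OF j] by (intro card_mono) auto
    then have "real (card (N' j)) \<le> 1200 ^ card (A j)" using N(2)[OF j] by linarith
    \<comment> \<open>1200 = 300 / (1/2)^2 is below (5/2)^8, hence below exp 8.\<close>
    also have "\<dots> \<le> exp 8 ^ card (A j)"
      using exp_numeral_ge[of 8] by (intro power_mono) (auto simp: power_divide)
    finally show "real (card (N' j)) \<le> exp (8 * real (card (A j)))"
      by (simp add: exp_of_nat_mult[symmetric] mult.commute)
  qed auto
  also have "\<dots> = exp (8 * d)" using fin by (simp add: exp_sum d_def sum_distrib_left)
  finally have cardL: "real (card L) \<le> exp (8 * d)" .
  have "?Bad \<subseteq> {s \<in> signs \<Omega>. \<exists>y\<in>L. \<bar>\<Sum>f\<in>Pi\<^sub>E J A. s (e f) * (\<Prod>j\<in>J. y j (f j))\<bar> > t}" (is "_ \<subseteq> ?B")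
  proof (rule subsetI, rule ccontr)
    fix s assume s: "s \<in> ?Bad" "s \<notin> ?B"
    have "\<bar>mlf J A (\<lambda>f. s (e f)) x\<bar> \<le> 2 ^ card J * t * (\<Prod>j\<in>J. L2_set (x j) (A j))" for x
    proof (rule mlf_le_of_nets[OF fin(1) _ t(1) N(1)])
      fix y assume y: "\<And>j. j \<in> J \<Longrightarrow> y j \<in> N j \<and> L2_set (y j) (A j) \<le> 2"
      then have "restrict y J \<in> L" by (auto simp: L_def N'_def)
      with s have "\<bar>\<Sum>f\<in>Pi\<^sub>E J A. s (e f) * (\<Prod>j\<in>J. (restrict y J) j (f j))\<bar> \<le> t"
        by (force simp: not_less)
      then show "\<bar>mlf J A (\<lambda>f. s (e f)) y\<bar> \<le> t" by (simp add: mlf_def)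
    qed (use fin in auto)
    then show False using s unfolding net_bound_def d_def[symmetric] t_def v_def by auto
  qed
  then have "real (card ?Bad) \<le> real (card ?B)"
    using finite_signs[OF Om(1)] by (simp add: card_mono)
  also have "\<dots> \<le> real (card L) * (2 * real (card (signs \<Omega>)) * exp (- t\<^sup>2 / (2 * v)))"
  proof (rule card_signs_tail_family[OF Om finL])
    fix y assume y: "y \<in> L"
    have "(\<Sum>f\<in>Pi\<^sub>E J A. (\<Prod>j\<in>J. y j (f j))\<^sup>2) = (\<Prod>j\<in>J. (L2_set (y j) (A j))\<^sup>2)"
      using fin by (intro prod_sum_squares_PiE) auto
    also have "\<dots> \<le> (\<Prod>j\<in>J. 2\<^sup>2)"
      using y by (intro prod_mono conjI power_mono) (auto simp: L_def N'_def)
    finally show "(\<Sum>f\<in>Pi\<^sub>E J A. (\<Prod>j\<in>J. y j (f j))\<^sup>2) \<le> v" by (simp add: v_def)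
  qed (use t in \<open>auto simp: v_def\<close>)
  also have "- t\<^sup>2 / (2 * v) = - (8 * d + 4)" using t(2) by (simp add: v_def)
  also have "real (card L) * (2 * real (card (signs \<Omega>)) * exp (- (8 * d + 4)))
    \<le> exp (8 * d) * (2 * real (card (signs \<Omega>)) * exp (- (8 * d + 4)))"
    using cardL by (intro mult_right_mono) auto
  also have "\<dots> = real (card (signs \<Omega>)) * (2 * exp (- 4))"
    by (simp add: exp_add[symmetric] algebra_simps)
  also have "2 * exp (- 4) \<le> (1 / 8 :: real)"
    using exp_numeral_ge[of 4] by (simp add: exp_minus field_simps)
  finally show ?thesis by (simp add: mult_left_mono)
qed

section \<open>The injective norm of a product of two sign tensors\<close>

text \<open>A rank-one matrix, the column \<open>g\<close> times the row \<open>g'\<close>, with a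
  tuple of pairs regarded as a pair of tuples.\<close>

definition pair_tensor :: "'j set \<Rightarrow> (('j \<Rightarrow> 'i) \<Rightarrow> real) \<Rightarrow> (('j \<Rightarrow> 'i) \<Rightarrow> real) \<Rightarrow> ('j \<Rightarrow> 'i \<times> 'i) \<Rightarrow> real" where
  "pair_tensor J g g' f = g (\<lambda>j\<in>J. fst (f j)) * g' (\<lambda>j\<in>J. snd (f j))"

lemma L2_set_Times: "(L2_set B (I \<times> K))\<^sup>2 = (\<Sum>p\<in>I. (L2_set (\<lambda>q. B (p, q)) K)\<^sup>2)"
  by (simp add: L2_set_power2 sum.cartesian_product case_prod_unfold)

text \<open>This is \<open>g\<close> paired with the image of \<open>g'\<close> under the tensor
  product of the matrices B_j. Once \<open>g'\<close> and \<open>B\<close> are fixed it is linear in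
  \<open>g\<close>, so Hoeffding applies with \<open>g\<close> as the only randomness.\<close>

lemma mlf_pair_tensor:
  "mlf J (\<lambda>_. I \<times> K) (pair_tensor J g g') B
    = (\<Sum>p\<in>(\<Pi>\<^sub>E j\<in>J. I). g p * mlf J (\<lambda>_. K) g' (\<lambda>j q. B j (p j, q)))"
proof -
  have "pair_tensor J g g' (\<lambda>j\<in>J. (p j, q j)) * (\<Prod>j\<in>J. B j ((\<lambda>j\<in>J. (p j, q j)) j))
      = g p * (g' q * (\<Prod>j\<in>J. B j (p j, q j)))"
    if "p \<in> (\<Pi>\<^sub>E j\<in>J. I)" "q \<in> (\<Pi>\<^sub>E j\<in>J. K)" for p q
  proof -
    have "(\<lambda>j\<in>J. fst ((\<lambda>j\<in>J. (p j, q j)) j)) = p" "(\<lambda>j\<in>J. snd ((\<lambda>j\<in>J. (p j, q j)) j)) = q"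
      using that by (auto simp: fun_eq_iff PiE_iff extensional_def)
    then show ?thesis by (simp add: pair_tensor_def)
  qed
  then show ?thesis
    unfolding mlf_def sum_PiE_pairs sum_distrib_left by (intro sum.cong refl) simp
qed

text \<open>Row p of the tensor product puts row p_j of B_j into slot j of \<open>T\<close>. After
  \<open>E\<close> has been applied, the sum over p factors into Hilbert-Schmidt norms.\<close>

lemma mlf_rows_sum_squares_le:
  assumes fin: "finite J" "finite I" "finite K"
    and E: "\<And>u. \<bar>mlf J (\<lambda>_. K) T u\<bar> \<le> E * (\<Prod>j\<in>J. L2_set (u j) K)"
  shows "(\<Sum>p\<in>(\<Pi>\<^sub>E j\<in>J. I). (mlf J (\<lambda>_. K) T (\<lambda>j q. B j (p j, q)))\<^sup>2)
    \<le> E\<^sup>2 * (\<Prod>j\<in>J. (L2_set (B j) (I \<times> K))\<^sup>2)"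
proof -
  have "(\<Sum>p\<in>(\<Pi>\<^sub>E j\<in>J. I). (mlf J (\<lambda>_. K) T (\<lambda>j q. B j (p j, q)))\<^sup>2)
    \<le> (\<Sum>p\<in>(\<Pi>\<^sub>E j\<in>J. I). (E * (\<Prod>j\<in>J. L2_set (\<lambda>q. B j (p j, q)) K))\<^sup>2)"
  proof (rule sum_mono)
    fix p
    show "(mlf J (\<lambda>_. K) T (\<lambda>j q. B j (p j, q)))\<^sup>2 \<le> (E * (\<Prod>j\<in>J. L2_set (\<lambda>q. B j (p j, q)) K))\<^sup>2"
      using power_mono[OF E[of "\<lambda>j q. B j (p j, q)"] abs_ge_zero, of 2] by (simp only: power2_abs)
  qed
  also have "\<dots> = E\<^sup>2 * (\<Sum>p\<in>(\<Pi>\<^sub>E j\<in>J. I). \<Prod>j\<in>J. (L2_set (\<lambda>q. B j (p j, q)) K)\<^sup>2)"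
    by (simp only: power_mult_distrib sum_distrib_left prod_power_distrib)
  also have "(\<Sum>p\<in>(\<Pi>\<^sub>E j\<in>J. I). \<Prod>j\<in>J. (L2_set (\<lambda>q. B j (p j, q)) K)\<^sup>2)
      = (\<Prod>j\<in>J. \<Sum>p\<in>I. (L2_set (\<lambda>q. B j (p, q)) K)\<^sup>2)"
    using fin by (subst prod_sum_PiE) auto
  finally show ?thesis by (simp only: L2_set_Times)
qed

text \<open>The sum over the rows in slot \<open>j0\<close> is the squared norm of B_j0 c, where
  \<open>c\<close> is \<open>T\<close> contracted with the rows in the other slots. So for this one
  factor the operator norm \<tau> replaces the Hilbert-Schmidt norm.\<close>

lemma mlf_rows_sum_squares_le_op:
  assumes fin: "finite J" "finite I" "finite K"
    and E: "E \<ge> 0" "\<And>u. \<bar>mlf J (\<lambda>_. K) T u\<bar> \<le> E * (\<Prod>j\<in>J. L2_set (u j) K)"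
    and j0: "j0 \<in> J"
    and op: "\<tau> \<ge> 0" "\<And>h. L2_set (\<lambda>p. \<Sum>q\<in>K. B j0 (p, q) * h q) I \<le> \<tau> * L2_set h K"
  shows "(\<Sum>p\<in>(\<Pi>\<^sub>E j\<in>J. I). (mlf J (\<lambda>_. K) T (\<lambda>j q. B j (p j, q)))\<^sup>2)
    \<le> E\<^sup>2 * \<tau>\<^sup>2 * (\<Prod>j\<in>J - {j0}. (L2_set (B j) (I \<times> K))\<^sup>2)"
proof -
  define J' where "J' = J - {j0}"
  have J': "J = insert j0 J'" "j0 \<notin> J'" "finite J'" using j0 fin by (auto simp: J'_def)
  have slice: "(\<Sum>r\<in>I. (mlf J (\<lambda>_. K) T (\<lambda>j q. B j ((p(j0 := r)) j, q)))\<^sup>2)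
      \<le> E\<^sup>2 * \<tau>\<^sup>2 * (\<Prod>j\<in>J'. (L2_set (\<lambda>q. B j (p j, q)) K)\<^sup>2)" for p
  proof -
    define x where "x = (\<lambda>j q. B j (p j, q))"
    define c where "c = (\<lambda>q. mlf J (\<lambda>_. K) T (x(j0 := (\<lambda>i'. of_bool (i' = q)))))"
    define P where "P = (\<Prod>j\<in>J'. L2_set (x j) K)"
    have P: "P \<ge> 0" by (auto simp: P_def intro: prod_nonneg)
    have slot: "mlf J (\<lambda>_. K) T (x(j0 := u)) = (\<Sum>q\<in>K. c q * u q)" for u
      unfolding c_def by (rule mlf_slot[OF fin(1) j0, where A="\<lambda>_. K", OF fin(3)])
    \<comment> \<open>Testing the form on \<open>c\<close> itself in slot \<open>j0\<close> bounds
      |c|^2 by E P |c|.\<close>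
    have "L2_set c K * L2_set c K = mlf J (\<lambda>_. K) T (x(j0 := c))"
      unfolding slot using L2_set_power2[of c K] by (simp only: power2_eq_square)
    also have "\<dots> \<le> E * (\<Prod>j\<in>J. L2_set ((x(j0 := c)) j) K)"
      using E(2)[of "x(j0 := c)"] by linarith
    also have "(\<Prod>j\<in>J. L2_set ((x(j0 := c)) j) K) = L2_set c K * P"
    proof -
      have "(\<Prod>j\<in>J'. L2_set ((x(j0 := c)) j) K) = P"
        unfolding P_def using J' by (intro prod.cong) auto
      then show ?thesis using J' by simp
    qed
    finally have "L2_set c K * L2_set c K \<le> (E * P) * L2_set c K" by (simp add: mult_ac)
    then have c: "L2_set c K \<le> E * P"
      using P E(1) mult_nonneg_nonneg[OF E(1) P] by (cases "L2_set c K = 0") (simp_all add: order_less_le)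
    have "(\<Sum>r\<in>I. (mlf J (\<lambda>_. K) T (\<lambda>j q. B j ((p(j0 := r)) j, q)))\<^sup>2)
        = (\<Sum>r\<in>I. (\<Sum>q\<in>K. B j0 (r, q) * c q)\<^sup>2)"
    proof (rule sum.cong[OF refl])
      fix r
      have "(\<lambda>j q. B j ((p(j0 := r)) j, q)) = x(j0 := (\<lambda>q. B j0 (r, q)))"
        by (auto simp: x_def fun_eq_iff)
      then show "(mlf J (\<lambda>_. K) T (\<lambda>j q. B j ((p(j0 := r)) j, q)))\<^sup>2 = (\<Sum>q\<in>K. B j0 (r, q) * c q)\<^sup>2"
        by (simp add: slot mult.commute)
    qed
    also have "\<dots> = (L2_set (\<lambda>p. \<Sum>q\<in>K. B j0 (p, q) * c q) I)\<^sup>2" by (simp add: L2_set_power2)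
    also have "\<dots> \<le> (\<tau> * L2_set c K)\<^sup>2" by (intro power_mono op) auto
    also have "\<dots> \<le> (\<tau> * (E * P))\<^sup>2" using c op by (intro power_mono mult_left_mono) auto
    also have "\<dots> = E\<^sup>2 * \<tau>\<^sup>2 * (\<Prod>j\<in>J'. (L2_set (\<lambda>q. B j (p j, q)) K)\<^sup>2)"
      by (simp add: power_mult_distrib P_def x_def prod_power_distrib mult_ac)
    finally show ?thesis .
  qed
  have "(\<Sum>p\<in>(\<Pi>\<^sub>E j\<in>J. I). (mlf J (\<lambda>_. K) T (\<lambda>j q. B j (p j, q)))\<^sup>2)
    = (\<Sum>p\<in>(\<Pi>\<^sub>E j\<in>J'. I). \<Sum>r\<in>I. (mlf J (\<lambda>_. K) T (\<lambda>j q. B j ((p(j0 := r)) j, q)))\<^sup>2)"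
    unfolding J'(1) by (rule sum_PiE_insert[OF J'(2)])
  also have "\<dots> \<le> (\<Sum>p\<in>(\<Pi>\<^sub>E j\<in>J'. I). E\<^sup>2 * \<tau>\<^sup>2 * (\<Prod>j\<in>J'. (L2_set (\<lambda>q. B j (p j, q)) K)\<^sup>2))"
    by (intro sum_mono slice)
  also have "\<dots> = E\<^sup>2 * \<tau>\<^sup>2 * (\<Prod>j\<in>J'. \<Sum>p\<in>I. (L2_set (\<lambda>q. B j (p, q)) K)\<^sup>2)"
    unfolding sum_distrib_left[symmetric] using fin J' by (subst prod_sum_PiE) auto
  finally show ?thesis by (simp only: L2_set_Times J'_def)
qed

text \<open>Cauchy-Schwarz. Far from the true size, but enough to control rounding errors, where it
  is multiplied by a very small mesh.\<close>

lemma mlf_pair_tensor_le: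
  assumes fin: "finite J" "finite I"
    and E: "E \<ge> 0" "\<And>u. \<bar>mlf J (\<lambda>_. I) g' u\<bar> \<le> E * (\<Prod>j\<in>J. L2_set (u j) I)"
  shows "\<bar>mlf J (\<lambda>_. I \<times> I) (pair_tensor J g g') B\<bar>
    \<le> (L2_set g (\<Pi>\<^sub>E j\<in>J. I) * E) * (\<Prod>j\<in>J. L2_set (B j) (I \<times> I))"
proof -
  let ?y = "\<lambda>p. mlf J (\<lambda>_. I) g' (\<lambda>j q. B j (p j, q))"
  have nn: "E * (\<Prod>j\<in>J. L2_set (B j) (I \<times> I)) \<ge> 0"
    using E by (auto intro!: mult_nonneg_nonneg prod_nonneg)
  have "\<bar>mlf J (\<lambda>_. I \<times> I) (pair_tensor J g g') B\<bar> \<le> L2_set g (\<Pi>\<^sub>E j\<in>J. I) * L2_set ?y (\<Pi>\<^sub>E j\<in>J. I)"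
    unfolding mlf_pair_tensor by (rule abs_sum_mult_le_L2)
  also have "L2_set ?y (\<Pi>\<^sub>E j\<in>J. I) \<le> E * (\<Prod>j\<in>J. L2_set (B j) (I \<times> I))"
    using mlf_rows_sum_squares_le[OF fin fin(2) E(2), where B=B] nn
    by (subst L2_set_le_iff) (auto simp: power_mult_distrib prod_power_distrib)
  finally show ?thesis by (simp add: mult_left_mono mult.assoc)
qed

text \<open>Telescoping: the slots are switched from \<open>x\<close> to \<open>y\<close> one at a
  time, and each difference has one slot of norm at most \<open>\<eta>\<close> and the others of
  norm at most 2.\<close>

lemma mlf_perturb:
  assumes fin: "finite J" "\<And>j. j \<in> J \<Longrightarrow> finite (A j)"
    and C: "C \<ge> 0" "\<And>u. \<bar>mlf J A T u\<bar> \<le> C * (\<Prod>j\<in>J. L2_set (u j) (A j))"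
    and xy: "\<And>j. j \<in> J \<Longrightarrow> L2_set (x j) (A j) \<le> 2" "\<And>j. j \<in> J \<Longrightarrow> L2_set (y j) (A j) \<le> 2"
      "\<And>j. j \<in> J \<Longrightarrow> L2_set (\<lambda>i. x j i - y j i) (A j) \<le> \<eta>"
  shows "\<bar>mlf J A T x - mlf J A T y\<bar> \<le> real (card J) * (2 ^ card J * \<eta> * C)"
proof -
  define z where "z S = (\<lambda>j. if j \<in> S then y j else x j)" for S
  have "\<bar>mlf J A T x - mlf J A T (z S)\<bar> \<le> real (card S) * (2 ^ card J * \<eta> * C)" if "S \<subseteq> J" for S
    using finite_subset[OF that fin(1)] that
  proof (induction S rule: finite_induct)
    case empty
    then show ?case by (simp add: z_def)
  next
    case (insert j S)
    have j: "j \<in> J" using insert.prems by auto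
    let ?d = "\<lambda>i. x j i - y j i"
    have eta: "\<eta> \<ge> 0" using xy(3)[OF j] L2_set_nonneg[of ?d "A j"] by linarith
    have "z S = (z S)(j := (\<lambda>i. y j i + ?d i))" using insert.hyps by (auto simp: z_def)
    moreover have "(z S)(j := y j) = z (insert j S)" by (auto simp: z_def)
    ultimately have eq: "mlf J A T (z S) = mlf J A T (z (insert j S)) + mlf J A T ((z S)(j := ?d))"
      using mlf_add[where A=A, OF fin(1) j fin(2)[OF j], of T "z S" "y j" ?d] by simp
    have "(\<Prod>l\<in>J. L2_set (((z S)(j := ?d)) l) (A l)) = L2_set ?d (A j) * (\<Prod>l\<in>J - {j}. L2_set (z S l) (A l))"
    proof -
      have "(\<Prod>l\<in>J - {j}. L2_set (((z S)(j := ?d)) l) (A l)) = (\<Prod>l\<in>J - {j}. L2_set (z S l) (A l))"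
        by (intro prod.cong) auto
      then show ?thesis using fin(1) j by (simp add: prod.remove[of J j])
    qed
    also have "\<dots> \<le> \<eta> * (\<Prod>l\<in>J - {j}. 2)"
      using xy j eta by (intro mult_mono prod_mono) (auto simp: z_def intro: prod_nonneg)
    also have "\<dots> \<le> \<eta> * 2 ^ card J"
      using eta fin j by (intro mult_left_mono) (auto intro!: power_increasing card_mono)
    finally have "C * (\<Prod>l\<in>J. L2_set (((z S)(j := ?d)) l) (A l)) \<le> C * (\<eta> * 2 ^ card J)"
      using C(1) by (rule mult_left_mono)
    then have "\<bar>mlf J A T ((z S)(j := ?d))\<bar> \<le> 2 ^ card J * \<eta> * C"
      using C(2)[of "(z S)(j := ?d)"] by (simp only: mult_ac)
    moreover have "\<bar>mlf J A T x - mlf J A T (z S)\<bar> \<le> real (card S) * (2 ^ card J * \<eta> * C)"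
      using insert by auto
    ultimately show ?case using insert.hyps eq by (simp add: algebra_simps)
  qed
  from this[of J] have "\<bar>mlf J A T x - mlf J A T (z J)\<bar> \<le> real (card J) * (2 ^ card J * \<eta> * C)" by simp
  moreover have "mlf J A T (z J) = mlf J A T y" by (rule mlf_cong) (simp add: z_def)
  ultimately show ?thesis by simp
qed

section \<open>Splitting a matrix into low rank and small operator norm\<close>

lemma sum_Times: "(\<Sum>x\<in>A \<times> B. \<phi> x) = (\<Sum>a\<in>A. \<Sum>b\<in>B. \<phi> (a, b))"
  by (simp add: sum.cartesian_product case_prod_unfold)

lemma bessel_identity:
  fixes v :: "nat \<Rightarrow> 'i \<Rightarrow> real"
  assumes "finite I"
    and orth: "\<And>l l'. l < n \<Longrightarrow> l' < n \<Longrightarrow> (\<Sum>q\<in>I. v l q * v l' q) = of_bool (l = l')"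
  defines "c b l \<equiv> \<Sum>q\<in>I. b q * v l q"
  shows "l < n \<Longrightarrow> (\<Sum>q\<in>I. (b q - (\<Sum>l<n. c b l * v l q)) * v l q) = 0"
    and "(\<Sum>q\<in>I. (\<Sum>l<n. c b l * v l q)\<^sup>2) = (\<Sum>l<n. (c b l)\<^sup>2)"
    and "(\<Sum>q\<in>I. (b q - (\<Sum>l<n. c b l * v l q))\<^sup>2) = (\<Sum>q\<in>I. (b q)\<^sup>2) - (\<Sum>l<n. (c b l)\<^sup>2)"
proof -
  have ex: "(\<Sum>q\<in>I. (\<Sum>l<n. c b l * v l q) * h q) = (\<Sum>l<n. c b l * c h l)" for b h
    unfolding sum_distrib_right by (subst sum.swap) (simp add: c_def sum_distrib_left mult_ac)
  have cv: "c (v l') l = of_bool (l' = l)" if "l < n" "l' < n" for l l'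
    unfolding c_def by (rule orth[OF that(2,1)])
  have proj: "(\<Sum>q\<in>I. (\<Sum>l<n. c b l * v l q) * v l' q) = c b l'" if "l' < n" for b l'
  proof -
    have "(\<Sum>l<n. c b l * c (v l') l) = (\<Sum>l<n. if l = l' then c b l else 0)"
      using that by (intro sum.cong) (auto simp: cv)
    then show ?thesis using that by (simp add: ex)
  qed
  show "(\<Sum>q\<in>I. (b q - (\<Sum>l<n. c b l * v l q)) * v l q) = 0" if "l < n"
    using proj[OF that, of b] by (simp add: left_diff_distrib sum_subtractf c_def)
  have sq: "(\<Sum>q\<in>I. (\<Sum>l<n. c b l * v l q)\<^sup>2) = (\<Sum>l<n. (c b l)\<^sup>2)" for b
  proof -
    have "(\<Sum>q\<in>I. (\<Sum>l<n. c b l * v l q)\<^sup>2)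
        = (\<Sum>l<n. c b l * c (\<lambda>q. \<Sum>l<n. c b l * v l q) l)"
      unfolding power2_eq_square by (rule ex)
    also have "\<dots> = (\<Sum>l<n. (c b l)\<^sup>2)"
    proof (rule sum.cong[OF refl])
      fix l assume "l \<in> {..<n}"
      then show "c b l * c (\<lambda>q. \<Sum>l<n. c b l * v l q) l = (c b l)\<^sup>2"
        using proj[of l b] by (simp add: c_def[of "\<lambda>q. \<Sum>l<n. c b l * v l q"] power2_eq_square)
    qed
    finally show ?thesis .
  qed
  then show "(\<Sum>q\<in>I. (\<Sum>l<n. c b l * v l q)\<^sup>2) = (\<Sum>l<n. (c b l)\<^sup>2)" .
  have expand: "(b q - (\<Sum>l<n. c b l * v l q))\<^sup>2
      = (b q)\<^sup>2 + (\<Sum>l<n. c b l * v l q)\<^sup>2 - 2 * ((\<Sum>l<n. c b l * v l q) * b q)" for q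
    by (simp add: power2_eq_square algebra_simps)
  have "(\<Sum>q\<in>I. (\<Sum>l<n. c b l * v l q) * b q) = (\<Sum>l<n. (c b l)\<^sup>2)"
    unfolding ex power2_eq_square ..
  then show "(\<Sum>q\<in>I. (b q - (\<Sum>l<n. c b l * v l q))\<^sup>2) = (\<Sum>q\<in>I. (b q)\<^sup>2) - (\<Sum>l<n. (c b l)\<^sup>2)"
    using sq[of b] by (simp only: expand sum.distrib sum_subtractf sum_distrib_left[symmetric])
qed

text \<open>\<open>v\<close> is an orthonormal family, of maximal size, of vectors on which \<open>B\<close> is large; the
  Hilbert--Schmidt norm limits its size and maximality makes the rest of \<open>B\<close> small in operator norm.\<close>

lemma low_rank_plus_small_op:
  fixes B :: "'i \<times> 'i \<Rightarrow> real"
  assumes fin: "finite I" and R: "R \<ge> 1" and B: "L2_set B (I \<times> I) \<le> 1"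
  obtains W V :: "'i \<times> nat \<Rightarrow> real" and B' B'' where
    "L2_set W (I \<times> {..<R}) \<le> 1" "L2_set V (I \<times> {..<R}) \<le> sqrt (real R)"
    "\<And>p q. B' (p, q) = (\<Sum>l<R. W (p, l) * V (q, l))"
    "\<And>x. B x = B' x + B'' x"
    "L2_set B' (I \<times> I) \<le> 1" "L2_set B'' (I \<times> I) \<le> 1"
    "\<And>h. L2_set (\<lambda>p. \<Sum>q\<in>I. B'' (p, q) * h q) I \<le> 1 / sqrt (real R) * L2_set h I"
proof -
  define orth where "orth n v \<longleftrightarrow> (\<forall>l<n. \<forall>l'<n. (\<Sum>q\<in>I. v l q * v l' q) = of_bool (l = l'))"
    for n and v :: "nat \<Rightarrow> 'i \<Rightarrow> real"
  define heavy where "heavy v \<longleftrightarrow> (\<Sum>p\<in>I. (\<Sum>q\<in>I. B (p, q) * v q)\<^sup>2) > 1 / real R"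
    for v :: "'i \<Rightarrow> real"
  define good where "good n \<longleftrightarrow> (\<exists>v. orth n v \<and> (\<forall>l<n. heavy (v l)))" for n
  have B2: "(\<Sum>p\<in>I. \<Sum>q\<in>I. (B (p, q))\<^sup>2) \<le> 1"
    using B by (subst (asm) L2_set_le_iff) (auto simp: sum.cartesian_product case_prod_unfold)
  have bessel: "(\<Sum>l<n. (\<Sum>q\<in>I. b q * v l q)\<^sup>2) \<le> (\<Sum>q\<in>I. (b q)\<^sup>2)" if "orth n v" for n v b
  proof -
    have "0 \<le> (\<Sum>q\<in>I. (b q - (\<Sum>l<n. (\<Sum>q\<in>I. b q * v l q) * v l q))\<^sup>2)" by (intro sum_nonneg) auto
    then show ?thesis using bessel_identity(3)[OF fin, of n v b] that by (simp add: orth_def)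
  qed
  have coeffs: "(\<Sum>p\<in>I. \<Sum>l<n. (\<Sum>q\<in>I. B (p, q) * v l q)\<^sup>2) \<le> 1" if "orth n v" for n v
    using sum_mono[of I "\<lambda>p. \<Sum>l<n. (\<Sum>q\<in>I. B (p, q) * v l q)\<^sup>2" "\<lambda>p. \<Sum>q\<in>I. (B (p, q))\<^sup>2"]
      bessel[OF that] B2 by force
  have "n \<le> R" if gn: "good n" for n
  proof -
    obtain v where v: "orth n v" "\<And>l. l < n \<Longrightarrow> heavy (v l)" using gn by (auto simp: good_def)
    have "real n * (1 / real R) = (\<Sum>l<n. 1 / real R)" by simp
    also have "\<dots> \<le> (\<Sum>l<n. \<Sum>p\<in>I. (\<Sum>q\<in>I. B (p, q) * v l q)\<^sup>2)"
      using v(2) by (intro sum_mono) (auto simp: heavy_def less_imp_le)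
    also have "\<dots> \<le> 1" using coeffs[OF v(1)] by (subst sum.swap)
    finally show ?thesis using R by (simp add: field_simps)
  qed
  moreover have "good 0" by (simp add: good_def orth_def)
  ultimately obtain n where n: "good n" "\<And>n'. good n' \<Longrightarrow> n' \<le> n" "n \<le> R"
    using Nat.ex_has_greatest_nat[of good 0 R] by auto
  obtain v where v: "orth n v" "\<And>l. l < n \<Longrightarrow> heavy (v l)" using n(1) by (auto simp: good_def)
  \<comment> \<open>\<open>pr b\<close> is the projection of \<open>b\<close> onto the span of the
    family. \<open>B'\<close> projects every row of \<open>B\<close>, so it factors through
    \<open>n\<close> coefficients, and \<open>B''\<close> is the remainder.\<close>
  define c where "c b l = (\<Sum>q\<in>I. b q * v l q)" for b l
  define pr where "pr b q = (\<Sum>l<n. c b l * v l q)" for b q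
  have orth': "\<And>l l'. l < n \<Longrightarrow> l' < n \<Longrightarrow> (\<Sum>q\<in>I. v l q * v l' q) = of_bool (l = l')"
    using v(1) by (simp add: orth_def)
  have bi: "l < n \<Longrightarrow> (\<Sum>q\<in>I. (b q - pr b q) * v l q) = 0"
    "(\<Sum>q\<in>I. (pr b q)\<^sup>2) = (\<Sum>l<n. (c b l)\<^sup>2)"
    "(\<Sum>q\<in>I. (b q - pr b q)\<^sup>2) = (\<Sum>q\<in>I. (b q)\<^sup>2) - (\<Sum>l<n. (c b l)\<^sup>2)" for b l
    unfolding pr_def c_def by (rule bessel_identity[OF fin orth']; assumption)+
  \<comment> \<open>Columns from \<open>n\<close> up to \<open>R\<close> are filled with zeros, so
    that the format of the factors depends on \<open>R\<close> alone.\<close>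
  define W where "W = (\<lambda>(p, l). if l < n then c (\<lambda>q. B (p, q)) l else 0)"
  define V where "V = (\<lambda>(q, l). if l < n then v l q else 0)"
  define B' where "B' = (\<lambda>(p, q). pr (\<lambda>q. B (p, q)) q)"
  define B'' where "B'' x = B x - B' x" for x
  have trunc: "(\<Sum>l<R. if l < n then \<phi> l else 0) = (\<Sum>l<n. \<phi> l)" for \<phi> :: "nat \<Rightarrow> real"
    by (rule sum.mono_neutral_cong_right) (use n(3) in auto)
  have sq_if: "(if P then a else 0)\<^sup>2 = (if P then a\<^sup>2 else 0)" for P and a :: real by simp
  have cW: "(\<Sum>p\<in>I. \<Sum>l<n. (c (\<lambda>q. B (p, q)) l)\<^sup>2) \<le> 1" using coeffs[OF v(1)] by (simp add: c_def)
  show ?thesis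
  proof (rule that[of W V B' B''])
    show "L2_set W (I \<times> {..<R}) \<le> 1"
      using cW by (subst L2_set_le_iff)
        (auto simp: sum_Times W_def sq_if trunc)
    have "(\<Sum>x\<in>I \<times> {..<R}. (V x)\<^sup>2) = (\<Sum>q\<in>I. \<Sum>l<n. (v l q)\<^sup>2)"
      by (simp add: sum_Times V_def sq_if trunc)
    also have "\<dots> = (\<Sum>l<n. \<Sum>q\<in>I. v l q * v l q)" by (subst sum.swap) (simp add: power2_eq_square)
    also have "\<dots> = real n" by (simp add: orth')
    finally show "L2_set V (I \<times> {..<R}) \<le> sqrt (real R)"
      using n(3) by (subst L2_set_le_iff) auto
    show "B' (p, q) = (\<Sum>l<R. W (p, l) * V (q, l))" for p q
    proof -
      have "(\<Sum>l<R. W (p, l) * V (q, l)) = (\<Sum>l<R. if l < n then c (\<lambda>q. B (p, q)) l * v l q else 0)"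
        by (intro sum.cong) (auto simp: W_def V_def)
      then show ?thesis by (simp only: trunc) (simp add: B'_def pr_def)
    qed
    show "B x = B' x + B'' x" for x by (simp add: B''_def)
    have "(\<Sum>x\<in>I \<times> I. (B' x)\<^sup>2) = (\<Sum>p\<in>I. \<Sum>l<n. (c (\<lambda>q. B (p, q)) l)\<^sup>2)"
      by (simp add: sum_Times B'_def bi(2))
    then show "L2_set B' (I \<times> I) \<le> 1" using cW by (subst L2_set_le_iff) auto
    have "(\<Sum>x\<in>I \<times> I. (B'' x)\<^sup>2) = (\<Sum>p\<in>I. \<Sum>q\<in>I. (B (p, q) - pr (\<lambda>q. B (p, q)) q)\<^sup>2)"
      by (simp add: sum_Times B'_def B''_def)
    also have "\<dots> \<le> (\<Sum>p\<in>I. \<Sum>q\<in>I. (B (p, q))\<^sup>2)"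
      by (rule sum_mono) (simp add: bi(3) sum_nonneg)
    finally show "L2_set B'' (I \<times> I) \<le> 1" using B2 by (subst L2_set_le_iff) auto
    fix h :: "'i \<Rightarrow> real"
    define w where "w q = h q - pr h q" for q
    have w0: "(\<Sum>q\<in>I. w q * v l q) = 0" if "l < n" for l
      using bi(1)[OF that, of h] by (simp add: w_def)
    have wh: "(\<Sum>q\<in>I. (w q)\<^sup>2) \<le> (\<Sum>q\<in>I. (h q)\<^sup>2)"
      using bi(3)[of h] by (simp add: w_def sum_nonneg)
    have move: "(\<Sum>q\<in>I. pr b q * h q) = (\<Sum>q\<in>I. b q * pr h q)" for b
    proof -
      have "(\<Sum>q\<in>I. pr b q * h q) = (\<Sum>l<n. c b l * c h l)" for b h
        unfolding pr_def sum_distrib_right by (subst sum.swap) (simp add: c_def sum_distrib_left mult_ac)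
      from this[of b h] this[of h b] show ?thesis by (simp add: mult.commute)
    qed
    \<comment> \<open>The projection is self-adjoint, so B'' h = B w with \<open>w\<close> the
      component of \<open>h\<close> orthogonal to the family.\<close>
    have eq: "(\<Sum>q\<in>I. B'' (p, q) * h q) = (\<Sum>q\<in>I. B (p, q) * w q)" for p
      using move[of "\<lambda>q. B (p, q)"]
      by (simp add: B''_def B'_def w_def left_diff_distrib right_diff_distrib sum_subtractf)
    have "(\<Sum>p\<in>I. (\<Sum>q\<in>I. B (p, q) * w q)\<^sup>2) \<le> (1 / real R) * (\<Sum>q\<in>I. (w q)\<^sup>2)"
    proof (cases "(\<Sum>q\<in>I. (w q)\<^sup>2) = 0")
      case True
      then have "\<forall>q\<in>I. w q = 0" using fin by (simp add: sum_nonneg_eq_0_iff)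
      then show ?thesis by simp
    next
      case False
      define r where "r = L2_set w I"
      have r: "r > 0" "r\<^sup>2 = (\<Sum>q\<in>I. (w q)\<^sup>2)"
        using False by (auto simp: r_def L2_set_power2 order_less_le L2_set_def intro: sum_nonneg)
      define u where "u q = w q / r" for q
      have u: "(\<Sum>q\<in>I. u q * u q) = 1" "\<And>l. l < n \<Longrightarrow> (\<Sum>q\<in>I. u q * v l q) = 0"
        using r w0 by (auto simp: u_def power2_eq_square sum_divide_distrib[symmetric])
      \<comment> \<open>Otherwise the unit vector \<open>u\<close>, orthogonal to the family, would
        extend it beyond its maximal size.\<close>
      have "\<not> heavy u"
      proof
        assume "heavy u"
        have "orth (Suc n) (v(n := u))"
          using v(1) u unfolding orth_def by (auto simp: less_Suc_eq mult.commute)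
        moreover have "\<forall>l<Suc n. heavy ((v(n := u)) l)"
          using v(2) \<open>heavy u\<close> by (auto simp: less_Suc_eq)
        ultimately have "good (Suc n)" unfolding good_def by blast
        then show False using n(2) by fastforce
      qed
      then have "(\<Sum>p\<in>I. (\<Sum>q\<in>I. B (p, q) * u q)\<^sup>2) \<le> 1 / real R" by (simp add: heavy_def)
      then have "r\<^sup>2 * (\<Sum>p\<in>I. (\<Sum>q\<in>I. B (p, q) * u q)\<^sup>2) \<le> r\<^sup>2 * (1 / real R)"
        by (intro mult_left_mono) auto
      moreover have "r\<^sup>2 * (\<Sum>p\<in>I. (\<Sum>q\<in>I. B (p, q) * u q)\<^sup>2) = (\<Sum>p\<in>I. (\<Sum>q\<in>I. B (p, q) * w q)\<^sup>2)"
      proof -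
        have "r * (\<Sum>q\<in>I. B (p, q) * u q) = (\<Sum>q\<in>I. B (p, q) * w q)" for p
          using r by (simp add: u_def sum_distrib_left)
        then show ?thesis by (simp add: sum_distrib_left power_mult_distrib[symmetric])
      qed
      ultimately show ?thesis using r by (simp add: mult.commute)
    qed
    also have "\<dots> \<le> (1 / real R) * (\<Sum>q\<in>I. (h q)\<^sup>2)"
      using wh by (intro mult_left_mono) auto
    finally have "(\<Sum>p\<in>I. (\<Sum>q\<in>I. B'' (p, q) * h q)\<^sup>2) \<le> (1 / sqrt (real R) * L2_set h I)\<^sup>2"
      by (simp add: eq power_mult_distrib power_divide L2_set_power2)
    then show "L2_set (\<lambda>p. \<Sum>q\<in>I. B'' (p, q) * h q) I \<le> 1 / sqrt (real R) * L2_set h I"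
      by (subst L2_set_le_iff) auto
  qed
qed

lemma L2_set_matrix_mult_le:
  assumes "finite L"
  shows "L2_set (\<lambda>(p, q). \<Sum>l\<in>L. a (p, l) * b (q, l)) (I \<times> I) \<le> L2_set a (I \<times> L) * L2_set b (I \<times> L)"
proof -
  have "(\<Sum>(p, q)\<in>I \<times> I. (\<Sum>l\<in>L. a (p, l) * b (q, l))\<^sup>2)
    \<le> (\<Sum>(p, q)\<in>I \<times> I. (L2_set (\<lambda>l. a (p, l)) L)\<^sup>2 * (L2_set (\<lambda>l. b (q, l)) L)\<^sup>2)"
  proof (intro sum_mono, clarify)
    fix p q
    show "(\<Sum>l\<in>L. a (p, l) * b (q, l))\<^sup>2 \<le> (L2_set (\<lambda>l. a (p, l)) L)\<^sup>2 * (L2_set (\<lambda>l. b (q, l)) L)\<^sup>2"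
      using power_mono[OF abs_sum_mult_le_L2[of "\<lambda>l. a (p, l)" "\<lambda>l. b (q, l)" L] abs_ge_zero, of 2]
      by (simp only: power2_abs power_mult_distrib)
  qed
  also have "\<dots> = (\<Sum>p\<in>I. (L2_set (\<lambda>l. a (p, l)) L)\<^sup>2) * (\<Sum>q\<in>I. (L2_set (\<lambda>l. b (q, l)) L)\<^sup>2)"
    by (simp only: sum_product sum.cartesian_product)
  also have "\<dots> = (L2_set a (I \<times> L) * L2_set b (I \<times> L))\<^sup>2"
    by (simp add: power_mult_distrib L2_set_power2 sum.cartesian_product case_prod_unfold)
  finally show ?thesis by (subst L2_set_le_iff) (auto simp: case_prod_unfold)
qed

text \<open>Nets for the two factors have 2 card I R parameters together, instead of the square of
  card I. Up to transposes the error is (W - w) V + w (V - u), with norms at most \<zeta> sqrt R and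
  2 \<zeta> sqrt R; the net for \<open>V\<close> is that of the unit ball scaled by sqrt R.\<close>

lemma low_rank_net:
  fixes I :: "'i set"
  assumes fin: "finite I" "I \<noteq> {}" and R: "R \<ge> 1" and zeta: "0 < \<zeta>" "\<zeta> \<le> 1"
  obtains N :: "('i \<times> 'i \<Rightarrow> real) set" where "finite N" "real (card N) \<le> (300 / \<zeta>\<^sup>2) ^ (2 * card I * R)"
    "\<And>W V B. L2_set W (I \<times> {..<R}) \<le> 1 \<Longrightarrow> L2_set V (I \<times> {..<R}) \<le> sqrt (real R) \<Longrightarrow>
      (\<And>p q. B (p, q) = (\<Sum>l<R. W (p, l) * V (q, l))) \<Longrightarrow>
      \<exists>B'\<in>N. L2_set (\<lambda>x. B x - B' x) (I \<times> I) \<le> 3 * sqrt (real R) * \<zeta>"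
proof -
  let ?K = "I \<times> {..<R}"
  obtain N0 where N0: "is_net \<zeta> ?K N0" "real (card N0) \<le> (300 / \<zeta>\<^sup>2) ^ card ?K"
    by (rule L2_net_exists[of ?K \<zeta>]) (use fin R zeta in \<open>auto simp: lessThan_empty_iff\<close>)
  have fin0: "finite N0" using N0 by (simp add: is_net_def)
  define comb where "comb = (\<lambda>(w :: 'i \<times> nat \<Rightarrow> real, u). (\<lambda>(p :: 'i, q :: 'i). \<Sum>l<R. w (p, l) * (sqrt (real R) * u (q, l))))"
  define N where "N = comb ` (N0 \<times> N0)"
  show ?thesis
  proof (rule that[of N])
    show "finite N" using fin0 by (simp add: N_def)
    have "card N \<le> card (N0 \<times> N0)" unfolding N_def using fin0 by (intro card_image_le) auto
    then have "real (card N) \<le> real (card N0) * real (card N0)"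
      by (simp add: card_cartesian_product flip: of_nat_mult)
    also have "\<dots> \<le> (300 / \<zeta>\<^sup>2) ^ card ?K * (300 / \<zeta>\<^sup>2) ^ card ?K"
      using N0(2) by (intro mult_mono) auto
    also have "\<dots> = (300 / \<zeta>\<^sup>2) ^ (2 * card I * R)"
      by (simp add: power_add[symmetric] card_cartesian_product mult_2 add_mult_distrib)
    finally show "real (card N) \<le> (300 / \<zeta>\<^sup>2) ^ (2 * card I * R)" .
    fix W V :: "'i \<times> nat \<Rightarrow> real" and B
    assume W: "L2_set W ?K \<le> 1" and V: "L2_set V ?K \<le> sqrt (real R)"
      and B: "\<And>p q. B (p, q) = (\<Sum>l<R. W (p, l) * V (q, l))"
    define s where "s = sqrt (real R)"
    have s: "s > 0" using R by (simp add: s_def)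
    obtain w where w: "w \<in> N0" "L2_set (\<lambda>i. W i - w i) ?K \<le> \<zeta>"
      using N0(1) W unfolding is_net_def by blast
    have "L2_set (\<lambda>i. (1 / s) * V i) ?K \<le> 1"
      unfolding L2_set_scale using V s by (simp add: s_def)
    then obtain u where u: "u \<in> N0" "L2_set (\<lambda>i. (1 / s) * V i - u i) ?K \<le> \<zeta>"
      using N0(1) unfolding is_net_def by blast
    have "L2_set (\<lambda>i. s * ((1 / s) * V i - u i)) ?K \<le> s * \<zeta>"
      unfolding L2_set_scale using u s by simp
    moreover have "(\<lambda>i. s * ((1 / s) * V i - u i)) = (\<lambda>i. V i - s * u i)"
      using s by (auto simp: fun_eq_iff algebra_simps)
    ultimately have Vu: "L2_set (\<lambda>i. V i - s * u i) ?K \<le> s * \<zeta>" by simp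
    have "L2_set w ?K \<le> L2_set W ?K + L2_set (\<lambda>i. - 1 * (W i - w i)) ?K"
      using L2_set_triangle_ineq[of W "\<lambda>i. - 1 * (W i - w i)" ?K] by simp
    also have "\<dots> \<le> 2" unfolding L2_set_scale using w W zeta by simp
    finally have w2: "L2_set w ?K \<le> 2" .
    have "(\<lambda>x. B x - comb (w, u) x) = (\<lambda>x.
        (\<lambda>(p, q). \<Sum>l<R. (\<lambda>i. W i - w i) (p, l) * V (q, l)) x
        + (\<lambda>(p, q). \<Sum>l<R. w (p, l) * (\<lambda>i. V i - s * u i) (q, l)) x)"
      by (auto simp: fun_eq_iff B comb_def s_def sum.distrib[symmetric] sum_subtractf[symmetric] algebra_simps)
    then have "L2_set (\<lambda>x. B x - comb (w, u) x) (I \<times> I)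
        \<le> L2_set (\<lambda>(p, q). \<Sum>l<R. (\<lambda>i. W i - w i) (p, l) * V (q, l)) (I \<times> I)
        + L2_set (\<lambda>(p, q). \<Sum>l<R. w (p, l) * (\<lambda>i. V i - s * u i) (q, l)) (I \<times> I)"
      using L2_set_triangle_ineq by simp
    also have "\<dots> \<le> \<zeta> * s + 2 * (s * \<zeta>)"
    proof (rule add_mono)
      show "L2_set (\<lambda>(p, q). \<Sum>l<R. (\<lambda>i. W i - w i) (p, l) * V (q, l)) (I \<times> I) \<le> \<zeta> * s"
        using w V zeta by (intro order.trans[OF L2_set_matrix_mult_le] mult_mono) (auto simp: s_def)
      show "L2_set (\<lambda>(p, q). \<Sum>l<R. w (p, l) * (\<lambda>i. V i - s * u i) (q, l)) (I \<times> I) \<le> 2 * (s * \<zeta>)"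
        by (intro order.trans[OF L2_set_matrix_mult_le] mult_mono w2 Vu) auto
    qed
    finally have "L2_set (\<lambda>x. B x - comb (w, u) x) (I \<times> I) \<le> 3 * sqrt (real R) * \<zeta>"
      by (simp add: s_def mult_ac)
    moreover have "comb (w, u) \<in> N" using w u by (auto simp: N_def)
    ultimately show "\<exists>B'\<in>N. L2_set (\<lambda>x. B x - B' x) (I \<times> I) \<le> 3 * sqrt (real R) * \<zeta>" by blast
  qed
qed

lemma L2_set_matrix_vector_le:
  "L2_set (\<lambda>p. \<Sum>q\<in>K. D (p, q) * h q) I \<le> L2_set D (I \<times> K) * L2_set h K"
proof -
  have "(\<Sum>p\<in>I. (\<Sum>q\<in>K. D (p, q) * h q)\<^sup>2) \<le> (\<Sum>p\<in>I. (L2_set (\<lambda>q. D (p, q)) K)\<^sup>2 * (L2_set h K)\<^sup>2)"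
  proof (rule sum_mono)
    fix p
    show "(\<Sum>q\<in>K. D (p, q) * h q)\<^sup>2 \<le> (L2_set (\<lambda>q. D (p, q)) K)\<^sup>2 * (L2_set h K)\<^sup>2"
      using power_mono[OF abs_sum_mult_le_L2[of "\<lambda>q. D (p, q)" h K] abs_ge_zero, of 2]
      by (simp only: power2_abs power_mult_distrib)
  qed
  also have "\<dots> = (L2_set D (I \<times> K) * L2_set h K)\<^sup>2"
    by (simp only: power_mult_distrib L2_set_Times sum_distrib_right)
  finally show ?thesis by (subst L2_set_le_iff) auto
qed

lemma exp_neg_3: "2 * exp (- 3) \<le> (1 / 4 :: real)"
  using exp_numeral_ge[of 3] by (simp add: exp_minus field_simps)

lemma L2_set_close_le_2:
  assumes "L2_set x A \<le> 1" "L2_set (\<lambda>i. x i - y i) A \<le> \<eta>" "\<eta> \<le> 1"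
  shows "L2_set y A \<le> 2"
proof -
  have "L2_set y A \<le> L2_set x A + L2_set (\<lambda>i. - 1 * (x i - y i)) A"
    using L2_set_triangle_ineq[of x "\<lambda>i. - 1 * (x i - y i)" A] by simp
  then show ?thesis unfolding L2_set_scale using assms by simp
qed

text \<open>\<open>g'\<close> is fixed with injective norm at most \<open>E\<close>, and only
  \<open>g\<close> is random. Two families of net tuples are controlled: arbitrary matrices with one
  slot of small operator norm (large entropy, variance divided by R) and low-rank matrices (full
  variance, small entropy). \<open>a1\<close> and \<open>a2\<close> are the two entropies plus 3,
  and \<open>err\<close> is the cost of rounding to the nets. Here \<open>m\<close> is card I, the
  square of the m of the game.\<close>

lemma exists_signs_pair_tensor:
  fixes J :: "'j set" and I :: "'i set" and g' :: "('j \<Rightarrow> 'i) \<Rightarrow> real"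
  assumes fin: "finite J" "J \<noteq> {}" "finite I" "I \<noteq> {}" and R: "R \<ge> 1"
    and E: "E > 0" "\<And>u. \<bar>mlf J (\<lambda>_. I) g' u\<bar> \<le> E * (\<Prod>j\<in>J. L2_set (u j) I)"
    and eta: "0 < \<eta>" "\<eta> \<le> 1 / sqrt (real R)"
  defines "k \<equiv> card J" and "m \<equiv> card I"
  defines "a1 \<equiv> real (k * m\<^sup>2) * ln (300 / \<eta>\<^sup>2) + 3"
    and "a2 \<equiv> real (k * (2 * m * R)) * ln (300 / (\<eta> / (3 * sqrt (real R)))\<^sup>2) + 3"
    and "err \<equiv> real k * (2 ^ k * \<eta> * (sqrt (real m ^ k) * E))"
  obtains g where "g \<in> signs (\<Pi>\<^sub>E j\<in>J. I)"
    "\<And>B. (\<And>j. j \<in> J \<Longrightarrow> L2_set (B j) (I \<times> I) \<le> 1) \<Longrightarrow>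
      \<bar>mlf J (\<lambda>_. I \<times> I) (pair_tensor J g g') B\<bar>
      \<le> real k * (sqrt (2 * (4 ^ k * E\<^sup>2 / real R) * a1) + err) + (sqrt (2 * (4 ^ k * E\<^sup>2) * a2) + err)"
proof -
  let ?P = "\<Pi>\<^sub>E j\<in>J. I" and ?II = "I \<times> I"
  define F where "F g B = mlf J (\<lambda>_. ?II) (pair_tensor J g g') B" for g B
  define y where "y B p = mlf J (\<lambda>_. I) g' (\<lambda>j q. B j (p j, q))" for B :: "'j \<Rightarrow> 'i \<times> 'i \<Rightarrow> real" and p
  have Fy: "F g B = (\<Sum>p\<in>?P. g p * y B p)" for g B
    unfolding F_def y_def by (rule mlf_pair_tensor)
  define r where "r = 1 / sqrt (real R)"
  have r: "0 < r" "r \<le> 1" "r\<^sup>2 = 1 / real R" using R by (auto simp: r_def power_divide)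
  have eta1: "\<eta> \<le> 1" "\<eta> \<le> r" using eta r(2) unfolding r_def by linarith+
  have k: "k \<ge> 1" using fin by (auto simp: k_def Suc_le_eq card_gt_0_iff)
  have m: "m \<ge> 1" using fin by (auto simp: m_def Suc_le_eq card_gt_0_iff)
  define \<zeta> where "\<zeta> = \<eta> / (3 * sqrt (real R))"
  have zeta: "0 < \<zeta>" "\<zeta> \<le> 1" "3 * sqrt (real R) * \<zeta> = \<eta>"
  proof -
    have "sqrt (real R) \<ge> 1" using R by simp
    then have "\<eta> \<le> 3 * sqrt (real R)" using eta1 by linarith
    then show "0 < \<zeta>" "\<zeta> \<le> 1" "3 * sqrt (real R) * \<zeta> = \<eta>"
      using eta eta1 R by (auto simp: \<zeta>_def divide_le_eq)
  qed
  obtain N1 where N1: "is_net \<eta> ?II N1" "real (card N1) \<le> (300 / \<eta>\<^sup>2) ^ card ?II"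
    by (rule L2_net_exists[of ?II \<eta>]) (use fin eta eta1 in auto)
  obtain N2 :: "('i \<times> 'i \<Rightarrow> real) set" where N2: "finite N2" "real (card N2) \<le> (300 / \<zeta>\<^sup>2) ^ (2 * card I * R)"
    "\<And>W V B. L2_set W (I \<times> {..<R}) \<le> 1 \<Longrightarrow> L2_set V (I \<times> {..<R}) \<le> sqrt (real R) \<Longrightarrow>
      (\<And>p q. B (p, q) = (\<Sum>l<R. W (p, l) * V (q, l))) \<Longrightarrow>
      \<exists>B'\<in>N2. L2_set (\<lambda>x. B x - B' x) ?II \<le> 3 * sqrt (real R) * \<zeta>"
    by (rule low_rank_net[OF fin(3,4) R zeta(1,2)]) blast
  define small_op where "small_op t D \<longleftrightarrow> (\<forall>h. L2_set (\<lambda>p. \<Sum>q\<in>I. D (p, q) * h q) I \<le> t * L2_set h I)"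
    for t and D :: "'i \<times> 'i \<Rightarrow> real"
  \<comment> \<open>The threshold is 2 r because rounding to the net adds up to \<eta>, at most r,
    to the operator norm.\<close>
  define L1 where "L1 = {B \<in> (\<Pi>\<^sub>E j\<in>J. N1). (\<forall>j\<in>J. L2_set (B j) ?II \<le> 2) \<and> (\<exists>j\<in>J. small_op (2 * r) (B j))}"
  define L2 where "L2 = {B \<in> (\<Pi>\<^sub>E j\<in>J. N2). \<forall>j\<in>J. L2_set (B j) ?II \<le> 2}"
  have finN1: "finite N1" using N1(1) by (simp add: is_net_def)
  have finL: "finite L1" "finite L2"
    using fin finN1 N2(1) by (auto simp: L1_def L2_def intro!: finite_PiE)
  have pos1: "300 / \<eta>\<^sup>2 > 0" and pos2: "300 / \<zeta>\<^sup>2 > 0" using eta zeta by auto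
  have a_ge: "300 / \<eta>\<^sup>2 \<ge> 1" "300 / \<zeta>\<^sup>2 \<ge> 1"
    using power_le_one[of \<eta> 2] power_le_one[of \<zeta> 2] eta eta1 zeta by (auto simp: le_divide_eq)
  have a_pos: "a1 > 0" "a2 > 0"
    unfolding a1_def a2_def \<zeta>_def[symmetric] using a_ge
    by (auto intro!: add_nonneg_pos mult_nonneg_nonneg simp: ln_ge_zero)
  have cardPi: "real (card (\<Pi>\<^sub>E j\<in>J. N)) = real (card N) ^ k" for N :: "('i \<times> 'i \<Rightarrow> real) set"
    using fin by (simp add: card_PiE k_def)
  have "real (card L1) \<le> real (card N1) ^ k"
    unfolding cardPi[symmetric] L1_def using fin finN1 by (auto intro!: card_mono finite_PiE)
  also have "\<dots> \<le> ((300 / \<eta>\<^sup>2) ^ card ?II) ^ k" by (intro power_mono N1) auto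
  also have "\<dots> = exp (ln (300 / \<eta>\<^sup>2)) ^ (k * m\<^sup>2)"
    using pos1 by (simp add: power_mult[symmetric] card_cartesian_product m_def power2_eq_square mult.commute)
  also have "\<dots> = exp (a1 - 3)" unfolding exp_of_nat_mult[symmetric] by (simp add: a1_def)
  finally have cL1: "real (card L1) \<le> exp (a1 - 3)" .
  have "real (card L2) \<le> real (card N2) ^ k"
    unfolding cardPi[symmetric] L2_def using fin N2(1) by (auto intro!: card_mono finite_PiE)
  also have "\<dots> \<le> ((300 / \<zeta>\<^sup>2) ^ (2 * card I * R)) ^ k" by (intro power_mono N2) auto
  also have "\<dots> = exp (ln (300 / \<zeta>\<^sup>2)) ^ (k * (2 * m * R))"
    using pos2 by (simp add: power_mult[symmetric] m_def mult_ac)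
  also have "\<dots> = exp (a2 - 3)" unfolding exp_of_nat_mult[symmetric] by (simp add: a2_def \<zeta>_def)
  finally have cL2: "real (card L2) \<le> exp (a2 - 3)" .
  define t1 where "t1 = sqrt (2 * (4 ^ k * E\<^sup>2 / real R) * a1)"
  define t2 where "t2 = sqrt (2 * (4 ^ k * E\<^sup>2) * a2)"
  \<comment> \<open>The 3 added to the entropy leaves each family a failure proportion of at most 2
    exp(-3), which is at most 1/4.\<close>
  have tail: "real (card {g \<in> signs ?P. \<exists>B\<in>L. \<bar>\<Sum>p\<in>?P. g p * y B p\<bar> > sqrt (2 * v * a)})
      \<le> real (card (signs ?P)) * (1 / 4)"
    if L: "finite L" "real (card L) \<le> exp (a - 3)" and v: "v > 0" "a > 0"
      "\<And>B. B \<in> L \<Longrightarrow> (\<Sum>p\<in>?P. (y B p)\<^sup>2) \<le> v" for L v a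
  proof -
    have "real (card {g \<in> signs ?P. \<exists>B\<in>L. \<bar>\<Sum>p\<in>?P. g p * y B p\<bar> > sqrt (2 * v * a)})
      \<le> real (card L) * (2 * real (card (signs ?P)) * exp (- (sqrt (2 * v * a))\<^sup>2 / (2 * v)))"
      by (rule card_signs_tail_family[where e = "\<lambda>f. f"]) (use fin L v in \<open>auto intro: finite_PiE\<close>)
    also have "- (sqrt (2 * v * a))\<^sup>2 / (2 * v) = - a" using v by simp
    also have "real (card L) * (2 * real (card (signs ?P)) * exp (- a))
        \<le> exp (a - 3) * (2 * real (card (signs ?P)) * exp (- a))"
      using L by (intro mult_right_mono) auto
    also have "\<dots> = real (card (signs ?P)) * (2 * exp (- 3))"
      by (simp add: exp_diff exp_minus field_simps)
    also have "\<dots> \<le> real (card (signs ?P)) * (1 / 4)" by (intro mult_left_mono exp_neg_3) auto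
    finally show ?thesis .
  qed
  \<comment> \<open>The slot of small operator norm contributes (2 r)^2 = 4 / R, each of the other k
    - 1 slots at most 4.\<close>
  have var1: "(\<Sum>p\<in>?P. (y B p)\<^sup>2) \<le> 4 ^ k * E\<^sup>2 / real R" if BL: "B \<in> L1" for B
  proof -
    obtain j0 where j0: "j0 \<in> J" "small_op (2 * r) (B j0)" using BL by (auto simp: L1_def)
    have "(\<Sum>p\<in>?P. (y B p)\<^sup>2) \<le> E\<^sup>2 * (2 * r)\<^sup>2 * (\<Prod>j\<in>J - {j0}. (L2_set (B j) ?II)\<^sup>2)"
      unfolding y_def
      by (rule mlf_rows_sum_squares_le_op) (use fin E j0 r in \<open>auto simp: small_op_def\<close>)
    also have "\<dots> \<le> E\<^sup>2 * (2 * r)\<^sup>2 * (\<Prod>j\<in>J - {j0}. 2\<^sup>2)"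
      using BL by (intro mult_left_mono prod_mono conjI power_mono) (auto simp: L1_def)
    also have "(\<Prod>j\<in>J - {j0}. 2\<^sup>2 :: real) = 4 ^ (k - 1)" using fin j0 by (simp add: k_def)
    also have "E\<^sup>2 * (2 * r)\<^sup>2 * 4 ^ (k - 1) = E\<^sup>2 * r\<^sup>2 * (4 * 4 ^ (k - 1))" by (simp add: power_mult_distrib)
    also have "4 * 4 ^ (k - 1) = (4 ^ k :: real)" using k by (cases k) auto
    finally show ?thesis by (simp add: r mult_ac)
  qed
  have var2: "(\<Sum>p\<in>?P. (y B p)\<^sup>2) \<le> 4 ^ k * E\<^sup>2" if "B \<in> L2" for B
  proof -
    have "(\<Sum>p\<in>?P. (y B p)\<^sup>2) \<le> E\<^sup>2 * (\<Prod>j\<in>J. (L2_set (B j) ?II)\<^sup>2)"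
      unfolding y_def by (rule mlf_rows_sum_squares_le) (use fin E in auto)
    also have "\<dots> \<le> E\<^sup>2 * (\<Prod>j\<in>J. 2\<^sup>2)"
      using that by (intro mult_left_mono prod_mono conjI power_mono) (auto simp: L2_def)
    finally show ?thesis using fin by (simp add: k_def mult.commute)
  qed
  have finP: "finite ?P" using fin by (intro finite_PiE) auto
  define Bad1 where "Bad1 = {g \<in> signs ?P. \<exists>B\<in>L1. \<bar>\<Sum>p\<in>?P. g p * y B p\<bar> > t1}"
  define Bad2 where "Bad2 = {g \<in> signs ?P. \<exists>B\<in>L2. \<bar>\<Sum>p\<in>?P. g p * y B p\<bar> > t2}"
  have v_pos: "4 ^ k * E\<^sup>2 / real R > 0" "4 ^ k * E\<^sup>2 > 0" using E R by auto
  have bad: "real (card Bad1) \<le> real (card (signs ?P)) * (1 / 4)" "real (card Bad2) \<le> real (card (signs ?P)) * (1 / 4)"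
    unfolding Bad1_def t1_def Bad2_def t2_def
    by (rule tail[OF finL(1) cL1 v_pos(1) a_pos(1) var1] tail[OF finL(2) cL2 v_pos(2) a_pos(2) var2]; assumption)+
  have "card (Bad1 \<union> Bad2) \<le> card Bad1 + card Bad2" by (rule card_Un_le)
  then have "real (card (Bad1 \<union> Bad2)) \<le> real (card (signs ?P)) * (1 / 2)" using bad by linarith
  also have "\<dots> < real (card (signs ?P))" by (simp add: card_signs finP)
  finally have "Bad1 \<union> Bad2 \<noteq> signs ?P" by auto
  then obtain g where g: "g \<in> signs ?P" "g \<notin> Bad1" "g \<notin> Bad2" unfolding Bad1_def Bad2_def by blast
  have gL1: "\<bar>F g B\<bar> \<le> t1" if "B \<in> L1" for B
    using g that unfolding Fy Bad1_def by force
  have gL2: "\<bar>F g B\<bar> \<le> t2" if "B \<in> L2" for B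
    using g that unfolding Fy Bad2_def by force
  have "L2_set g ?P = sqrt (real m ^ k)"
  proof -
    have "(\<Sum>p\<in>?P. (g p)\<^sup>2) = (\<Sum>p\<in>?P. 1)" by (intro sum.cong refl signs_power2[OF g(1)])
    then show ?thesis using fin by (simp add: L2_set_def card_PiE m_def k_def)
  qed
  then have F_le: "\<bar>F g B\<bar> \<le> (sqrt (real m ^ k) * E) * (\<Prod>j\<in>J. L2_set (B j) ?II)" for B
    using mlf_pair_tensor_le[OF fin(1,3) _ E(2), of g B] E(1) by (simp add: F_def)
  have round: "\<bar>F g x\<bar> \<le> \<bar>F g z\<bar> + err"
    if "\<And>j. j \<in> J \<Longrightarrow> L2_set (x j) ?II \<le> 1" "\<And>j. j \<in> J \<Longrightarrow> L2_set (\<lambda>i. x j i - z j i) ?II \<le> \<eta>" for x z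
  proof -
    have "\<bar>F g x - F g z\<bar> \<le> real (card J) * (2 ^ card J * \<eta> * (sqrt (real m ^ k) * E))"
      unfolding F_def
    proof (rule mlf_perturb)
      show "L2_set (x j) ?II \<le> 2" "L2_set (z j) ?II \<le> 2" if j: "j \<in> J" for j
        using that L2_set_close_le_2[OF \<open>j \<in> J \<Longrightarrow> L2_set (x j) ?II \<le> 1\<close>
          \<open>j \<in> J \<Longrightarrow> L2_set (\<lambda>i. x j i - z j i) ?II \<le> \<eta>\<close> eta1(1)] \<open>j \<in> J \<Longrightarrow> L2_set (x j) ?II \<le> 1\<close> by auto
    qed (use fin E F_le that in \<open>auto simp: F_def\<close>)
    then show ?thesis by (simp add: err_def k_def)
  qed
  have restrict_F: "F g (restrict z J) = F g z" for z
    unfolding F_def by (rule mlf_cong) auto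
  have small: "\<bar>F g x\<bar> \<le> t1 + err"
    if x: "\<And>j. j \<in> J \<Longrightarrow> L2_set (x j) ?II \<le> 1" and j0: "j0 \<in> J" "small_op r (x j0)" for x j0
  proof -
    have "\<exists>z\<in>N1. L2_set (\<lambda>i. x j i - z i) ?II \<le> \<eta>" if "j \<in> J" for j
      using N1(1) x[OF that] unfolding is_net_def by blast
    then obtain z where z: "\<And>j. j \<in> J \<Longrightarrow> z j \<in> N1" "\<And>j. j \<in> J \<Longrightarrow> L2_set (\<lambda>i. x j i - z j i) ?II \<le> \<eta>"
      by metis
    have "small_op (2 * r) (z j0)" unfolding small_op_def
    proof
      fix h
      have "L2_set (\<lambda>p. \<Sum>q\<in>I. z j0 (p, q) * h q) I
        = L2_set (\<lambda>p. (\<Sum>q\<in>I. x j0 (p, q) * h q) + - 1 * (\<Sum>q\<in>I. (\<lambda>i. x j0 i - z j0 i) (p, q) * h q)) I"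
        by (simp add: left_diff_distrib sum_subtractf)
      also have "\<dots> \<le> L2_set (\<lambda>p. \<Sum>q\<in>I. x j0 (p, q) * h q) I
          + L2_set (\<lambda>p. - 1 * (\<Sum>q\<in>I. (\<lambda>i. x j0 i - z j0 i) (p, q) * h q)) I"
        by (rule L2_set_triangle_ineq)
      also have "\<dots> \<le> r * L2_set h I + \<eta> * L2_set h I"
      proof (rule add_mono)
        show "L2_set (\<lambda>p. \<Sum>q\<in>I. x j0 (p, q) * h q) I \<le> r * L2_set h I"
          using j0 by (simp add: small_op_def)
        have "L2_set (\<lambda>p. \<Sum>q\<in>I. (\<lambda>i. x j0 i - z j0 i) (p, q) * h q) I
            \<le> L2_set (\<lambda>i. x j0 i - z j0 i) ?II * L2_set h I"
          by (rule L2_set_matrix_vector_le)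
        also have "\<dots> \<le> \<eta> * L2_set h I" by (intro mult_right_mono z j0) auto
        finally show "L2_set (\<lambda>p. - 1 * (\<Sum>q\<in>I. (\<lambda>i. x j0 i - z j0 i) (p, q) * h q)) I \<le> \<eta> * L2_set h I"
          unfolding L2_set_scale by simp
      qed
      also have "\<dots> = (r + \<eta>) * L2_set h I" by (simp add: algebra_simps)
      also have "\<dots> \<le> (2 * r) * L2_set h I" using eta1 by (intro mult_right_mono) auto
      finally show "L2_set (\<lambda>p. \<Sum>q\<in>I. z j0 (p, q) * h q) I \<le> 2 * r * L2_set h I" .
    qed
    then have "restrict z J \<in> L1"
      using z j0 L2_set_close_le_2[OF x z(2) eta1(1)] by (auto simp: L1_def)
    then show ?thesis using gL1[of "restrict z J"] round[of x z, OF x z(2)] by (simp add: restrict_F)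
  qed
  have low: "\<bar>F g x\<bar> \<le> t2 + err"
    if x: "\<And>j. j \<in> J \<Longrightarrow> L2_set (x j) ?II \<le> 1"
      "\<And>j. j \<in> J \<Longrightarrow> \<exists>z\<in>N2. L2_set (\<lambda>i. x j i - z i) ?II \<le> \<eta>" for x
  proof -
    obtain z where z: "\<And>j. j \<in> J \<Longrightarrow> z j \<in> N2" "\<And>j. j \<in> J \<Longrightarrow> L2_set (\<lambda>i. x j i - z j i) ?II \<le> \<eta>"
      using x(2) by metis
    have "restrict z J \<in> L2"
      using z L2_set_close_le_2[OF x(1) z(2) eta1(1)] by (auto simp: L2_def)
    then show ?thesis using gL2[of "restrict z J"] round[of x z, OF x(1) z(2)] by (simp add: restrict_F)
  qed
  have "\<bar>F g B\<bar> \<le> real k * (t1 + err) + (t2 + err)" if B: "\<And>j. j \<in> J \<Longrightarrow> L2_set (B j) ?II \<le> 1" for B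
  proof -
    have "\<forall>j\<in>J. \<exists>D. (\<forall>x. B j x = fst D x + snd D x) \<and> L2_set (fst D) ?II \<le> 1 \<and> L2_set (snd D) ?II \<le> 1
        \<and> (\<exists>z\<in>N2. L2_set (\<lambda>i. fst D i - z i) ?II \<le> \<eta>) \<and> small_op r (snd D)"
    proof
      fix j assume j: "j \<in> J"
      obtain W V B' B'' where lr:
        "L2_set W (I \<times> {..<R}) \<le> 1" "L2_set V (I \<times> {..<R}) \<le> sqrt (real R)"
        "\<And>p q. B' (p, q) = (\<Sum>l<R. W (p, l) * V (q, l))"
        and dec: "\<And>x. B j x = B' x + B'' x" "L2_set B' ?II \<le> 1" "L2_set B'' ?II \<le> 1"
        and op: "\<And>h. L2_set (\<lambda>p. \<Sum>q\<in>I. B'' (p, q) * h q) I \<le> 1 / sqrt (real R) * L2_set h I"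
        using low_rank_plus_small_op[OF fin(3) R B[OF j]] by blast
      have "small_op r B''" unfolding small_op_def r_def using op by blast
      moreover have "\<exists>z\<in>N2. L2_set (\<lambda>i. B' i - z i) ?II \<le> \<eta>"
        using N2(3)[OF lr] unfolding zeta(3) .
      ultimately show "\<exists>D. (\<forall>x. B j x = fst D x + snd D x) \<and> L2_set (fst D) ?II \<le> 1 \<and> L2_set (snd D) ?II \<le> 1
        \<and> (\<exists>z\<in>N2. L2_set (\<lambda>i. fst D i - z i) ?II \<le> \<eta>) \<and> small_op r (snd D)"
        using dec by (intro exI[of _ "(B', B'')"]) auto
    qed
    from bchoice[OF this] obtain D where D: "\<forall>j\<in>J. (\<forall>x. B j x = fst (D j) x + snd (D j) x) \<and>
        L2_set (fst (D j)) ?II \<le> 1 \<and> L2_set (snd (D j)) ?II \<le> 1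
        \<and> (\<exists>z\<in>N2. L2_set (\<lambda>i. fst (D j) i - z i) ?II \<le> \<eta>) \<and> small_op r (snd (D j))" by blast
    define B' where "B' j = fst (D j)" for j
    define B'' where "B'' j = snd (D j)" for j
    have dec: "\<And>j. j \<in> J \<Longrightarrow> B j = (\<lambda>x. B' j x + B'' j x)"
      "\<And>j. j \<in> J \<Longrightarrow> L2_set (B' j) ?II \<le> 1" "\<And>j. j \<in> J \<Longrightarrow> L2_set (B'' j) ?II \<le> 1"
      "\<And>j. j \<in> J \<Longrightarrow> \<exists>z\<in>N2. L2_set (\<lambda>i. B' j i - z i) ?II \<le> \<eta>"
      "\<And>j. j \<in> J \<Longrightarrow> small_op r (B'' j)"
      using D unfolding B'_def B''_def by (blast | (rule ext, blast))+
    \<comment> \<open>Switching slot j from B_j to its low-rank part leaves an error form with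
      \<open>B'' j\<close> there and unit-ball matrices in the other slots, to which
      \<open>small\<close> applies. After all k switches every slot has low rank and
      \<open>low\<close> applies.\<close>
    define z where "z S = (\<lambda>j. if j \<in> S then B' j else B j)" for S
    have "\<bar>F g B\<bar> \<le> real (card S) * (t1 + err) + \<bar>F g (z S)\<bar>" if "S \<subseteq> J" for S
      using finite_subset[OF that fin(1)] that
    proof (induction S rule: finite_induct)
      case empty
      then show ?case by (simp add: z_def)
    next
      case (insert j S)
      have j: "j \<in> J" using insert.prems by auto
      have "z S = (z S)(j := (\<lambda>x. B' j x + B'' j x))" using insert.hyps dec(1)[OF j] by (auto simp: z_def)
      moreover have "(z S)(j := B' j) = z (insert j S)" by (auto simp: z_def)
      ultimately have "F g (z S) = F g (z (insert j S)) + F g ((z S)(j := B'' j))"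
        unfolding F_def
        using mlf_add[where A="\<lambda>_. ?II", OF fin(1) j, of "pair_tensor J g g'" "z S" "B' j" "B'' j"] fin by simp
      moreover have "\<bar>F g ((z S)(j := B'' j))\<bar> \<le> t1 + err"
        by (rule small[OF _ j]) (use B dec j in \<open>auto simp: z_def\<close>)
      moreover have "\<bar>F g B\<bar> \<le> real (card S) * (t1 + err) + \<bar>F g (z S)\<bar>" using insert by auto
      ultimately show ?case using insert.hyps by (simp add: algebra_simps)
    qed
    from this[of J] have "\<bar>F g B\<bar> \<le> real k * (t1 + err) + \<bar>F g (z J)\<bar>" by (simp add: k_def)
    moreover have "\<bar>F g (z J)\<bar> \<le> t2 + err" by (rule low) (use dec in \<open>auto simp: z_def\<close>)
    ultimately show ?thesis by simp
  qed
  then show ?thesis using that[OF g(1)] unfolding F_def t1_def t2_def by blast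
qed

section \<open>Parameters for the injective norm bound\<close>

lemma half_le_ln: "(1 / 2 :: real) \<le> ln (real m)" if "m \<ge> 2"
proof -
  have "exp (1 / 2) ^ 2 = exp (1 :: real)" by (simp add: exp_of_nat_mult[symmetric])
  also have "\<dots> \<le> 2 ^ 2" using exp_le by simp
  finally have "exp (1 / 2 :: real) \<le> 2" by (rule power2_le_imp_le) simp
  then have "exp (1 / 2) \<le> real m" using that by linarith
  then show ?thesis using that ln_ge_iff[of "real m" "1 / 2"] by linarith
qed

lemma mlf_scale:
  "mlf J A T (\<lambda>j i. r j * x j i) = (\<Prod>j\<in>J. r j) * mlf J A T x"
  unfolding mlf_def by (simp add: prod.distrib sum_distrib_left mult_ac)

text \<open>Homogeneity. A slot of norm zero needs no normalisation, since its vector vanishes on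
  the index set.\<close>

lemma mlf_le_of_unit_balls:
  assumes fin: "finite J" "\<And>j. j \<in> J \<Longrightarrow> finite (A j)"
    and unit: "\<And>x. (\<And>j. j \<in> J \<Longrightarrow> L2_set (x j) (A j) \<le> 1) \<Longrightarrow> \<bar>mlf J A T x\<bar> \<le> b"
  shows "\<bar>mlf J A T x\<bar> \<le> b * (\<Prod>j\<in>J. L2_set (x j) (A j))"
proof -
  define r where "r j = L2_set (x j) (A j)" for j
  define u where "u = (\<lambda>j i. (1 / r j) * x j i)"
  have "mlf J A T x = mlf J A T (\<lambda>j i. r j * u j i)"
  proof (rule mlf_cong)
    fix j i assume "j \<in> J" "i \<in> A j"
    then show "x j i = r j * u j i"
      using fin L2_set_eq_0_iff[of "A j" "x j"] by (cases "r j = 0") (auto simp: u_def r_def)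
  qed
  then have "\<bar>mlf J A T x\<bar> = (\<Prod>j\<in>J. r j) * \<bar>mlf J A T u\<bar>"
    unfolding mlf_scale by (simp add: abs_mult abs_prod r_def)
  also have "\<dots> \<le> (\<Prod>j\<in>J. r j) * b"
  proof (intro mult_left_mono unit)
    fix j assume "j \<in> J"
    show "L2_set (u j) (A j) \<le> 1"
      unfolding u_def L2_set_scale r_def[symmetric] by (simp add: r_def)
  qed (auto simp: r_def intro: prod_nonneg)
  finally show ?thesis by (simp add: r_def mult.commute)
qed

lemma exists_sign_tensor:
  assumes "finite J" "finite I" "I \<noteq> {}"
  obtains g where "g \<in> signs (\<Pi>\<^sub>E j\<in>J. I)"
    "\<And>u. \<bar>mlf J (\<lambda>_. I) g u\<bar> \<le> net_bound (card J) (real (card J) * real (card I)) * (\<Prod>j\<in>J. L2_set (u j) I)"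
proof -
  let ?P = "\<Pi>\<^sub>E j\<in>J. I"
  have finP: "finite ?P" using assms by (intro finite_PiE) auto
  let ?Bad = "{s \<in> signs ?P. \<not> (\<forall>x. \<bar>mlf J (\<lambda>_. I) (\<lambda>f. s (id f)) x\<bar>
      \<le> net_bound (card J) (\<Sum>j\<in>J. real (card I)) * (\<Prod>j\<in>J. L2_set (x j) I))}"
  have "real (card ?Bad) \<le> real (card (signs ?P)) / 8"
    by (rule random_tensor_norm) (use assms finP in auto)
  also have "\<dots> < real (card (signs ?P))" by (simp add: card_signs finP)
  finally have "?Bad \<noteq> signs ?P" by auto
  then obtain g where g: "g \<in> signs ?P" "g \<notin> ?Bad" by blast
  then have "\<forall>x. \<bar>mlf J (\<lambda>_. I) g x\<bar>
      \<le> net_bound (card J) (real (card J) * real (card I)) * (\<Prod>j\<in>J. L2_set (x j) I)"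
    by simp
  then show ?thesis using that[OF g(1)] by blast
qed

text \<open>With card I = m^2 and R = m, \<open>E\<close> is of order m, the entropies are of order
  m^4 log m and m^3 log m, and the variances of order E^2 / m and E^2. Both deviations are therefore
  of order m sqrt(m^3 log m).\<close>

lemma exists_pair_tensor:
  fixes k :: nat
  assumes k: "k \<ge> 1"
  shows "\<exists>C>0. \<forall>m\<ge>2. \<exists>g\<in>signs (\<Pi>\<^sub>E j\<in>{..<k}. {..<m\<^sup>2}). \<exists>g'\<in>signs (\<Pi>\<^sub>E j\<in>{..<k}. {..<m\<^sup>2}). \<forall>B.
    \<bar>mlf {..<k} (\<lambda>_. {..<m\<^sup>2} \<times> {..<m\<^sup>2}) (pair_tensor {..<k} g g') B\<bar>
      \<le> C * (real m * sqrt (real m ^ 3 * ln (real m))) * (\<Prod>j<k. L2_set (B j) ({..<m\<^sup>2} \<times> {..<m\<^sup>2}))"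
proof -
  \<comment> \<open>\<open>CE\<close> bounds E / m, \<open>K\<close> bounds the two entropies in
    units of m^4 log m and m^3 log m, and \<open>C\<close> collects the k + 1 terms of the final
    sum.\<close>
  define CE where "CE = 2 ^ k * sqrt (2 * 4 ^ k * (8 * real k + 4))"
  define K where "K = 2 * real k * (4 * real k + 13) + 6"
  define C where "C = CE * ((real k + 1) * (sqrt (2 * 4 ^ k * K) + real k * 2 ^ k))"
  have CE: "CE > 0" by (auto simp: CE_def intro!: mult_pos_pos add_nonneg_pos)
  have K: "K > 0" by (auto simp: K_def intro!: add_nonneg_pos)
  have C: "C > 0" using CE K k by (auto simp: C_def intro!: mult_pos_pos add_pos_nonneg)
  have "\<exists>g\<in>signs (\<Pi>\<^sub>E j\<in>{..<k}. {..<m\<^sup>2}). \<exists>g'\<in>signs (\<Pi>\<^sub>E j\<in>{..<k}. {..<m\<^sup>2}). \<forall>B.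
    \<bar>mlf {..<k} (\<lambda>_. {..<m\<^sup>2} \<times> {..<m\<^sup>2}) (pair_tensor {..<k} g g') B\<bar>
      \<le> C * (real m * sqrt (real m ^ 3 * ln (real m))) * (\<Prod>j<k. L2_set (B j) ({..<m\<^sup>2} \<times> {..<m\<^sup>2}))"
    if m: "m \<ge> 2" for m
  proof -
    let ?I = "{..<m\<^sup>2}"
    have I: "finite ?I" "?I \<noteq> {}" using m by (auto simp: lessThan_empty_iff)
    have k0: "finite {..<k}" "{..<k} \<noteq> {}" using k by (auto simp: lessThan_empty_iff)
    define L where "L = ln (real m)"
    have L: "L \<ge> 1 / 2" unfolding L_def by (rule half_le_ln[OF m])
    define x where "x = real m"
    have x: "x \<ge> 2" using m by (simp add: x_def)
    define E where "E = net_bound k (real k * x\<^sup>2)"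
    obtain g' where g': "g' \<in> signs (\<Pi>\<^sub>E j\<in>{..<k}. ?I)"
      "\<And>u. \<bar>mlf {..<k} (\<lambda>_. ?I) g' u\<bar> \<le> E * (\<Prod>j<k. L2_set (u j) ?I)"
      using exists_sign_tensor[OF k0(1) I] by (auto simp: E_def x_def)
    have E_pos: "E > 0" by (auto simp: E_def net_bound_def intro!: mult_pos_pos add_nonneg_pos)
    have x2: "1 \<le> x\<^sup>2" using x by (simp add: one_le_power)
    have "E \<le> 2 ^ k * sqrt (2 * 4 ^ k * (8 * real k + 4) * x\<^sup>2)"
    proof -
      have "8 * (real k * x\<^sup>2) + 4 \<le> (8 * real k + 4) * x\<^sup>2" using x2 by (simp add: algebra_simps)
      then show ?thesis unfolding E_def net_bound_def by (simp add: mult.assoc)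
    qed
    also have "\<dots> = CE * x" using x by (simp add: real_sqrt_mult CE_def)
    finally have E_le: "E \<le> CE * x" .
    \<comment> \<open>Fine enough to beat the norm m^k of \<open>g\<close>, which enters
      \<open>err\<close> through the Cauchy-Schwarz bound. The entropy sees \<eta> through its
      logarithm only, so this costs a factor of order k log m.\<close>
    define \<eta> where "\<eta> = 1 / x ^ (2 * k)"
    have x2k: "x ^ (2 * k) \<ge> x" using x k by (intro self_le_power) auto
    have eta: "0 < \<eta>" using x by (simp add: \<eta>_def)
    have "sqrt x \<le> x" using x real_sqrt_le_iff[of x "x\<^sup>2"] by (simp add: self_le_power)
    then have eta': "\<eta> \<le> 1 / sqrt (real m)"
      using x x2k unfolding \<eta>_def x_def[symmetric] by (intro divide_left_mono) auto
    have "m \<ge> 1" using m by simp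
    from exists_signs_pair_tensor[OF k0 I this E_pos g'(2) eta eta']
    obtain g where g: "g \<in> signs (\<Pi>\<^sub>E j\<in>{..<k}. ?I)"
      and bound: "\<And>B. (\<And>j. j \<in> {..<k} \<Longrightarrow> L2_set (B j) (?I \<times> ?I) \<le> 1) \<Longrightarrow>
      \<bar>mlf {..<k} (\<lambda>_. ?I \<times> ?I) (pair_tensor {..<k} g g') B\<bar>
      \<le> real k * (sqrt (2 * (4 ^ k * E\<^sup>2 / real m) * (real (k * (m\<^sup>2)\<^sup>2) * ln (300 / \<eta>\<^sup>2) + 3))
          + real k * (2 ^ k * \<eta> * (sqrt (real (m\<^sup>2) ^ k) * E)))
        + (sqrt (2 * (4 ^ k * E\<^sup>2) * (real (k * (2 * m\<^sup>2 * m)) * ln (300 / (\<eta> / (3 * sqrt (real m)))\<^sup>2) + 3))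
          + real k * (2 ^ k * \<eta> * (sqrt (real (m\<^sup>2) ^ k) * E)))"
      by (auto simp only: card_lessThan)
    define a1 where "a1 = real (k * (m\<^sup>2)\<^sup>2) * ln (300 / \<eta>\<^sup>2) + 3"
    define a2 where "a2 = real (k * (2 * m\<^sup>2 * m)) * ln (300 / (\<eta> / (3 * sqrt (real m)))\<^sup>2) + 3"
    define err where "err = real k * (2 ^ k * \<eta> * (sqrt (real (m\<^sup>2) ^ k) * E))"
    have ln_le: "ln y \<le> real n * L" if "0 < y" "y \<le> x ^ n" for y n
    proof -
      have "ln y \<le> ln (x ^ n)" using that by (intro ln_mono) auto
      then show ?thesis using x by (simp add: ln_realpow L_def x_def)
    qed
    have pow2: "2 ^ n \<le> x ^ n" for n using x by (intro power_mono) auto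
    \<comment> \<open>300 is below 2^9, and 2700 below is less than 2^12, so the constants become
      powers of m and the logarithms multiples of log m.\<close>
    have "300 / \<eta>\<^sup>2 = 300 * x ^ (4 * k)" by (simp add: \<eta>_def power_divide power_mult[symmetric] mult.commute)
    also have "\<dots> \<le> x ^ 9 * x ^ (4 * k)" using pow2[of 9] x by (intro mult_right_mono) auto
    finally have l1: "ln (300 / \<eta>\<^sup>2) \<le> real (9 + 4 * k) * L"
      using eta by (intro ln_le) (auto simp: power_add)
    have "300 / (\<eta> / (3 * sqrt x))\<^sup>2 = 2700 * (x * x ^ (4 * k))"
      using x by (simp add: \<eta>_def power_divide power_mult_distrib power_mult[symmetric] mult.commute)
    also have "\<dots> \<le> x ^ 12 * (x * x ^ (4 * k))" using pow2[of 12] x by (intro mult_right_mono) auto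
    also have "\<dots> = x ^ (13 + 4 * k)" by (simp add: power_add numeral_eq_Suc)
    finally have l2: "ln (300 / (\<eta> / (3 * sqrt (real m)))\<^sup>2) \<le> real (13 + 4 * k) * L"
      using eta x unfolding x_def[symmetric] by (intro ln_le) auto
    \<comment> \<open>log m is at least 1/2, which absorbs the additive 3.\<close>
    have "1 \<le> x ^ 4" "1 \<le> x ^ 3" using x by (auto intro: one_le_power)
    then have three: "3 \<le> 6 * (x ^ 4 * L)" "3 \<le> 6 * (x ^ 3 * L)"
      using mult_mono[OF _ L, of 1 "x ^ 4"] mult_mono[OF _ L, of 1 "x ^ 3"] x by linarith+
    have "a1 \<le> real k * x ^ 4 * (real (9 + 4 * k) * L) + 6 * (x ^ 4 * L)"
    proof -
      have "real (k * (m\<^sup>2)\<^sup>2) = real k * x ^ 4" by (simp add: x_def)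
      moreover have "real k * x ^ 4 * ln (300 / \<eta>\<^sup>2) \<le> real k * x ^ 4 * (real (9 + 4 * k) * L)"
        using x by (intro mult_left_mono l1) auto
      ultimately show ?thesis using three(1) by (simp only: a1_def)
    qed
    also have "\<dots> = (real k * (9 + 4 * real k) + 6) * (x ^ 4 * L)" by (simp add: algebra_simps)
    also have "\<dots> \<le> K * (x ^ 4 * L)"
      using x L unfolding K_def by (intro mult_right_mono add_mono) (auto simp: algebra_simps intro!: mult_nonneg_nonneg)
    finally have a1: "a1 \<le> K * (x ^ 4 * L)" .
    have "a2 \<le> 2 * real k * x ^ 3 * (real (13 + 4 * k) * L) + 6 * (x ^ 3 * L)"
    proof -
      have "real (k * (2 * m\<^sup>2 * m)) = 2 * real k * x ^ 3" by (simp add: x_def power2_eq_square power3_eq_cube)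
      moreover have "2 * real k * x ^ 3 * ln (300 / (\<eta> / (3 * sqrt (real m)))\<^sup>2)
          \<le> 2 * real k * x ^ 3 * (real (13 + 4 * k) * L)"
        using x by (intro mult_left_mono l2) auto
      ultimately show ?thesis using three(2) by (simp only: a2_def)
    qed
    also have "\<dots> = K * (x ^ 3 * L)" by (simp add: K_def algebra_simps)
    finally have a2: "a2 \<le> K * (x ^ 3 * L)" .
    define s where "s = sqrt (x ^ 3 * L)"
    have s: "s \<ge> 1"
    proof -
      have "2 ^ 3 * (1 / 2) \<le> x ^ 3 * L" by (intro mult_mono pow2 L) (use x in auto)
      then show ?thesis by (simp add: s_def)
    qed
    define T where "T = sqrt (2 * 4 ^ k * K)"
    have T: "T \<ge> 0" using K by (simp add: T_def)
    have Ts: "sqrt (2 * 4 ^ k * K * E\<^sup>2 * (x ^ 3 * L)) = T * E * s"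
      using E_pos by (simp add: T_def s_def real_sqrt_mult)
    have "2 * (4 ^ k * E\<^sup>2 / real m) * a1 \<le> 2 * (4 ^ k * E\<^sup>2 / real m) * (K * (x ^ 4 * L))"
      by (intro mult_left_mono a1) auto
    also have "\<dots> = 2 * 4 ^ k * K * E\<^sup>2 * (x ^ 3 * L)"
      using x by (simp add: x_def[symmetric] power4_eq_xxxx power3_eq_cube)
    finally have t1: "sqrt (2 * (4 ^ k * E\<^sup>2 / real m) * a1) \<le> T * E * s"
      unfolding Ts[symmetric] by (rule real_sqrt_le_mono)
    have "2 * (4 ^ k * E\<^sup>2) * a2 \<le> 2 * (4 ^ k * E\<^sup>2) * (K * (x ^ 3 * L))"
      by (intro mult_left_mono a2) auto
    also have "\<dots> = 2 * 4 ^ k * K * E\<^sup>2 * (x ^ 3 * L)" by simp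
    finally have t2: "sqrt (2 * (4 ^ k * E\<^sup>2) * a2) \<le> T * E * s"
      unfolding Ts[symmetric] by (rule real_sqrt_le_mono)
    have "\<eta> * sqrt (real (m\<^sup>2) ^ k) \<le> 1"
    proof -
      have "sqrt (real (m\<^sup>2) ^ k) = x ^ k"
        using x by (intro real_sqrt_unique) (auto simp: x_def power_mult[symmetric] mult.commute)
      moreover have "x ^ k \<le> x ^ (2 * k)" using x by (intro power_increasing) auto
      ultimately show ?thesis using x by (simp add: \<eta>_def divide_le_eq)
    qed
    then have "2 ^ k * E * (\<eta> * sqrt (real (m\<^sup>2) ^ k)) \<le> 2 ^ k * E * s"
      using s E_pos by (intro mult_left_mono) auto
    then have "real k * (2 ^ k * E * (\<eta> * sqrt (real (m\<^sup>2) ^ k))) \<le> real k * (2 ^ k * E * s)"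
      by (rule mult_left_mono) simp
    then have err: "err \<le> real k * 2 ^ k * E * s"
      unfolding err_def by (simp only: mult_ac)
    have total: "real k * (sqrt (2 * (4 ^ k * E\<^sup>2 / real m) * a1) + err) + (sqrt (2 * (4 ^ k * E\<^sup>2) * a2) + err)
        \<le> C * (x * s)"
    proof -
      have "real k * (sqrt (2 * (4 ^ k * E\<^sup>2 / real m) * a1) + err) + (sqrt (2 * (4 ^ k * E\<^sup>2) * a2) + err)
        \<le> real k * (T * E * s + real k * 2 ^ k * E * s) + (T * E * s + real k * 2 ^ k * E * s)"
        by (intro add_mono mult_left_mono t1 t2 err) auto
      also have "\<dots> = E * (((real k + 1) * (T + real k * 2 ^ k)) * s)" by (simp add: algebra_simps)
      also have "\<dots> \<le> CE * x * (((real k + 1) * (T + real k * 2 ^ k)) * s)"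
        using s T by (intro mult_right_mono E_le mult_nonneg_nonneg) auto
      also have "\<dots> = C * (x * s)" by (simp add: C_def T_def mult_ac)
      finally show ?thesis .
    qed
    have "\<bar>mlf {..<k} (\<lambda>_. ?I \<times> ?I) (pair_tensor {..<k} g g') B\<bar>
        \<le> C * (x * s) * (\<Prod>j<k. L2_set (B j) (?I \<times> ?I))" for B
    proof (rule mlf_le_of_unit_balls)
      fix B assume "\<And>j. j \<in> {..<k} \<Longrightarrow> L2_set (B j) (?I \<times> ?I) \<le> 1"
      from bound[OF this] total
      show "\<bar>mlf {..<k} (\<lambda>_. ?I \<times> ?I) (pair_tensor {..<k} g g') B\<bar> \<le> C * (x * s)"
        unfolding a1_def a2_def err_def by (rule order_trans)
    qed auto
    then show ?thesis using g g'(1) unfolding s_def x_def L_def by blast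
  qed
  then show ?thesis using C by blast
qed

section \<open>Random sign matrices\<close>

lemma mlf_two:
  "mlf {0, 1 :: nat} A T x = (\<Sum>a\<in>A 0. \<Sum>b\<in>A 1. T ((\<lambda>_. undefined)(0 := a, 1 := b)) * (x 0 a * x 1 b))"
proof -
  have *: "(\<Sum>f\<in>Pi\<^sub>E {0, 1 :: nat} A. \<phi> f) = (\<Sum>a\<in>A 0. \<Sum>b\<in>A 1. \<phi> ((\<lambda>_. undefined)(0 := a, 1 := b)))"
    for \<phi> :: "(nat \<Rightarrow> 'a) \<Rightarrow> real"
  proof -
    have "(\<Sum>f\<in>Pi\<^sub>E {0, 1} A. \<phi> f) = (\<Sum>f\<in>Pi\<^sub>E {1} A. \<Sum>a\<in>A 0. \<phi> (f(0 := a)))"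
      by (rule sum_PiE_insert) simp
    also have "\<dots> = (\<Sum>f\<in>Pi\<^sub>E {} A. \<Sum>b\<in>A 1. \<Sum>a\<in>A 0. \<phi> ((f(1 := b))(0 := a)))"
      by (rule sum_PiE_insert) simp
    also have "\<dots> = (\<Sum>b\<in>A 1. \<Sum>a\<in>A 0. \<phi> ((\<lambda>_. undefined)(1 := b, 0 := a)))"
      by (simp add: fun_upd_def)
    also have "\<dots> = (\<Sum>a\<in>A 0. \<Sum>b\<in>A 1. \<phi> ((\<lambda>_. undefined)(1 := b, 0 := a)))" by (rule sum.swap)
    finally show ?thesis by (simp add: fun_upd_twist)
  qed
  show ?thesis unfolding mlf_def * by simp
qed

lemma mlf_three:
  "mlf {0, 1, 2 :: nat} A T x = (\<Sum>a\<in>A 0. \<Sum>b\<in>A 1. \<Sum>c\<in>A 2.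
    T ((\<lambda>_. undefined)(0 := a, 1 := b, 2 := c)) * (x 0 a * (x 1 b * x 2 c)))"
proof -
  have *: "(\<Sum>f\<in>Pi\<^sub>E {0, 1, 2 :: nat} A. \<phi> f)
    = (\<Sum>a\<in>A 0. \<Sum>b\<in>A 1. \<Sum>c\<in>A 2. \<phi> ((\<lambda>_. undefined)(0 := a, 1 := b, 2 := c)))"
    for \<phi> :: "(nat \<Rightarrow> 'a) \<Rightarrow> real"
  proof -
    have "(\<Sum>f\<in>Pi\<^sub>E {0, 1, 2} A. \<phi> f) = (\<Sum>f\<in>Pi\<^sub>E {2, 1, 0} A. \<phi> f)"
      by (simp add: insert_commute)
    also have "\<dots> = (\<Sum>f\<in>Pi\<^sub>E {1, 0} A. \<Sum>c\<in>A 2. \<phi> (f(2 := c)))"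
      by (rule sum_PiE_insert) simp
    also have "\<dots> = (\<Sum>f\<in>Pi\<^sub>E {0} A. \<Sum>b\<in>A 1. \<Sum>c\<in>A 2. \<phi> ((f(1 := b))(2 := c)))"
      by (rule sum_PiE_insert) simp
    also have "\<dots> = (\<Sum>f\<in>Pi\<^sub>E {} A. \<Sum>a\<in>A 0. \<Sum>b\<in>A 1. \<Sum>c\<in>A 2. \<phi> ((f(0 := a))(1 := b, 2 := c)))"
      by (rule sum_PiE_insert) simp
    finally show ?thesis by (simp add: fun_upd_def)
  qed
  show ?thesis unfolding mlf_def * by simp
qed

text \<open>Multiplying row \<open>a\<close> by row \<open>b\<close> is an involution of the sign patterns that turns the
  correlation of the two rows into the linear form \<open>\<Sum>u. s (a, u)\<close>.\<close>

lemma card_signs_gram_tail: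
  fixes A :: "'a set" and U :: "'u set"
  assumes fin: "finite A" "finite U" "U \<noteq> {}" and ab: "a \<in> A" "b \<in> A" "a \<noteq> b" and t: "t \<ge> 0"
  shows "real (card {s \<in> signs (A \<times> U). \<bar>\<Sum>u\<in>U. s (a, u) * s (b, u)\<bar> > t})
    \<le> 2 * real (card (signs (A \<times> U))) * exp (- t\<^sup>2 / (2 * real (card U)))"
proof -
  let ?S = "signs (A \<times> U)"
  define \<Phi> where "\<Phi> s = (\<lambda>x\<in>A \<times> U. if fst x = a then s x * s (b, snd x) else s x)" for s :: "'a \<times> 'u \<Rightarrow> real"
  have val: "s x = - 1 \<or> s x = 1" if "s \<in> ?S" "x \<in> A \<times> U" for s x
    using that unfolding signs_def by (auto dest!: PiE_mem)
  have mem: "\<Phi> s \<in> ?S" if s: "s \<in> ?S" for s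
    unfolding signs_def
  proof (rule PiE_I)
    fix x assume x: "x \<in> A \<times> U"
    then have "(b, snd x) \<in> A \<times> U" using ab by auto
    then show "\<Phi> s x \<in> {-1, 1}" using val[OF s x] val[OF s, of "(b, snd x)"] x by (auto simp: \<Phi>_def)
  qed (simp add: \<Phi>_def)
  have invol: "\<Phi> (\<Phi> s) = s" if s: "s \<in> ?S" for s
  proof
    fix x
    show "\<Phi> (\<Phi> s) x = s x"
    proof (cases "x \<in> A \<times> U")
      case True
      then have "(b, snd x) \<in> A \<times> U" using ab by auto
      then show ?thesis using True ab val[OF s, of "(b, snd x)"] by (auto simp: \<Phi>_def)
    next
      case False
      then have "s x = undefined" using s unfolding signs_def by (rule PiE_arb[rotated])
      then show ?thesis using False by (simp add: \<Phi>_def)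
    qed
  qed
  have inj: "inj_on \<Phi> ?S" by (rule inj_on_inverseI[of _ \<Phi>]) (rule invol)
  have sum: "(\<Sum>u\<in>U. s (a, u) * s (b, u)) = (\<Sum>u\<in>U. \<Phi> s (a, u) * 1)" for s
    using ab by (intro sum.cong) (auto simp: \<Phi>_def)
  have "card {s \<in> ?S. \<bar>\<Sum>u\<in>U. s (a, u) * s (b, u)\<bar> > t} \<le> card {s \<in> ?S. \<bar>\<Sum>u\<in>U. s (a, u) * 1\<bar> > t}"
  proof (rule card_inj_on_le[of \<Phi>])
    show "inj_on \<Phi> {s \<in> ?S. \<bar>\<Sum>u\<in>U. s (a, u) * s (b, u)\<bar> > t}"
      by (rule inj_on_subset[OF inj]) auto
    show "\<Phi> ` {s \<in> ?S. \<bar>\<Sum>u\<in>U. s (a, u) * s (b, u)\<bar> > t} \<subseteq> {s \<in> ?S. \<bar>\<Sum>u\<in>U. s (a, u) * 1\<bar> > t}"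
      using mem sum by auto
    show "finite {s \<in> ?S. \<bar>\<Sum>u\<in>U. s (a, u) * 1\<bar> > t}"
      using finite_signs[of "A \<times> U"] fin by auto
  qed
  then have "real (card {s \<in> ?S. \<bar>\<Sum>u\<in>U. s (a, u) * s (b, u)\<bar> > t})
    \<le> real (card {s \<in> ?S. \<bar>\<Sum>u\<in>U. s (a, u) * 1\<bar> > t})" by simp
  also have "\<dots> \<le> 2 * real (card ?S) * exp (- t\<^sup>2 / (2 * real (card U)))"
    by (rule card_signs_tail[where e = "\<lambda>u. (a, u)"])
       (use fin ab t in \<open>auto simp: inj_on_def card_gt_0_iff\<close>)
  finally show ?thesis .
qed

text \<open>One sign family has to meet three requirements at once: the trilinear norm (for the
  separable bias), the norm of the large matrix with rows (p, i) and columns (q, j) (for the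
  players' observable), and almost orthogonality. The failure proportions 1/8, 1/8 and 1/2 add up to
  less than 1.\<close>

lemma exists_sign_matrices:
  fixes m d :: nat
  assumes m: "m \<ge> 2" and d: "real d \<ge> 9 * real m ^ 4 * sqrt (ln (real m))"
  obtains s :: "(nat \<times> nat) \<times> (nat \<times> nat) \<Rightarrow> real" where
    "\<And>a u. a \<in> {..<m\<^sup>2} \<times> {..<m\<^sup>2} \<Longrightarrow> u \<in> {..<d} \<times> {..<d} \<Longrightarrow> (s (a, u))\<^sup>2 = 1"
    "\<And>b x y. \<bar>\<Sum>a\<in>{..<m\<^sup>2} \<times> {..<m\<^sup>2}. \<Sum>i<d. \<Sum>j<d. s (a, (i, j)) * (b a * (x i * y j))\<bar>
      \<le> 500 * sqrt (real d) * (L2_set b ({..<m\<^sup>2} \<times> {..<m\<^sup>2}) * (L2_set x {..<d} * L2_set y {..<d}))"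
    "\<And>x y. \<bar>\<Sum>p\<in>{..<m\<^sup>2} \<times> {..<d}. \<Sum>q\<in>{..<m\<^sup>2} \<times> {..<d}. s ((fst p, fst q), (snd p, snd q)) * (x p * y q)\<bar>
      \<le> 500 * (real m * sqrt (real d)) * (L2_set x ({..<m\<^sup>2} \<times> {..<d}) * L2_set y ({..<m\<^sup>2} \<times> {..<d}))"
    "\<And>a b. a \<in> {..<m\<^sup>2} \<times> {..<m\<^sup>2} \<Longrightarrow> b \<in> {..<m\<^sup>2} \<times> {..<m\<^sup>2} \<Longrightarrow> a \<noteq> b \<Longrightarrow>
      \<bar>\<Sum>u\<in>{..<d} \<times> {..<d}. s (a, u) * s (b, u)\<bar> \<le> (real d)\<^sup>2 / (2 * real m ^ 4)"
proof -
  define A where "A = {..<m\<^sup>2} \<times> {..<m\<^sup>2}"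
  define U where "U = {..<d} \<times> {..<d}"
  define \<Omega> where "\<Omega> = A \<times> U"
  define n where "n = real m ^ 4"
  have n: "n \<ge> 1" "real (card A) = n"
    using m by (auto simp: n_def A_def card_cartesian_product power_add[symmetric] one_le_power
        simp flip: of_nat_mult of_nat_power)
  have L: "ln (real m) \<ge> 1 / 2" using half_le_ln[OF m] .
  have dn: "real d \<ge> 9 * n * sqrt (ln (real m))" using d by (simp add: n_def)
  have d_ge: "real d \<ge> n"
  proof -
    have "1 / 3 \<le> sqrt (ln (real m))" using L by (intro real_le_rsqrt) (simp add: power2_eq_square)
    then have "9 * n * (1 / 3) \<le> 9 * n * sqrt (ln (real m))" using n by (intro mult_left_mono) auto
    then show ?thesis using dn n by linarith
  qed
  then have d1: "d \<ge> 1" using n by linarith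
  have fin: "finite A" "finite U" "U \<noteq> {}" "finite \<Omega>" "A \<noteq> {}"
    using d1 m by (auto simp: A_def U_def \<Omega>_def lessThan_empty_iff)
  define N where "N = real (card (signs \<Omega>))"
  have N: "N > 0" using fin by (simp add: N_def card_signs)
  \<comment> \<open>The dummy factor {0} gives the three slots the same index type.\<close>
  define A3 where "A3 j = (if j = 0 then A else {..<d} \<times> {0 :: nat})" for j :: nat
  define e3 where "e3 f = (f 0, (fst (f 1), fst (f 2)))" for f :: "nat \<Rightarrow> nat \<times> nat"
  define A2 where "A2 j = {..<m\<^sup>2} \<times> {..<d}" for j :: nat
  \<comment> \<open>The sign with index ((p, q), (i, j)) becomes the entry in row (p, i) and column
    (q, j).\<close>
  define e2 where "e2 f = ((fst (f 0), fst (f 1)), (snd (f 0), snd (f 1)))" for f :: "nat \<Rightarrow> nat \<times> nat"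
  define Bad3 where "Bad3 = {s \<in> signs \<Omega>. \<not> (\<forall>x. \<bar>mlf {0, 1, 2} A3 (\<lambda>f. s (e3 f)) x\<bar>
      \<le> net_bound (card {0, 1, 2 :: nat}) (\<Sum>j\<in>{0, 1, 2}. real (card (A3 j))) * (\<Prod>j\<in>{0, 1, 2}. L2_set (x j) (A3 j)))}"
  define Bad2 where "Bad2 = {s \<in> signs \<Omega>. \<not> (\<forall>x. \<bar>mlf {0, 1} A2 (\<lambda>f. s (e2 f)) x\<bar>
      \<le> net_bound (card {0, 1 :: nat}) (\<Sum>j\<in>{0, 1}. real (card (A2 j))) * (\<Prod>j\<in>{0, 1}. L2_set (x j) (A2 j)))}"
  have b3: "real (card Bad3) \<le> N / 8"
    unfolding Bad3_def N_def
  proof (rule random_tensor_norm)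
    show "inj_on e3 (Pi\<^sub>E {0, 1, 2} A3)"
    proof (rule inj_onI)
      fix f g assume fg: "f \<in> Pi\<^sub>E {0, 1, 2} A3" "g \<in> Pi\<^sub>E {0, 1, 2} A3" "e3 f = e3 g"
      show "f = g"
      proof (rule PiE_ext[OF fg(1,2)])
        fix j :: nat assume j: "j \<in> {0, 1, 2}"
        have "f j \<in> A3 j" "g j \<in> A3 j" using fg j by auto
        then show "f j = g j" using fg(3) j by (auto simp: A3_def e3_def split: if_splits)
      qed
    qed
    show "e3 ` Pi\<^sub>E {0, 1, 2} A3 \<subseteq> \<Omega>"
    proof
      fix z assume "z \<in> e3 ` Pi\<^sub>E {0, 1, 2} A3"
      then obtain f where f: "f \<in> Pi\<^sub>E {0, 1, 2} A3" "z = e3 f" by auto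
      have "f 0 \<in> A3 0" "f 1 \<in> A3 1" "f 2 \<in> A3 2" using f by auto
      then show "z \<in> \<Omega>" by (auto simp: f e3_def A3_def \<Omega>_def U_def)
    qed
  qed (use fin d1 in \<open>auto simp: A3_def lessThan_empty_iff\<close>)
  have b2: "real (card Bad2) \<le> N / 8"
    unfolding Bad2_def N_def
  proof (rule random_tensor_norm)
    show "inj_on e2 (Pi\<^sub>E {0, 1} A2)"
    proof (rule inj_onI)
      fix f g assume fg: "f \<in> Pi\<^sub>E {0, 1} A2" "g \<in> Pi\<^sub>E {0, 1} A2" "e2 f = e2 g"
      show "f = g"
      proof (rule PiE_ext[OF fg(1,2)])
        fix j :: nat assume j: "j \<in> {0, 1}"
        then show "f j = g j" using fg(3) by (auto simp: e2_def prod_eq_iff)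
      qed
    qed
    show "e2 ` Pi\<^sub>E {0, 1} A2 \<subseteq> \<Omega>"
    proof
      fix z assume "z \<in> e2 ` Pi\<^sub>E {0, 1} A2"
      then obtain f where f: "f \<in> Pi\<^sub>E {0, 1} A2" "z = e2 f" by auto
      have "f 0 \<in> A2 0" "f 1 \<in> A2 1" using f by auto
      then show "z \<in> \<Omega>" by (auto simp: f e2_def A2_def \<Omega>_def U_def A_def)
    qed
  qed (use fin d1 m in \<open>auto simp: A2_def lessThan_empty_iff\<close>)
  \<comment> \<open>Half of the diagonal Gram entry d^2, divided by the number n = m^4 of matrices,
    as diagonal dominance requires.\<close>
  define t where "t = (real d)\<^sup>2 / (2 * n)"
  define Gb where "Gb = (\<lambda>(a, b). {s \<in> signs \<Omega>. \<bar>\<Sum>u\<in>U. s (a, u) * s (b, u)\<bar> > t})"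
  define BadG where "BadG = (\<Union>l\<in>{(a, b). a \<in> A \<and> b \<in> A \<and> a \<noteq> b}. Gb l)"
  have bG: "real (card BadG) \<le> N / 2"
  proof -
    let ?L = "{(a, b). a \<in> A \<and> b \<in> A \<and> a \<noteq> b}"
    have sub: "?L \<subseteq> A \<times> A" by auto
    have finL: "finite ?L" using fin by (intro finite_subset[OF sub]) auto
    have cG: "real (card BadG) \<le> real (card ?L) * (2 * N * exp (- t\<^sup>2 / (2 * real (card U))))"
      unfolding BadG_def
    proof (rule card_UN_le_real[OF finL])
      fix l assume "l \<in> ?L"
      then obtain a b where l: "l = (a, b)" "a \<in> A" "b \<in> A" "a \<noteq> b" by auto
      show "real (card (Gb l)) \<le> 2 * N * exp (- t\<^sup>2 / (2 * real (card U)))"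
        unfolding Gb_def l(1) N_def \<Omega>_def prod.case
        by (rule card_signs_gram_tail) (use fin l n in \<open>auto simp: t_def\<close>)
    qed
    have cL: "real (card ?L) \<le> n\<^sup>2"
    proof -
      have "card ?L \<le> card (A \<times> A)" using fin by (intro card_mono sub) auto
      then have "real (card ?L) \<le> real (card A) * real (card A)"
        by (simp add: card_cartesian_product flip: of_nat_mult)
      then show ?thesis by (simp add: n power2_eq_square)
    qed
    \<comment> \<open>The exponent is d^2 / (8 n^2), at least (81/8) ln m by the hypothesis on
      \<open>d\<close>. So a pair fails with proportion at most 2 / m^10, and there are at most m^8
      pairs. This is where the order m^4 sqrt(log m) of the dimension comes from.\<close>
    have "t\<^sup>2 / (2 * real (card U)) \<ge> 10 * ln (real m)"
    proof -
      have cU: "real (card U) = (real d)\<^sup>2" by (simp add: U_def card_cartesian_product power2_eq_square)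
      have "(9 * n * sqrt (ln (real m)))\<^sup>2 \<le> (real d)\<^sup>2" using dn n L by (intro power_mono) auto
      then have "81 * n\<^sup>2 * ln (real m) \<le> (real d)\<^sup>2" using L by (simp add: power_mult_distrib)
      then have "10 * ln (real m) \<le> (real d)\<^sup>2 / (8 * n\<^sup>2)"
        using n L by (simp add: le_divide_eq) (use L in \<open>auto intro: order_trans[rotated] mult_right_mono simp: mult_ac\<close>)
      also have "\<dots> = t\<^sup>2 / (2 * real (card U))"
        using d1 n by (simp add: t_def cU power_divide power_mult_distrib power2_eq_square field_simps)
      finally show ?thesis .
    qed
    then have "exp (- t\<^sup>2 / (2 * real (card U))) \<le> exp (- (10 * ln (real m)))" by simp
    also have "exp (- (10 * ln (real m))) = 1 / real m ^ 10"
      using m exp_of_nat_mult[of 10 "ln (real m)"] by (simp add: exp_minus inverse_eq_divide)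
    finally have e: "exp (- t\<^sup>2 / (2 * real (card U))) \<le> 1 / real m ^ 10" .
    have "n\<^sup>2 * (2 * N * exp (- t\<^sup>2 / (2 * real (card U)))) \<le> n\<^sup>2 * (2 * N * (1 / real m ^ 10))"
      using e N by (intro mult_left_mono) auto
    also have "\<dots> = N * (2 / (real m)\<^sup>2)"
      using m by (simp add: n_def power_mult[symmetric] field_simps power_add[symmetric])
    also have "\<dots> \<le> N * (2 / 2\<^sup>2)"
      using m N by (intro mult_left_mono divide_left_mono power_mono) auto
    finally have "n\<^sup>2 * (2 * N * exp (- t\<^sup>2 / (2 * real (card U)))) \<le> N / 2" by simp
    moreover have "real (card ?L) * (2 * N * exp (- t\<^sup>2 / (2 * real (card U))))
        \<le> n\<^sup>2 * (2 * N * exp (- t\<^sup>2 / (2 * real (card U))))"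
      using cL N by (intro mult_right_mono) auto
    ultimately show ?thesis using cG by linarith
  qed
  have "card (Bad3 \<union> Bad2 \<union> BadG) \<le> card Bad3 + card Bad2 + card BadG"
    using card_Un_le[of "Bad3 \<union> Bad2" BadG] card_Un_le[of Bad3 Bad2] by linarith
  then have "real (card (Bad3 \<union> Bad2 \<union> BadG)) < N" using b3 b2 bG N by linarith
  then have "Bad3 \<union> Bad2 \<union> BadG \<noteq> signs \<Omega>" by (auto simp: N_def)
  moreover have "Bad3 \<union> Bad2 \<union> BadG \<subseteq> signs \<Omega>" by (auto simp: Bad3_def Bad2_def BadG_def Gb_def)
  ultimately obtain s where s: "s \<in> signs \<Omega>" "s \<notin> Bad3" "s \<notin> Bad2" "s \<notin> BadG" by blast
  show ?thesis
  proof (rule that[of s])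
    show "(s (a, u))\<^sup>2 = 1" if "a \<in> {..<m\<^sup>2} \<times> {..<m\<^sup>2}" "u \<in> {..<d} \<times> {..<d}" for a u
      using that signs_power2[OF s(1), of "(a, u)"] by (auto simp: \<Omega>_def A_def U_def)
    show "\<bar>\<Sum>u\<in>{..<d} \<times> {..<d}. s (a, u) * s (b, u)\<bar> \<le> (real d)\<^sup>2 / (2 * real m ^ 4)"
      if "a \<in> {..<m\<^sup>2} \<times> {..<m\<^sup>2}" "b \<in> {..<m\<^sup>2} \<times> {..<m\<^sup>2}" "a \<noteq> b" for a b
    proof -
      have "s \<notin> Gb (a, b)" using s(4) that unfolding BadG_def A_def by blast
      then show ?thesis using s(1) by (simp add: Gb_def U_def t_def n_def not_less)
    qed
    fix b x y :: "_ \<Rightarrow> real"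
    show "\<bar>\<Sum>a\<in>{..<m\<^sup>2} \<times> {..<m\<^sup>2}. \<Sum>i<d. \<Sum>j<d. s (a, (i, j)) * (b a * (x i * y j))\<bar>
      \<le> 500 * sqrt (real d) * (L2_set b ({..<m\<^sup>2} \<times> {..<m\<^sup>2}) * (L2_set x {..<d} * L2_set y {..<d}))"
    proof -
      define z where "z j = (if j = 0 then b else if j = 1 then x \<circ> fst else y \<circ> fst)" for j :: nat
      have sum0: "(\<Sum>c\<in>{..<d} \<times> {0 :: nat}. \<phi> c) = (\<Sum>i<d. \<phi> (i, 0))" for \<phi> :: "nat \<times> nat \<Rightarrow> real"
        unfolding sum_Times by simp
      have "\<bar>mlf {0, 1, 2} A3 (\<lambda>f. s (e3 f)) z\<bar>
        \<le> net_bound (card {0, 1, 2 :: nat}) (\<Sum>j\<in>{0, 1, 2}. real (card (A3 j))) * (\<Prod>j\<in>{0, 1, 2}. L2_set (z j) (A3 j))"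
        using s(1,2) unfolding Bad3_def by blast
      also have "mlf {0, 1, 2} A3 (\<lambda>f. s (e3 f)) z = (\<Sum>a\<in>A. \<Sum>i<d. \<Sum>j<d. s (a, (i, j)) * (b a * (x i * y j)))"
        unfolding mlf_three by (simp add: A3_def e3_def z_def sum0)
      also have "(\<Prod>j\<in>{0, 1, 2}. L2_set (z j) (A3 j)) = L2_set b A * (L2_set x {..<d} * L2_set y {..<d})"
        by (simp add: z_def A3_def L2_set_def sum0)
      also have "net_bound (card {0, 1, 2 :: nat}) (\<Sum>j\<in>{0, 1, 2}. real (card (A3 j))) = net_bound 3 (n + 2 * real d)"
        by (simp add: A3_def n card_cartesian_product numeral_3_eq_3)
      also have "net_bound 3 (n + 2 * real d) \<le> 500 * sqrt (real d)"
      proof -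
        \<comment> \<open>The sum of the dimensions is at most 3 d, so the square root is that of at
          most 128 times 28 d, below 3600 d, and 8 times 60 is below 500.\<close>
        have "net_bound 3 (n + 2 * real d) = 8 * sqrt (128 * (8 * (n + 2 * real d) + 4))"
          by (simp add: net_bound_def)
        also have "\<dots> \<le> 8 * sqrt (3600 * real d)"
          using d_ge d1 by (intro mult_left_mono real_sqrt_le_mono) auto
        also have "\<dots> = 8 * (60 * sqrt (real d))"
          by (simp add: real_sqrt_mult real_sqrt_unique[of 60 3600])
        finally show ?thesis using real_sqrt_ge_zero[of "real d"] by linarith
      qed
      finally show ?thesis by (simp add: A_def mult_right_mono)
    qed
    fix x y :: "_ \<Rightarrow> real"
    show "\<bar>\<Sum>p\<in>{..<m\<^sup>2} \<times> {..<d}. \<Sum>q\<in>{..<m\<^sup>2} \<times> {..<d}. s ((fst p, fst q), (snd p, snd q)) * (x p * y q)\<bar>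
      \<le> 500 * (real m * sqrt (real d)) * (L2_set x ({..<m\<^sup>2} \<times> {..<d}) * L2_set y ({..<m\<^sup>2} \<times> {..<d}))"
    proof -
      define z where "z j = (if j = 0 then x else y)" for j :: nat
      have "\<bar>mlf {0, 1} A2 (\<lambda>f. s (e2 f)) z\<bar>
        \<le> net_bound (card {0, 1 :: nat}) (\<Sum>j\<in>{0, 1}. real (card (A2 j))) * (\<Prod>j\<in>{0, 1}. L2_set (z j) (A2 j))"
        using s(1,3) unfolding Bad2_def by blast
      also have "mlf {0, 1} A2 (\<lambda>f. s (e2 f)) z
        = (\<Sum>p\<in>{..<m\<^sup>2} \<times> {..<d}. \<Sum>q\<in>{..<m\<^sup>2} \<times> {..<d}. s ((fst p, fst q), (snd p, snd q)) * (x p * y q))"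
        unfolding mlf_two by (simp add: A2_def e2_def z_def)
      also have "(\<Prod>j\<in>{0, 1}. L2_set (z j) (A2 j)) = L2_set x ({..<m\<^sup>2} \<times> {..<d}) * L2_set y ({..<m\<^sup>2} \<times> {..<d})"
        by (simp add: z_def A2_def)
      also have "net_bound (card {0, 1 :: nat}) (\<Sum>j\<in>{0, 1}. real (card (A2 j))) = net_bound 2 (2 * ((real m)\<^sup>2 * real d))"
        by (simp add: A2_def card_cartesian_product numeral_2_eq_2)
      also have "net_bound 2 (2 * ((real m)\<^sup>2 * real d)) \<le> 500 * (real m * sqrt (real d))"
      proof -
        have "1 * 1 \<le> (real m)\<^sup>2 * real d" using m d1 by (intro mult_mono) (auto simp: one_le_power)
        moreover have "net_bound 2 (2 * ((real m)\<^sup>2 * real d)) = 4 * sqrt (32 * (16 * ((real m)\<^sup>2 * real d) + 4))"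
          by (simp add: net_bound_def)
        ultimately have "net_bound 2 (2 * ((real m)\<^sup>2 * real d)) \<le> 4 * sqrt (900 * ((real m)\<^sup>2 * real d))"
          by (auto intro!: mult_left_mono real_sqrt_le_mono simp: mult.commute)
        also have "\<dots> = 4 * (30 * (real m * sqrt (real d)))"
          by (simp add: real_sqrt_mult real_sqrt_unique[of 30 900])
        also have "\<dots> \<le> 500 * (real m * sqrt (real d))" by simp
        finally show ?thesis .
      qed
      finally show ?thesis by (simp add: mult_right_mono)
    qed
  qed
qed

section \<open>Positive semidefinite matrices\<close>

lemma quadratic_form_two:
  fixes A :: "'i cop" and a b :: complex
  assumes "finite I" "i \<in> I" "j \<in> I" "i \<noteq> j"
  defines "v \<equiv> (\<lambda>x. if x = i then a else if x = j then b else 0)"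
  shows "(\<Sum>x\<in>I. \<Sum>y\<in>I. cnj (v x) * A x y * v y)
    = cnj a * A i i * a + cnj a * A i j * b + cnj b * A j i * a + cnj b * A j j * b"
proof -
  have supp: "(\<Sum>x\<in>I. \<phi> x) = \<phi> i + \<phi> j" if "\<And>x. x \<noteq> i \<Longrightarrow> x \<noteq> j \<Longrightarrow> \<phi> x = 0" for \<phi> :: "'i \<Rightarrow> complex"
  proof -
    have "(\<Sum>x\<in>I. \<phi> x) = (\<Sum>x\<in>{i, j}. \<phi> x)"
      by (rule sum.mono_neutral_right) (use assms that in auto)
    then show ?thesis using assms by simp
  qed
  have inner: "(\<Sum>y\<in>I. cnj (v x) * A x y * v y) = cnj (v x) * A x i * a + cnj (v x) * A x j * b" for x
    by (subst supp) (use assms(4) in \<open>auto simp: v_def\<close>)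
  show ?thesis unfolding inner
    by (subst supp) (use assms(4) in \<open>auto simp: v_def\<close>)
qed

lemma psd_diag:
  assumes "psd I A" "finite I" "i \<in> I"
  shows "A i i \<in> \<real>\<^sub>\<ge>\<^sub>0"
proof -
  have supp: "(\<Sum>x\<in>I. \<phi> x) = \<phi> i" if "\<And>x. x \<noteq> i \<Longrightarrow> \<phi> x = 0" for \<phi> :: "'a \<Rightarrow> complex"
  proof -
    have "(\<Sum>x\<in>I. \<phi> x) = (\<Sum>x\<in>{i}. \<phi> x)"
      by (rule sum.mono_neutral_right) (use assms that in auto)
    then show ?thesis by simp
  qed
  let ?v = "\<lambda>x. if x = i then 1 else 0"
  have "(\<Sum>x\<in>I. \<Sum>y\<in>I. cnj (?v x) * A x y * ?v y) = A i i"
    by (simp add: supp)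
  then show ?thesis using assms(1)[unfolded psd_def, rule_format, of ?v] by simp
qed

text \<open>\<open>psd\<close> only asks for nonnegative values of the form. Symmetry follows by
  polarization, from the vectors e_i + e_j and e_i + \<i> e_j.\<close>

lemma psd_hermitian:
  assumes "psd I A" "finite I" "i \<in> I" "j \<in> I"
  shows "cnj (A i j) = A j i"
proof (cases "i = j")
  case True
  then show ?thesis using psd_diag[OF assms(1-3)] by (auto simp: complex_nonneg_Reals_iff complex_eq_iff)
next
  case False
  have r: "A i i \<in> \<real>\<^sub>\<ge>\<^sub>0" "A j j \<in> \<real>\<^sub>\<ge>\<^sub>0" using psd_diag[OF assms(1,2)] assms(3,4) by auto
  have *: "cnj 1 * A i i * 1 + cnj 1 * A i j * b + cnj b * A j i * 1 + cnj b * A j j * b \<in> \<real>\<^sub>\<ge>\<^sub>0" for b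
    unfolding quadratic_form_two[OF assms(2-4) False, symmetric]
    using assms(1)[unfolded psd_def, rule_format, of "\<lambda>x. if x = i then 1 else if x = j then b else 0"] .
  show ?thesis using *[of 1] *[of \<i>] r
    by (auto simp: complex_nonneg_Reals_iff complex_eq_iff)
qed

lemma psd_zero_row:
  assumes "psd I A" "finite I" "i \<in> I" "j \<in> I" "A i i = 0"
  shows "A i j = 0"
proof (rule ccontr)
  assume nz: "A i j \<noteq> 0"
  then have ij: "i \<noteq> j" using assms(5) by auto
  have h: "A j i = cnj (A i j)" using psd_hermitian[OF assms(1-4)] by simp
  define p where "p = (cmod (A i j))\<^sup>2"
  have p: "p > 0" using nz by (simp add: p_def)
  have AA: "A i j * cnj (A i j) = complex_of_real p" by (simp only: p_def complex_norm_square)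
  \<comment> \<open>Chosen so that the form at the vector -t A_ij e_i + e_j equals -1.\<close>
  define t where "t = (Re (A j j) + 1) / (2 * p)"
  define a where "a = - of_real t * A i j"
  have "cnj a * A i i * a + cnj a * A i j * 1 + cnj 1 * A j i * a + cnj 1 * A j j * 1 \<in> \<real>\<^sub>\<ge>\<^sub>0"
    unfolding quadratic_form_two[OF assms(2-4) ij, symmetric]
    using assms(1)[unfolded psd_def, rule_format, of "\<lambda>x. if x = i then a else if x = j then 1 else 0"] .
  also have "cnj a * A i i * a + cnj a * A i j * 1 + cnj 1 * A j i * a + cnj 1 * A j j * 1
    = A j j - of_real (2 * t) * (A i j * cnj (A i j))"
    by (simp add: a_def h assms(5) algebra_simps)
  finally have "Re (A j j) - 2 * t * p \<ge> 0" unfolding AA by (simp add: complex_nonneg_Reals_iff)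
  then show False using p by (simp add: t_def)
qed

lemma psd_subset:
  assumes "psd I A" "finite I" "K \<subseteq> I"
  shows "psd K A"
  unfolding psd_def
proof
  fix v :: "'a \<Rightarrow> complex"
  define w where "w x = (if x \<in> K then v x else 0)" for x
  have "(\<Sum>i\<in>I. \<Sum>j\<in>I. cnj (w i) * A i j * w j) = (\<Sum>i\<in>K. \<Sum>j\<in>I. cnj (w i) * A i j * w j)"
    by (rule sum.mono_neutral_right) (use assms in \<open>auto simp: w_def\<close>)
  also have "\<dots> = (\<Sum>i\<in>K. \<Sum>j\<in>K. cnj (w i) * A i j * w j)"
    by (intro sum.cong refl sum.mono_neutral_right) (use assms in \<open>auto simp: w_def\<close>)
  also have "\<dots> = (\<Sum>i\<in>K. \<Sum>j\<in>K. cnj (v i) * A i j * v j)"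
    by (intro sum.cong refl) (auto simp: w_def)
  finally show "(\<Sum>i\<in>K. \<Sum>j\<in>K. cnj (v i) * A i j * v j) \<in> \<real>\<^sub>\<ge>\<^sub>0"
    using assms(1)[unfolded psd_def, rule_format, of w] by simp
qed

text \<open>For given \<open>w\<close> the coordinate at \<open>a\<close> is chosen to minimise the
  form; the minimum is the form of the Schur complement.\<close>

lemma psd_schur_complement:
  assumes psd: "psd (insert a I) A" and fin: "finite I" and a: "a \<notin> I" and nz: "A a a \<noteq> 0"
  shows "psd I (\<lambda>i j. A i j - A i a * A a j / A a a)"
  unfolding psd_def
proof
  fix w :: "'a \<Rightarrow> complex"
  have finI: "finite (insert a I)" using fin by simp
  define s where "s = (\<Sum>j\<in>I. A a j * w j)"
  define v where "v x = (if x = a then - s / A a a else w x)" for x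
  have herm: "(\<Sum>i\<in>I. cnj (w i) * A i a) = cnj s"
    unfolding s_def cnj_sum by (intro sum.cong) (auto simp: psd_hermitian[OF psd finI] mult.commute)
  have real: "cnj (A a a) = A a a" by (rule psd_hermitian[OF psd finI]) auto
  have va: "v a = - s / A a a" and vI: "\<And>x. x \<in> I \<Longrightarrow> v x = w x" using a by (auto simp: v_def)
  have "(\<Sum>i\<in>insert a I. \<Sum>j\<in>insert a I. cnj (v i) * A i j * v j)
    = cnj (v a) * A a a * v a + (\<Sum>j\<in>I. cnj (v a) * A a j * v j)
      + ((\<Sum>i\<in>I. cnj (v i) * A i a * v a) + (\<Sum>i\<in>I. \<Sum>j\<in>I. cnj (v i) * A i j * v j))"
    using fin a by (simp add: sum.distrib)
  also have "(\<Sum>j\<in>I. cnj (v a) * A a j * v j) = cnj (v a) * s"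
    unfolding s_def sum_distrib_left by (intro sum.cong) (auto simp: vI)
  also have "(\<Sum>i\<in>I. cnj (v i) * A i a * v a) = cnj s * v a"
    unfolding herm[symmetric] sum_distrib_right by (intro sum.cong) (auto simp: vI)
  also have "(\<Sum>i\<in>I. \<Sum>j\<in>I. cnj (v i) * A i j * v j) = (\<Sum>i\<in>I. \<Sum>j\<in>I. cnj (w i) * A i j * w j)"
    by (intro sum.cong) (auto simp: vI)
  also have "cnj (v a) * A a a * v a + cnj (v a) * s + (cnj s * v a + (\<Sum>i\<in>I. \<Sum>j\<in>I. cnj (w i) * A i j * w j))
    = (\<Sum>i\<in>I. \<Sum>j\<in>I. cnj (w i) * A i j * w j) - cnj s * s / A a a"
    using nz by (simp add: va real field_simps)
  also have "\<dots> = (\<Sum>i\<in>I. \<Sum>j\<in>I. cnj (w i) * (A i j - A i a * A a j / A a a) * w j)"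
  proof -
    have "cnj s * s / A a a = (\<Sum>i\<in>I. \<Sum>j\<in>I. cnj (w i) * (A i a * A a j / A a a) * w j)"
    proof -
      have "cnj s * s = (\<Sum>i\<in>I. cnj (w i) * A i a) * (\<Sum>j\<in>I. A a j * w j)"
        unfolding herm by (simp only: s_def)
      then show ?thesis
        unfolding sum_product by (simp add: sum_divide_distrib mult_ac)
    qed
    then show ?thesis by (simp add: sum_subtractf[symmetric] algebra_simps)
  qed
  finally show "(\<Sum>i\<in>I. \<Sum>j\<in>I. cnj (w i) * (A i j - A i a * A a j / A a a) * w j) \<in> \<real>\<^sub>\<ge>\<^sub>0"
    using psd[unfolded psd_def, rule_format, of v] by simp
qed

text \<open>Cholesky factorization by induction: a vanishing pivot has a vanishing row and column;
  otherwise the pivot column divided by the root of the pivot is split off and the Schur complement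
  remains. Any rank-one decomposition will do later, so eigenvectors are avoided.\<close>

lemma psd_imp_sum_rank_one:
  assumes "finite I" "psd I A"
  shows "\<exists>(n::nat) v. \<forall>i\<in>I. \<forall>j\<in>I. A i j = (\<Sum>l<n. v l i * cnj (v l j))"
  using assms
proof (induction I arbitrary: A rule: finite_induct)
  case empty
  then show ?case by auto
next
  case (insert a I)
  have finI: "finite (insert a I)" using insert.hyps by simp
  have herm: "\<And>j. j \<in> I \<Longrightarrow> A j a = cnj (A a j)"
    using psd_hermitian[OF insert.prems finI] by (metis complex_cnj_cnj insertCI)
  show ?case
  proof (cases "A a a = 0")
    case True
    have zero: "A a j = 0" "A j a = 0" if "j \<in> I" for j
      using psd_zero_row[OF insert.prems finI _ _ True, of j] herm that by auto
    have "psd I A" by (rule psd_subset[OF insert.prems finI]) auto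
    then obtain n v where v: "\<forall>i\<in>I. \<forall>j\<in>I. A i j = (\<Sum>l<n::nat. v l i * cnj (v l j))"
      using insert.IH by blast
    have "\<forall>i\<in>insert a I. \<forall>j\<in>insert a I.
      A i j = (\<Sum>l<n. (if i = a then 0 else v l i) * cnj (if j = a then 0 else v l j))"
    proof (intro ballI)
      fix i j assume "i \<in> insert a I" "j \<in> insert a I"
      then show "A i j = (\<Sum>l<n. (if i = a then 0 else v l i) * cnj (if j = a then 0 else v l j))"
        by (cases "i = a"; cases "j = a") (use v zero True in auto)
    qed
    then show ?thesis by (intro exI[of _ n] exI[of _ "\<lambda>l i. if i = a then 0 else v l i"])
  next
    case False
    define B where "B i j = A i j - A i a * A a j / A a a" for i j
    have "psd I B" unfolding B_def by (rule psd_schur_complement[OF insert.prems insert.hyps False])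
    then obtain n v where v: "\<forall>i\<in>I. \<forall>j\<in>I. B i j = (\<Sum>l<n::nat. v l i * cnj (v l j))"
      using insert.IH by blast
    define r where "r = sqrt (Re (A a a))"
    have "A a a \<in> \<real>\<^sub>\<ge>\<^sub>0" by (rule psd_diag[OF insert.prems finI]) auto
    then have r: "complex_of_real r * complex_of_real r = A a a"
      by (auto simp: r_def complex_nonneg_Reals_iff complex_eq_iff)
    then have r0: "complex_of_real r \<noteq> 0" using False by auto
    define u where "u l i = (if l = n then A i a / of_real r else if i = a then 0 else v l i)" for l i
    have "A i j = (\<Sum>l<Suc n. u l i * cnj (u l j))" if ij: "i \<in> insert a I" "j \<in> insert a I" for i j
    proof -
      have "(\<Sum>l<Suc n. u l i * cnj (u l j))
        = (\<Sum>l<n. (if i = a then 0 else v l i) * cnj (if j = a then 0 else v l j)) + A i a * cnj (A j a) / A a a"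
        by (simp add: u_def r[symmetric])
      also have "cnj (A j a) = A a j" by (rule psd_hermitian[OF insert.prems finI]) (use ij in auto)
      also have "(\<Sum>l<n. (if i = a then 0 else v l i) * cnj (if j = a then 0 else v l j)) = B i j"
        by (cases "i = a"; cases "j = a") (use v ij False in \<open>auto simp: B_def\<close>)
      finally show ?thesis by (simp add: B_def)
    qed
    then show ?thesis by blast
  qed
qed

lemma psd_family_rank_one:
  fixes k :: nat and A :: "nat \<Rightarrow> 'i cop"
  assumes "\<And>j. j < k \<Longrightarrow> finite (I j)" "\<And>j. j < k \<Longrightarrow> psd (I j) (A j)"
  obtains N :: "nat \<Rightarrow> nat" and v where "\<And>j x y. j < k \<Longrightarrow> x \<in> I j \<Longrightarrow> y \<in> I j \<Longrightarrow>
      A j x y = (\<Sum>l<N j. v j l x * cnj (v j l y))"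
proof -
  have "\<forall>j\<in>{..<k}. \<exists>V. \<forall>x\<in>I j. \<forall>y\<in>I j. A j x y = (\<Sum>l<fst V :: nat. snd V l x * cnj (snd V l y))"
  proof
    fix j assume "j \<in> {..<k}"
    then obtain N v where "\<forall>x\<in>I j. \<forall>y\<in>I j. A j x y = (\<Sum>l<N::nat. v l x * cnj (v l y))"
      using psd_imp_sum_rank_one[of "I j" "A j"] assms by auto
    then show "\<exists>V. \<forall>x\<in>I j. \<forall>y\<in>I j. A j x y = (\<Sum>l<fst V :: nat. snd V l x * cnj (snd V l y))"
      by (intro exI[of _ "(N, v)"]) simp
  qed
  from bchoice[OF this] obtain V where V: "\<forall>j\<in>{..<k}. \<forall>x\<in>I j. \<forall>y\<in>I j.
      A j x y = (\<Sum>l<fst (V j) :: nat. snd (V j) l x * cnj (snd (V j) l y))" by blast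
  then show ?thesis using that[of "\<lambda>j. snd (V j)" "\<lambda>j. fst (V j)"] by blast
qed

lemma psd_of_sum_rank_one:
  fixes A :: "'a cop"
  assumes "finite L" "\<And>i j. i \<in> I \<Longrightarrow> j \<in> I \<Longrightarrow> A i j = (\<Sum>l\<in>L. w l i * cnj (w l j))"
  shows "psd I A"
  unfolding psd_def
proof
  fix v :: "'a \<Rightarrow> complex"
  have "(\<Sum>i\<in>I. \<Sum>j\<in>I. cnj (v i) * A i j * v j)
    = (\<Sum>i\<in>I. \<Sum>j\<in>I. \<Sum>l\<in>L. (cnj (v i) * w l i) * (cnj (w l j) * v j))"
    by (intro sum.cong refl) (simp add: assms(2) sum_distrib_left sum_distrib_right mult_ac)
  also have "\<dots> = (\<Sum>l\<in>L. \<Sum>i\<in>I. \<Sum>j\<in>I. (cnj (v i) * w l i) * (cnj (w l j) * v j))"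
    by (rule sum_rotate)
  also have "\<dots> = (\<Sum>l\<in>L. (\<Sum>i\<in>I. cnj (v i) * w l i) * (\<Sum>j\<in>I. cnj (w l j) * v j))"
    by (simp only: sum_product)
  also have "\<dots> = (\<Sum>l\<in>L. complex_of_real ((cmod (\<Sum>i\<in>I. cnj (v i) * w l i))\<^sup>2))"
  proof (rule sum.cong[OF refl])
    fix l
    have "(\<Sum>j\<in>I. cnj (w l j) * v j) = cnj (\<Sum>i\<in>I. cnj (v i) * w l i)"
      by (simp add: cnj_sum mult.commute)
    then show "(\<Sum>i\<in>I. cnj (v i) * w l i) * (\<Sum>j\<in>I. cnj (w l j) * v j)
      = complex_of_real ((cmod (\<Sum>i\<in>I. cnj (v i) * w l i))\<^sup>2)"
      by (simp only: complex_norm_square)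
  qed
  also have "\<dots> \<in> \<real>\<^sub>\<ge>\<^sub>0"
    by (simp only: of_real_sum[symmetric] nonneg_Reals_of_real_iff) (intro sum_nonneg, simp)
  finally show "(\<Sum>i\<in>I. \<Sum>j\<in>I. cnj (v i) * A i j * v j) \<in> \<real>\<^sub>\<ge>\<^sub>0" .
qed

lemma sum_nonneg_Reals:
  fixes f :: "'a \<Rightarrow> complex"
  shows "(\<And>x. x \<in> A \<Longrightarrow> f x \<in> \<real>\<^sub>\<ge>\<^sub>0) \<Longrightarrow> sum f A \<in> \<real>\<^sub>\<ge>\<^sub>0"
  by (induction A rule: infinite_finite_induct) auto

lemma op_trace_mult: "op_trace I (op_mult I A B) = (\<Sum>i\<in>I. \<Sum>j\<in>I. A i j * B j i)"
  by (simp add: op_trace_def op_mult_def)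

text \<open>Decomposing \<open>A\<close> into rank-one terms makes the trace a sum of values of the
  form of \<open>B\<close>.\<close>

lemma psd_trace_mult_nonneg:
  assumes "finite I" "psd I A" "psd I B"
  shows "op_trace I (op_mult I A B) \<in> \<real>\<^sub>\<ge>\<^sub>0"
proof -
  obtain n v where v: "\<forall>i\<in>I. \<forall>j\<in>I. A i j = (\<Sum>l<n::nat. v l i * cnj (v l j))"
    using psd_imp_sum_rank_one[OF assms(1,2)] by blast
  have "op_trace I (op_mult I A B) = (\<Sum>i\<in>I. \<Sum>j\<in>I. \<Sum>l<n. cnj (v l j) * B j i * v l i)"
    unfolding op_trace_mult
  proof (intro sum.cong refl)
    fix i j assume ij: "i \<in> I" "j \<in> I"
    have "A i j * B j i = (\<Sum>l<n. v l i * cnj (v l j)) * B j i" using v ij by simp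
    then show "A i j * B j i = (\<Sum>l<n. cnj (v l j) * B j i * v l i)"
      unfolding sum_distrib_right by (simp add: mult_ac)
  qed
  also have "\<dots> = (\<Sum>l<n. \<Sum>i\<in>I. \<Sum>j\<in>I. cnj (v l j) * B j i * v l i)"
    by (rule sum_rotate)
  also have "\<dots> = (\<Sum>l<n. \<Sum>j\<in>I. \<Sum>i\<in>I. cnj (v l j) * B j i * v l i)"
    by (intro sum.cong refl sum.swap)
  also have "\<dots> \<in> \<real>\<^sub>\<ge>\<^sub>0"
  proof (rule sum_nonneg_Reals)
    show "(\<Sum>j\<in>I. \<Sum>i\<in>I. cnj (v l j) * B j i * v l i) \<in> \<real>\<^sub>\<ge>\<^sub>0" for l
      using assms(3) unfolding psd_def by blast
  qed
  finally show ?thesis .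
qed

lemma sum_prod_rank_one:
  fixes x y :: "nat \<Rightarrow> nat \<Rightarrow> complex"
  shows "(\<Prod>j<k. \<Sum>l<n j. x j l * cnj (y j l))
    = (\<Sum>L\<in>(\<Pi>\<^sub>E j\<in>{..<k}. {..<n j}). (\<Prod>j<k. x j (L j)) * cnj (\<Prod>j<k. y j (L j)))"
  by (subst prod_sum_PiE) (auto simp: prod.distrib cnj_prod)

text \<open>Tensor products of the rank-one decompositions of the factors; the regrouping merely
  renames the coordinates of the vectors.\<close>

lemma psd_tensor_regroup:
  fixes E :: "nat \<Rightarrow> (nat \<times> nat) cop"
  assumes psd: "\<And>j. j < k \<Longrightarrow> psd ({..<n j} \<times> {..<d j}) (E j)"
  shows "psd (multi k n \<times> multi k d) (tensor_regroup k E)"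
proof -
  obtain N :: "nat \<Rightarrow> nat" and v where v: "\<And>j x y. j < k \<Longrightarrow> x \<in> {..<n j} \<times> {..<d j} \<Longrightarrow> y \<in> {..<n j} \<times> {..<d j} \<Longrightarrow>
      E j x y = (\<Sum>l<N j. v j l x * cnj (v j l y))"
    by (rule psd_family_rank_one[OF _ psd]) auto
  show ?thesis
  proof (rule psd_of_sum_rank_one)
    show "finite (\<Pi>\<^sub>E j\<in>{..<k}. {..<N j})" by (intro finite_PiE) auto
    fix x y assume xy: "x \<in> multi k n \<times> multi k d" "y \<in> multi k n \<times> multi k d"
    obtain f f' g g' where fg: "x = (f, f')" "y = (g, g')" by (cases x, cases y)
    have "tensor_regroup k E x y = (\<Prod>j<k. \<Sum>l<N j. v j l (f j, f' j) * cnj (v j l (g j, g' j)))"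
      unfolding fg tensor_regroup_def tensor_def prod.case
      by (intro prod.cong refl v) (use xy in \<open>auto simp: fg multi_def\<close>)
    also have "\<dots> = (\<Sum>L\<in>(\<Pi>\<^sub>E j\<in>{..<k}. {..<N j}). (\<Prod>j<k. v j (L j) (f j, f' j)) * cnj (\<Prod>j<k. v j (L j) (g j, g' j)))"
      by (rule sum_prod_rank_one)
    finally show "tensor_regroup k E x y
      = (\<Sum>L\<in>(\<Pi>\<^sub>E j\<in>{..<k}. {..<N j}). (\<Prod>j<k. v j (L j) (fst x j, snd x j)) * cnj (\<Prod>j<k. v j (L j) (fst y j, snd y j)))"
      by (simp add: fg)
  qed
qed

lemma psd_tensor2:
  assumes "finite I" "finite K" "psd I A" "psd K B"
  shows "psd (I \<times> K) (tensor2 A B)"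
proof -
  obtain n v where v: "\<forall>i\<in>I. \<forall>j\<in>I. A i j = (\<Sum>l<n::nat. v l i * cnj (v l j))"
    using psd_imp_sum_rank_one[OF assms(1,3)] by blast
  obtain N u where u: "\<forall>i\<in>K. \<forall>j\<in>K. B i j = (\<Sum>l<N::nat. u l i * cnj (u l j))"
    using psd_imp_sum_rank_one[OF assms(2,4)] by blast
  show ?thesis
  proof (rule psd_of_sum_rank_one)
    show "finite ({..<n} \<times> {..<N})" by simp
    fix x y assume xy: "x \<in> I \<times> K" "y \<in> I \<times> K"
    have "tensor2 A B x y = A (fst x) (fst y) * B (snd x) (snd y)"
      by (simp add: tensor2_def case_prod_unfold)
    also have "\<dots> = (\<Sum>l<n. v l (fst x) * cnj (v l (fst y))) * (\<Sum>l<N. u l (snd x) * cnj (u l (snd y)))"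
      using v u xy by (simp add: mem_Times_iff)
    also have "\<dots> = (\<Sum>l\<in>{..<n} \<times> {..<N}.
        (v (fst l) (fst x) * u (snd l) (snd x)) * cnj (v (fst l) (fst y) * u (snd l) (snd y)))"
      unfolding sum_product sum.cartesian_product by (intro sum.cong refl) (auto simp: mult_ac)
    finally show "tensor2 A B x y = (\<Sum>l\<in>{..<n} \<times> {..<N}.
        (v (fst l) (fst x) * u (snd l) (snd x)) * cnj (v (fst l) (fst y) * u (snd l) (snd y)))" .
  qed
qed

section \<open>Biases of quantum XOR games\<close>

lemma finite_multi: "finite (multi k n)"
  unfolding multi_def by (rule finite_PiE) auto

lemma sum_prod_answers:
  fixes \<phi> :: "nat \<Rightarrow> int \<Rightarrow> 'c :: comm_semiring_1"
  shows "(\<Sum>a\<in>answers k. \<Prod>j<k. \<phi> j (a j)) = (\<Prod>j<k. \<Sum>b\<in>{-1, 1}. \<phi> j b)"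
  unfolding answers_def by (rule prod_sum_PiE[symmetric]) auto

text \<open>The bias is linear in the questions, so it sees the game only through
  \<open>game_operator\<close>. This is the identification of games with operators.\<close>

lemma bias_eq:
  assumes P: "\<And>\<rho> a. P \<rho> a = Re (\<Sum>f\<in>M. \<Sum>g\<in>M. E a f g * \<rho> g f)"
  shows "bias k G P = Re (\<Sum>f\<in>M. \<Sum>g\<in>M.
    (\<Sum>a\<in>answers k. of_int (\<Prod>j<k. a j) * E a f g) * game_operator G g f)"
proof -
  let ?c = "\<lambda>x. of_int (sign G x) * of_real (prob G x) :: complex"
  let ?\<pi> = "\<lambda>a. of_int (\<Prod>j<k. a j) :: complex"
  let ?X = "{..<num_questions G}"
  have step: "prob G x * of_int (sign G x) * (\<Sum>a\<in>answers k. of_int (\<Prod>j<k. a j) * P (question G x) a)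
    = Re (\<Sum>a\<in>answers k. \<Sum>z\<in>M \<times> M. (?\<pi> a * E a (fst z) (snd z)) * (?c x * question G x (snd z) (fst z)))" for x
  proof -
    have "prob G x * of_int (sign G x) * (\<Sum>a\<in>answers k. of_int (\<Prod>j<k. a j) *
        (\<Sum>f\<in>M. Re (\<Sum>g\<in>M. E a f g * question G x g f)))
      = (\<Sum>a\<in>answers k. \<Sum>f\<in>M. \<Sum>g\<in>M.
        (prob G x * of_int (sign G x) * of_int (\<Prod>j<k. a j)) * Re (E a f g * question G x g f))"
      by (simp only: Re_sum sum_distrib_left mult.assoc)
    also have "\<dots> = (\<Sum>a\<in>answers k. \<Sum>f\<in>M. \<Sum>g\<in>M.
        Re ((?\<pi> a * E a f g) * (?c x * question G x g f)))"
    proof (intro sum.cong refl)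
      fix a f g
      have "(?\<pi> a * E a f g) * (?c x * question G x g f)
        = of_real (prob G x * of_int (sign G x) * of_int (\<Prod>j<k. a j)) * (E a f g * question G x g f)"
        by (simp add: mult_ac del: of_int_prod)
      then show "(prob G x * of_int (sign G x) * of_int (\<Prod>j<k. a j)) * Re (E a f g * question G x g f)
        = Re ((?\<pi> a * E a f g) * (?c x * question G x g f))"
        by (simp only: Re_complex_of_real times_complex.sel Im_complex_of_real)
    qed
    finally show ?thesis by (simp only: P sum_Times Re_sum fst_conv snd_conv)
  qed
  have "bias k G P = Re (\<Sum>x\<in>?X. \<Sum>a\<in>answers k. \<Sum>z\<in>M \<times> M.
      (?\<pi> a * E a (fst z) (snd z)) * (?c x * question G x (snd z) (fst z)))"
    unfolding bias_def step by (simp only: Re_sum)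
  also have "(\<Sum>x\<in>?X. \<Sum>a\<in>answers k. \<Sum>z\<in>M \<times> M.
      (?\<pi> a * E a (fst z) (snd z)) * (?c x * question G x (snd z) (fst z)))
    = (\<Sum>x\<in>?X. \<Sum>z\<in>M \<times> M. \<Sum>a\<in>answers k.
      (?\<pi> a * E a (fst z) (snd z)) * (?c x * question G x (snd z) (fst z)))"
    by (intro sum.cong refl sum.swap)
  also have "\<dots> = (\<Sum>z\<in>M \<times> M. \<Sum>x\<in>?X. \<Sum>a\<in>answers k.
      (?\<pi> a * E a (fst z) (snd z)) * (?c x * question G x (snd z) (fst z)))"
    by (rule sum.swap)
  also have "\<dots> = (\<Sum>z\<in>M \<times> M. \<Sum>a\<in>answers k. \<Sum>x\<in>?X.
      (?\<pi> a * E a (fst z) (snd z)) * (?c x * question G x (snd z) (fst z)))"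
    by (intro sum.cong refl sum.swap)
  also have "\<dots> = (\<Sum>z\<in>M \<times> M. (\<Sum>a\<in>answers k. ?\<pi> a * E a (fst z) (snd z)) * game_operator G (snd z) (fst z))"
    by (simp only: sum_product game_operator_def)
  finally show ?thesis by (simp only: sum_Times fst_conv snd_conv)
qed

text \<open>Needed because a real supremum dominates the members of a set only if the set is bounded
  above.\<close>

lemma bias_le_1:
  assumes G: "quantum_xor_game k n G"
    and P: "\<And>\<rho> a. qstate (multi k n) \<rho> \<Longrightarrow> a \<in> answers k \<Longrightarrow> P \<rho> a \<ge> 0"
      "\<And>\<rho>. qstate (multi k n) \<rho> \<Longrightarrow> (\<Sum>a\<in>answers k. P \<rho> a) = 1"
  shows "bias k G P \<le> 1"
proof -
  have "bias k G P \<le> (\<Sum>x<num_questions G. prob G x)"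
    unfolding bias_def
  proof (rule sum_mono)
    fix x assume "x \<in> {..<num_questions G}"
    then have q: "qstate (multi k n) (question G x)" and c: "sign G x \<in> {-1, 1}" and p: "prob G x \<ge> 0"
      using G unfolding quantum_xor_game_def by auto
    have "\<bar>\<Sum>a\<in>answers k. of_int (\<Prod>j<k. a j) * P (question G x) a\<bar>
      \<le> (\<Sum>a\<in>answers k. \<bar>of_int (\<Prod>j<k. a j) * P (question G x) a\<bar>)" by (rule sum_abs)
    also have "\<dots> = (\<Sum>a\<in>answers k. P (question G x) a)"
    proof (rule sum.cong[OF refl])
      fix a assume a: "a \<in> answers k"
      have "\<bar>real_of_int (\<Prod>j<k. a j)\<bar> = (\<Prod>j<k. \<bar>real_of_int (a j)\<bar>)"
        by (simp add: abs_prod)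
      also have "\<dots> = (\<Prod>j<k. 1)"
        by (intro prod.cong refl) (use a in \<open>auto simp: answers_def dest!: PiE_mem\<close>)
      finally have "\<bar>real_of_int (\<Prod>j<k. a j)\<bar> = 1" by simp
      then show "\<bar>of_int (\<Prod>j<k. a j) * P (question G x) a\<bar> = P (question G x) a"
        using P(1)[OF q a] by (simp only: abs_mult)
    qed
    also have "\<dots> = 1" by (rule P(2)[OF q])
    finally have "\<bar>of_int (sign G x) * (\<Sum>a\<in>answers k. of_int (\<Prod>j<k. a j) * P (question G x) a)\<bar> \<le> 1"
      using c by (auto simp: abs_mult)
    then have "of_int (sign G x) * (\<Sum>a\<in>answers k. of_int (\<Prod>j<k. a j) * P (question G x) a) \<le> 1"
      by linarith
    then show "prob G x * of_int (sign G x) * (\<Sum>a\<in>answers k. of_int (\<Prod>j<k. a j) * P (question G x) a) \<le> prob G x"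
      using mult_left_mono[OF _ p] by (fastforce simp: mult.assoc)
  qed
  then show ?thesis using G by (simp add: quantum_xor_game_def)
qed

text \<open>Weighting the answers by their product turns the POVMs into the tensor product of the
  observables \<open>E j 1 - E j (-1)\<close>.\<close>

lemma entangled_bias_ge:
  assumes G: "quantum_xor_game k n G" and rho: "qstate (multi k d) \<rho>'"
    and E: "\<And>j. j < k \<Longrightarrow> povm ({..<n j} \<times> {..<d j}) (E j)"
  shows "Re (\<Sum>f\<in>multi k n. \<Sum>g\<in>multi k n. (\<Sum>f'\<in>multi k d. \<Sum>g'\<in>multi k d.
      (\<Prod>j<k. E j 1 (f j, f' j) (g j, g' j) - E j (-1) (f j, f' j) (g j, g' j)) * \<rho>' g' f') * game_operator G g f)
    \<le> entangled_bias k n G"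
proof -
  define strat where "strat d \<rho>' E = (\<lambda>\<rho> a. let I = multi k n \<times> multi k d in
      Re (op_trace I (op_mult I (tensor_regroup k (\<lambda>j. E j (a j))) (tensor2 \<rho> \<rho>'))))"
    for d \<rho>' and E :: "nat \<Rightarrow> int \<Rightarrow> (nat \<times> nat) cop"
  have bound: "bias k G (strat d \<rho>' E) \<le> 1"
    if rho: "qstate (multi k d) \<rho>'" and E: "\<forall>j<k. povm ({..<n j} \<times> {..<d j}) (E j)" for d \<rho>' E
  proof (rule bias_le_1[OF G])
    let ?I = "multi k n \<times> multi k d"
    have finI: "finite ?I" using finite_multi by auto
    fix \<rho> assume q: "qstate (multi k n) \<rho>"
    show "strat d \<rho>' E \<rho> a \<ge> 0" if a: "a \<in> answers k" for a
    proof -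
      have "psd ({..<n j} \<times> {..<d j}) (E j (a j))" if "j < k" for j
      proof -
        have "a j \<in> {-1, 1}" using a that by (auto simp: answers_def dest!: PiE_mem)
        then show ?thesis using E that unfolding povm_def by blast
      qed
      then have "psd ?I (tensor_regroup k (\<lambda>j. E j (a j)))" by (rule psd_tensor_regroup)
      moreover have "psd ?I (tensor2 \<rho> \<rho>')"
        using q rho finite_multi by (intro psd_tensor2) (auto simp: qstate_def)
      ultimately have "op_trace ?I (op_mult ?I (tensor_regroup k (\<lambda>j. E j (a j))) (tensor2 \<rho> \<rho>')) \<in> \<real>\<^sub>\<ge>\<^sub>0"
        by (rule psd_trace_mult_nonneg[OF finI])
      then show ?thesis by (simp add: strat_def complex_nonneg_Reals_iff Let_def)
    qed
    have id: "(\<Sum>a\<in>answers k. tensor_regroup k (\<lambda>j. E j (a j)) x y) = op_id x y"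
      if x: "x \<in> ?I" and y: "y \<in> ?I" for x y
    proof -
      obtain f f' g g' where fg: "x = (f, f')" "y = (g, g')" by (cases x, cases y)
      have mem: "(f j, f' j) \<in> {..<n j} \<times> {..<d j}" "(g j, g' j) \<in> {..<n j} \<times> {..<d j}" if "j < k" for j
        using x y that unfolding fg multi_def by (auto dest: PiE_mem)
      have "(\<Sum>a\<in>answers k. tensor_regroup k (\<lambda>j. E j (a j)) x y)
        = (\<Prod>j<k. \<Sum>b\<in>{-1, 1}. E j b (f j, f' j) (g j, g' j))"
        unfolding fg tensor_regroup_def tensor_def prod.case
        by (rule sum_prod_answers[where \<phi> = "\<lambda>j b. E j b (f j, f' j) (g j, g' j)"])
      also have "\<dots> = (\<Prod>j<k. op_id (f j, f' j) (g j, g' j))"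
        using E mem unfolding povm_def op_eq_on_def by (intro prod.cong refl) auto
      also have "\<dots> = op_id x y"
      proof (cases "x = y")
        case True
        then show ?thesis by (simp add: fg op_id_def)
      next
        case False
        then have "\<exists>j<k. (f j, f' j) \<noteq> (g j, g' j)"
          using x y unfolding fg multi_def by (auto simp: PiE_iff extensional_def fun_eq_iff) (metis lessThan_iff)+
        then show ?thesis using False by (auto simp: op_id_def)
      qed
      finally show ?thesis .
    qed
    have "(\<Sum>a\<in>answers k. strat d \<rho>' E \<rho> a)
      = Re (\<Sum>a\<in>answers k. \<Sum>x\<in>?I. \<Sum>y\<in>?I. tensor_regroup k (\<lambda>j. E j (a j)) x y * tensor2 \<rho> \<rho>' y x)"
      by (simp add: strat_def op_trace_mult Let_def)
    also have "(\<Sum>a\<in>answers k. \<Sum>x\<in>?I. \<Sum>y\<in>?I. tensor_regroup k (\<lambda>j. E j (a j)) x y * tensor2 \<rho> \<rho>' y x)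
      = (\<Sum>x\<in>?I. \<Sum>a\<in>answers k. \<Sum>y\<in>?I. tensor_regroup k (\<lambda>j. E j (a j)) x y * tensor2 \<rho> \<rho>' y x)"
      by (rule sum.swap)
    also have "\<dots> = (\<Sum>x\<in>?I. \<Sum>y\<in>?I. \<Sum>a\<in>answers k. tensor_regroup k (\<lambda>j. E j (a j)) x y * tensor2 \<rho> \<rho>' y x)"
      by (intro sum.cong refl sum.swap)
    also have "\<dots> = (\<Sum>x\<in>?I. \<Sum>y\<in>?I. op_id x y * tensor2 \<rho> \<rho>' y x)"
      unfolding sum_distrib_right[symmetric] by (intro sum.cong refl) (simp add: id)
    also have "\<dots> = (\<Sum>x\<in>?I. \<Sum>y\<in>?I. if y = x then tensor2 \<rho> \<rho>' x x else 0)"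
      by (intro sum.cong refl) (auto simp: op_id_def)
    also have "\<dots> = (\<Sum>x\<in>?I. tensor2 \<rho> \<rho>' x x)" using finI by (simp add: sum.delta)
    also have "\<dots> = op_trace (multi k n) \<rho> * op_trace (multi k d) \<rho>'"
      by (simp add: sum_Times tensor2_def op_trace_def sum_product)
    also have "\<dots> = 1" using q rho by (simp add: qstate_def)
    finally show "(\<Sum>a\<in>answers k. strat d \<rho>' E \<rho> a) = 1" by simp
  qed
  have "bdd_above (bias k G ` entangled_strategies k n)"
    unfolding entangled_strategies_def strat_def[symmetric]
    by (rule bdd_aboveI2[of _ _ 1]) (use bound in blast)
  moreover have "strat d \<rho>' E \<in> entangled_strategies k n"
    unfolding entangled_strategies_def strat_def[symmetric] using rho E by blast
  ultimately have "bias k G (strat d \<rho>' E) \<le> entangled_bias k n G"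
    unfolding entangled_bias_def by (intro cSUP_upper)
  moreover have "bias k G (strat d \<rho>' E) = Re (\<Sum>f\<in>multi k n. \<Sum>g\<in>multi k n. (\<Sum>f'\<in>multi k d. \<Sum>g'\<in>multi k d.
      (\<Prod>j<k. E j 1 (f j, f' j) (g j, g' j) - E j (-1) (f j, f' j) (g j, g' j)) * \<rho>' g' f') * game_operator G g f)"
  proof -
    define R where "R a f g = (\<Sum>f'\<in>multi k d. \<Sum>g'\<in>multi k d.
        (\<Prod>j<k. E j (a j) (f j, f' j) (g j, g' j)) * \<rho>' g' f')" for a f g
    have "strat d \<rho>' E \<rho> a = Re (\<Sum>f\<in>multi k n. \<Sum>g\<in>multi k n. R a f g * \<rho> g f)" for \<rho> a
    proof -
      have "op_trace (multi k n \<times> multi k d) (op_mult (multi k n \<times> multi k d) (tensor_regroup k (\<lambda>j. E j (a j))) (tensor2 \<rho> \<rho>'))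
        = (\<Sum>f\<in>multi k n. \<Sum>f'\<in>multi k d. \<Sum>g\<in>multi k n. \<Sum>g'\<in>multi k d.
          (\<Prod>j<k. E j (a j) (f j, f' j) (g j, g' j)) * (\<rho> g f * \<rho>' g' f'))"
        by (simp add: op_trace_mult sum_Times tensor_regroup_def tensor_def tensor2_def)
      also have "\<dots> = (\<Sum>f\<in>multi k n. \<Sum>g\<in>multi k n. \<Sum>f'\<in>multi k d. \<Sum>g'\<in>multi k d.
          (\<Prod>j<k. E j (a j) (f j, f' j) (g j, g' j)) * (\<rho> g f * \<rho>' g' f'))"
        by (intro sum.cong refl sum.swap)
      also have "\<dots> = (\<Sum>f\<in>multi k n. \<Sum>g\<in>multi k n. R a f g * \<rho> g f)"
        unfolding R_def sum_distrib_right by (intro sum.cong refl) (simp add: mult_ac)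
      finally show ?thesis by (simp add: strat_def Let_def)
    qed
    then have "bias k G (strat d \<rho>' E) = Re (\<Sum>f\<in>multi k n. \<Sum>g\<in>multi k n.
        (\<Sum>a\<in>answers k. of_int (\<Prod>j<k. a j) * R a f g) * game_operator G g f)"
      by (rule bias_eq)
    moreover have "(\<Sum>a\<in>answers k. of_int (\<Prod>j<k. a j) * R a f g) = (\<Sum>f'\<in>multi k d. \<Sum>g'\<in>multi k d.
        (\<Prod>j<k. E j 1 (f j, f' j) (g j, g' j) - E j (-1) (f j, f' j) (g j, g' j)) * \<rho>' g' f')" for f g
    proof -
      have prod: "(\<Sum>a\<in>answers k. of_int (\<Prod>j<k. a j) * (\<Prod>j<k. E j (a j) (f j, f' j) (g j, g' j)))
        = (\<Prod>j<k. E j 1 (f j, f' j) (g j, g' j) - E j (-1) (f j, f' j) (g j, g' j))" for f' g'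
      proof -
        have "(\<Sum>a\<in>answers k. of_int (\<Prod>j<k. a j) * (\<Prod>j<k. E j (a j) (f j, f' j) (g j, g' j)))
          = (\<Sum>a\<in>answers k. \<Prod>j<k. of_int (a j) * E j (a j) (f j, f' j) (g j, g' j))"
          by (simp add: prod.distrib)
        also have "\<dots> = (\<Prod>j<k. \<Sum>b\<in>{-1, 1}. of_int b * E j b (f j, f' j) (g j, g' j))"
          by (rule sum_prod_answers[where \<phi> = "\<lambda>j b. of_int b * E j b (f j, f' j) (g j, g' j)"])
        finally show ?thesis by simp
      qed
      have "(\<Sum>a\<in>answers k. of_int (\<Prod>j<k. a j) * R a f g)
        = (\<Sum>a\<in>answers k. \<Sum>z\<in>multi k d \<times> multi k d. of_int (\<Prod>j<k. a j)
            * (\<Prod>j<k. E j (a j) (f j, fst z j) (g j, snd z j)) * \<rho>' (snd z) (fst z))"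
        unfolding R_def sum_Times sum_distrib_left by (simp add: mult_ac)
      also have "\<dots> = (\<Sum>z\<in>multi k d \<times> multi k d. \<Sum>a\<in>answers k. of_int (\<Prod>j<k. a j)
            * (\<Prod>j<k. E j (a j) (f j, fst z j) (g j, snd z j)) * \<rho>' (snd z) (fst z))"
        by (rule sum.swap)
      also have "\<dots> = (\<Sum>z\<in>multi k d \<times> multi k d.
          (\<Prod>j<k. E j 1 (f j, fst z j) (g j, snd z j) - E j (-1) (f j, fst z j) (g j, snd z j)) * \<rho>' (snd z) (fst z))"
        unfolding sum_distrib_right[symmetric] by (simp only: prod)
      finally show ?thesis by (simp only: sum_Times fst_conv snd_conv)
    qed
    ultimately show ?thesis by (simp only:)
  qed
  ultimately show ?thesis by (simp only:)
qed

text \<open>Rank-one decompositions of the Q_j turn the trace into a sum over product vectors, where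
  \<open>K\<close> is controlled; the products of squared norms add up to the product of the
  traces.\<close>

lemma tensor_trace_bound:
  fixes Q :: "nat \<Rightarrow> nat cop"
  assumes psd: "\<And>j. j < k \<Longrightarrow> psd {..<n j} (Q j)" and \<Lambda>: "\<Lambda> \<ge> 0"
    and K: "\<And>x :: nat \<Rightarrow> nat \<Rightarrow> complex. cmod (\<Sum>f\<in>multi k n. \<Sum>g\<in>multi k n. cnj (\<Prod>j<k. x j (f j)) * K f g * (\<Prod>j<k. x j (g j)))
      \<le> \<Lambda> * (\<Prod>j<k. \<Sum>i<n j. (cmod (x j i))\<^sup>2)"
  shows "cmod (\<Sum>f\<in>multi k n. \<Sum>g\<in>multi k n. tensor k Q f g * K g f) \<le> \<Lambda> * (\<Prod>j<k. \<Sum>i<n j. Re (Q j i i))"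
proof -
  obtain N :: "nat \<Rightarrow> nat" and v where v: "\<And>j x y. j < k \<Longrightarrow> x \<in> {..<n j} \<Longrightarrow> y \<in> {..<n j} \<Longrightarrow>
      Q j x y = (\<Sum>l<N j. v j l x * cnj (v j l y))"
    by (rule psd_family_rank_one[OF _ psd]) auto
  let ?L = "\<Pi>\<^sub>E j\<in>{..<k}. {..<N j}"
  have tens: "tensor k Q f g = (\<Sum>L\<in>?L. (\<Prod>j<k. v j (L j) (f j)) * cnj (\<Prod>j<k. v j (L j) (g j)))"
    if "f \<in> multi k n" "g \<in> multi k n" for f g
  proof -
    have "tensor k Q f g = (\<Prod>j<k. \<Sum>l<N j. v j l (f j) * cnj (v j l (g j)))"
      unfolding tensor_def by (intro prod.cong refl v) (use that in \<open>auto simp: multi_def\<close>)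
    then show ?thesis by (simp only: sum_prod_rank_one)
  qed
  have "(\<Sum>f\<in>multi k n. \<Sum>g\<in>multi k n. tensor k Q f g * K g f)
    = (\<Sum>g\<in>multi k n. \<Sum>f\<in>multi k n. tensor k Q f g * K g f)" by (rule sum.swap)
  also have "\<dots> = (\<Sum>g\<in>multi k n. \<Sum>f\<in>multi k n. \<Sum>L\<in>?L.
      cnj (\<Prod>j<k. v j (L j) (g j)) * K g f * (\<Prod>j<k. v j (L j) (f j)))"
  proof (intro sum.cong refl)
    fix f g assume fg: "g \<in> multi k n" "f \<in> multi k n"
    show "tensor k Q f g * K g f = (\<Sum>L\<in>?L. cnj (\<Prod>j<k. v j (L j) (g j)) * K g f * (\<Prod>j<k. v j (L j) (f j)))"
      unfolding tens[OF fg(2,1)] sum_distrib_right by (intro sum.cong refl) (simp only: mult_ac)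
  qed
  also have "\<dots> = (\<Sum>L\<in>?L. \<Sum>g\<in>multi k n. \<Sum>f\<in>multi k n.
      cnj (\<Prod>j<k. v j (L j) (g j)) * K g f * (\<Prod>j<k. v j (L j) (f j)))"
    by (rule sum_rotate)
  finally have "cmod (\<Sum>f\<in>multi k n. \<Sum>g\<in>multi k n. tensor k Q f g * K g f)
    = cmod (\<Sum>L\<in>?L. \<Sum>g\<in>multi k n. \<Sum>f\<in>multi k n.
      cnj (\<Prod>j<k. v j (L j) (g j)) * K g f * (\<Prod>j<k. v j (L j) (f j)))" by (rule arg_cong)
  also have "\<dots> \<le> (\<Sum>L\<in>?L. \<Lambda> * (\<Prod>j<k. \<Sum>i<n j. (cmod (v j (L j) i))\<^sup>2))"
    by (rule sum_norm_le) (rule K)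
  also have "\<dots> = \<Lambda> * (\<Prod>j<k. \<Sum>l<N j. \<Sum>i<n j. (cmod (v j l i))\<^sup>2)"
  proof -
    have "(\<Prod>j<k. \<Sum>l<N j. \<Sum>i<n j. (cmod (v j l i))\<^sup>2) = (\<Sum>L\<in>?L. \<Prod>j<k. \<Sum>i<n j. (cmod (v j (L j) i))\<^sup>2)"
      by (rule prod_sum_PiE[where f = "\<lambda>j l. \<Sum>i<n j. (cmod (v j l i))\<^sup>2"]) auto
    then show ?thesis by (simp only: sum_distrib_left)
  qed
  also have "(\<Prod>j<k. \<Sum>l<N j. \<Sum>i<n j. (cmod (v j l i))\<^sup>2) = (\<Prod>j<k. \<Sum>i<n j. Re (Q j i i))"
  proof (rule prod.cong[OF refl])
    fix j assume j: "j \<in> {..<k}"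
    have "(\<Sum>l<N j. \<Sum>i<n j. (cmod (v j l i))\<^sup>2) = (\<Sum>i<n j. \<Sum>l<N j. (cmod (v j l i))\<^sup>2)" by (rule sum.swap)
    also have "\<dots> = (\<Sum>i<n j. Re (Q j i i))"
    proof (rule sum.cong[OF refl])
      fix i assume "i \<in> {..<n j}"
      then have "Q j i i = (\<Sum>l<N j. complex_of_real ((cmod (v j l i))\<^sup>2))"
        using v j by (simp only: complex_norm_square lessThan_iff)
      then show "(\<Sum>l<N j. (cmod (v j l i))\<^sup>2) = Re (Q j i i)"
        by (simp only: Re_sum Re_complex_of_real)
    qed
    finally show "(\<Sum>l<N j. \<Sum>i<n j. (cmod (v j l i))\<^sup>2) = (\<Sum>i<n j. Re (Q j i i))" .
  qed
  finally show ?thesis .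
qed

text \<open>Triangle inequality over all product terms of the strategy. Their traces add up to the
  trace of the identity, the total dimension.\<close>

lemma separable_bias_le:
  assumes \<Lambda>: "\<Lambda> \<ge> 0"
    and K: "\<And>x :: nat \<Rightarrow> nat \<Rightarrow> complex. cmod (\<Sum>f\<in>multi k n. \<Sum>g\<in>multi k n.
        cnj (\<Prod>j<k. x j (f j)) * game_operator G f g * (\<Prod>j<k. x j (g j)))
      \<le> \<Lambda> * (\<Prod>j<k. \<Sum>i<n j. (cmod (x j i))\<^sup>2)"
  shows "separable_bias k n G \<le> \<Lambda> * (\<Prod>j<k. real (n j))"
proof -
  let ?M = "multi k n"
  define strat where "strat S Q = (\<lambda>\<rho> a. Re (op_trace ?M
      (op_mult ?M (\<lambda>f g. \<Sum>s\<in>S. tensor k (\<lambda>j. Q s j (a j)) f g) \<rho>)))"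
    for S :: "nat set" and Q :: "nat \<Rightarrow> nat \<Rightarrow> int \<Rightarrow> nat cop"
  have bound: "bias k G (strat S Q) \<le> \<Lambda> * (\<Prod>j<k. real (n j))"
    if S: "finite S" and psd: "\<forall>s\<in>S. \<forall>j<k. \<forall>b\<in>{-1, 1}. psd {..<n j} (Q s j b)"
      and id: "op_eq_on ?M (\<lambda>f g. \<Sum>s\<in>S. \<Sum>a\<in>answers k. tensor k (\<lambda>j. Q s j (a j)) f g) op_id" for S Q
  proof -
    define T where "T s a f g = tensor k (\<lambda>j. Q s j (a j)) f g" for s a f g
    have psd': "psd {..<n j} (Q s j (a j))" if "s \<in> S" "a \<in> answers k" "j < k" for s a j
    proof -
      have "a j \<in> {-1, 1}" using that by (auto simp: answers_def dest!: PiE_mem)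
      then show ?thesis using psd that by blast
    qed
    have "bias k G (strat S Q) = Re (\<Sum>f\<in>?M. \<Sum>g\<in>?M.
      (\<Sum>a\<in>answers k. of_int (\<Prod>j<k. a j) * (\<Sum>s\<in>S. T s a f g)) * game_operator G g f)"
      by (rule bias_eq) (simp add: strat_def op_trace_mult T_def)
    also have "(\<Sum>f\<in>?M. \<Sum>g\<in>?M. (\<Sum>a\<in>answers k. of_int (\<Prod>j<k. a j) * (\<Sum>s\<in>S. T s a f g)) * game_operator G g f)
      = (\<Sum>z\<in>?M \<times> ?M. \<Sum>w\<in>answers k \<times> S.
          of_int (\<Prod>j<k. fst w j) * (T (snd w) (fst w) (fst z) (snd z) * game_operator G (snd z) (fst z)))"
      by (simp only: sum_Times fst_conv snd_conv sum_distrib_left sum_distrib_right mult.assoc)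
    also have "\<dots> = (\<Sum>w\<in>answers k \<times> S. \<Sum>z\<in>?M \<times> ?M.
          of_int (\<Prod>j<k. fst w j) * (T (snd w) (fst w) (fst z) (snd z) * game_operator G (snd z) (fst z)))"
      by (rule sum.swap)
    also have "Re \<dots> \<le> cmod \<dots>" by (rule complex_Re_le_cmod)
    also have "\<dots> \<le> (\<Sum>w\<in>answers k \<times> S. \<Lambda> * (\<Prod>j<k. \<Sum>i<n j. Re (Q (snd w) j (fst w j) i i)))"
    proof (rule sum_norm_le)
      fix w assume "w \<in> answers k \<times> S"
      then have w: "fst w \<in> answers k" "snd w \<in> S" by auto
      have "cmod (of_int (\<Prod>j<k. fst w j)) = 1"
      proof -
        have "cmod (of_int (\<Prod>j<k. fst w j)) = (\<Prod>j<k. cmod (of_int (fst w j)))"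
          by (simp add: prod_norm[symmetric])
        also have "\<dots> = (\<Prod>j<k. 1)"
          by (intro prod.cong refl) (use w in \<open>auto simp: answers_def dest!: PiE_mem\<close>)
        finally show ?thesis by simp
      qed
      then have "cmod (\<Sum>z\<in>?M \<times> ?M. of_int (\<Prod>j<k. fst w j)
          * (T (snd w) (fst w) (fst z) (snd z) * game_operator G (snd z) (fst z)))
        = cmod (\<Sum>f\<in>?M. \<Sum>g\<in>?M. T (snd w) (fst w) f g * game_operator G g f)"
        by (simp only: sum_distrib_left[symmetric] norm_mult sum_Times fst_conv snd_conv)
      also have "\<dots> \<le> \<Lambda> * (\<Prod>j<k. \<Sum>i<n j. Re (Q (snd w) j (fst w j) i i))"
        unfolding T_def by (rule tensor_trace_bound[OF psd'[OF w(2,1)] \<Lambda> K])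
      finally show "cmod (\<Sum>z\<in>?M \<times> ?M. of_int (\<Prod>j<k. fst w j)
          * (T (snd w) (fst w) (fst z) (snd z) * game_operator G (snd z) (fst z)))
        \<le> \<Lambda> * (\<Prod>j<k. \<Sum>i<n j. Re (Q (snd w) j (fst w j) i i))" .
    qed
    also have "\<dots> = \<Lambda> * (\<Sum>a\<in>answers k. \<Sum>s\<in>S. \<Prod>j<k. \<Sum>i<n j. Re (Q s j (a j) i i))"
      by (simp only: sum_distrib_left sum_Times fst_conv snd_conv)
    also have "(\<Sum>a\<in>answers k. \<Sum>s\<in>S. \<Prod>j<k. \<Sum>i<n j. Re (Q s j (a j) i i)) = (\<Prod>j<k. real (n j))"
    proof -
      have "complex_of_real (\<Prod>j<k. \<Sum>i<n j. Re (Q s j (a j) i i)) = (\<Sum>f\<in>?M. T s a f f)"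
        if sa: "s \<in> S" "a \<in> answers k" for s a
      proof -
        have "complex_of_real (\<Prod>j<k. \<Sum>i<n j. Re (Q s j (a j) i i)) = (\<Prod>j<k. \<Sum>i<n j. Q s j (a j) i i)"
          unfolding of_real_prod of_real_sum
        proof (intro prod.cong sum.cong refl)
          fix j i assume "j \<in> {..<k}" "i \<in> {..<n j}"
          then have "Q s j (a j) i i \<in> \<real>\<^sub>\<ge>\<^sub>0" using psd_diag[OF psd'[OF sa, of j]] by simp
          then show "complex_of_real (Re (Q s j (a j) i i)) = Q s j (a j) i i"
            by (simp add: complex_nonneg_Reals_iff complex_eq_iff)
        qed
        also have "\<dots> = (\<Sum>f\<in>?M. T s a f f)"
          unfolding T_def tensor_def multi_def by (rule prod_sum_PiE) auto
        finally show ?thesis .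
      qed
      then have "complex_of_real (\<Sum>a\<in>answers k. \<Sum>s\<in>S. \<Prod>j<k. \<Sum>i<n j. Re (Q s j (a j) i i))
        = (\<Sum>a\<in>answers k. \<Sum>s\<in>S. \<Sum>f\<in>?M. T s a f f)"
        by (simp add: of_real_sum)
      also have "\<dots> = (\<Sum>w\<in>answers k \<times> S. \<Sum>f\<in>?M. T (snd w) (fst w) f f)" by (simp only: sum_Times fst_conv snd_conv)
      also have "\<dots> = (\<Sum>f\<in>?M. \<Sum>w\<in>answers k \<times> S. T (snd w) (fst w) f f)" by (rule sum.swap)
      also have "\<dots> = (\<Sum>f\<in>?M. \<Sum>s\<in>S. \<Sum>a\<in>answers k. T s a f f)"
        unfolding sum_Times fst_conv snd_conv by (intro sum.cong refl sum.swap)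
      also have "\<dots> = (\<Sum>f\<in>?M. 1)"
        using id unfolding op_eq_on_def T_def by (intro sum.cong refl) (simp add: op_id_def)
      also have "\<dots> = complex_of_real (\<Prod>j<k. real (n j))"
        by (simp add: multi_def card_PiE)
      finally show ?thesis by (simp only: of_real_eq_iff)
    qed
    finally show ?thesis .
  qed
  \<comment> \<open>\<open>cSUP_least\<close> needs a member: every player always answers 1.\<close>
  have "separable_strategies k n \<noteq> {}"
  proof -
    let ?Q = "\<lambda>(s::nat) (j::nat) (b::int). if b = 1 then op_id else (\<lambda>i i'. 0) :: nat cop"
    have psd_id: "psd {..<N} op_id" for N :: nat
    proof (rule psd_of_sum_rank_one[of "{..<N}"])
      fix i j :: nat assume "i \<in> {..<N}" "j \<in> {..<N}"
      have "(\<Sum>l<N. of_bool (i = l) * cnj (of_bool (j = l))) = (\<Sum>l<N. if l = i then of_bool (i = j) else 0 :: complex)"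
        by (intro sum.cong) auto
      then show "op_id i j = (\<Sum>l<N. of_bool (i = l) * cnj (of_bool (j = l)))"
        using \<open>i \<in> {..<N}\<close> by (simp add: op_id_def)
    qed simp
    have psd_0: "psd {..<N} (\<lambda>i i'. 0)" for N :: nat by (simp add: psd_def)
    have "(\<Sum>s\<in>{0 :: nat}. \<Sum>a\<in>answers k. tensor k (\<lambda>j. ?Q s j (a j)) f g) = op_id f g"
      if "f \<in> multi k n" "g \<in> multi k n" for f g
    proof -
      have "(\<Sum>s\<in>{0 :: nat}. \<Sum>a\<in>answers k. tensor k (\<lambda>j. ?Q s j (a j)) f g)
        = (\<Prod>j<k. \<Sum>b\<in>{-1, 1}. ?Q 0 j b (f j) (g j))"
        using sum_prod_answers[where \<phi> = "\<lambda>j b. ?Q 0 j b (f j) (g j)" and k = k] by (simp add: tensor_def)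
      also have "\<dots> = (\<Prod>j<k. op_id (f j) (g j))" by simp
      also have "\<dots> = op_id f g"
      proof (cases "f = g")
        case False
        then have "\<exists>j<k. f j \<noteq> g j"
          using that unfolding multi_def by (metis PiE_ext lessThan_iff)
        then show ?thesis using False by (auto simp: op_id_def)
      qed (simp add: op_id_def)
      finally show ?thesis .
    qed
    then have "op_eq_on (multi k n) (\<lambda>f g. \<Sum>s\<in>{0 :: nat}. \<Sum>a\<in>answers k. tensor k (\<lambda>j. ?Q s j (a j)) f g) op_id"
      unfolding op_eq_on_def by blast
    moreover have "\<forall>s\<in>{0 :: nat}. \<forall>j<k. \<forall>b\<in>{-1, 1}. psd {..<n j} (?Q s j b)"
      using psd_id psd_0 by simp
    ultimately have "strat {0} ?Q \<in> separable_strategies k n"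
      unfolding separable_strategies_def mem_Collect_eq
      by (intro exI[of _ "{0}"] exI[of _ ?Q] conjI) (simp_all only: strat_def finite.emptyI finite.insertI)
    then show ?thesis by blast
  qed
  moreover have "bias k G P \<le> \<Lambda> * (\<Prod>j<k. real (n j))" if P: "P \<in> separable_strategies k n" for P
  proof -
    obtain S :: "nat set" and Q :: "nat \<Rightarrow> nat \<Rightarrow> int \<Rightarrow> nat cop" where S: "finite S" "\<forall>s\<in>S. \<forall>j<k. \<forall>b\<in>{-1, 1}. psd {..<n j} (Q s j b)"
      "op_eq_on ?M (\<lambda>f g. \<Sum>s\<in>S. \<Sum>a\<in>answers k. tensor k (\<lambda>j. Q s j (a j)) f g) op_id"
      and P: "P = (\<lambda>\<rho> a. Re (op_trace ?M (op_mult ?M (\<lambda>f g. \<Sum>s\<in>S. tensor k (\<lambda>j. Q s j (a j)) f g) \<rho>)))"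
      using P unfolding separable_strategies_def mem_Collect_eq by (elim exE conjE) (rule that)
    have "P = strat S Q" unfolding strat_def by (rule P)
    then show ?thesis using bound[OF S] by simp
  qed
  ultimately show ?thesis unfolding separable_bias_def by (rule cSUP_least)
qed

section \<open>Symmetric block matrices\<close>

text \<open>Real matrices and complex vectors: the game and the observables constructed here have
  real entries, but separable strategies may be complex.\<close>

definition quad_form :: "'i set \<Rightarrow> ('i \<Rightarrow> 'i \<Rightarrow> real) \<Rightarrow> ('i \<Rightarrow> complex) \<Rightarrow> complex" where
  "quad_form I H v = (\<Sum>x\<in>I. \<Sum>y\<in>I. cnj (v x) * of_real (H x y) * v y)"

lemma quad_form_real:
  assumes "\<And>x y. x \<in> I \<Longrightarrow> y \<in> I \<Longrightarrow> H x y = H y x"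
  shows "quad_form I H v \<in> \<real>"
proof -
  have "cnj (quad_form I H v) = (\<Sum>x\<in>I. \<Sum>y\<in>I. cnj (v y) * of_real (H x y) * v x)"
    by (simp add: quad_form_def cnj_sum mult_ac)
  also have "\<dots> = (\<Sum>y\<in>I. \<Sum>x\<in>I. cnj (v y) * of_real (H x y) * v x)" by (rule sum.swap)
  also have "\<dots> = quad_form I H v"
    unfolding quad_form_def by (intro sum.cong refl) (simp add: assms)
  finally show ?thesis by (simp add: Reals_cnj_iff)
qed

text \<open>\<kappa> dominates the form of \<open>H\<close>, so adding \<kappa> times the identity
  makes both signs of \<open>H\<close> positive. This produces the question states as well as the
  POVMs.\<close>

lemma psd_identity_plus:
  fixes H :: "'i \<Rightarrow> 'i \<Rightarrow> real"
  assumes fin: "finite I" and sym: "\<And>x y. x \<in> I \<Longrightarrow> y \<in> I \<Longrightarrow> H x y = H y x"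
    and H: "\<And>v. cmod (quad_form I H v) \<le> \<kappa> * (\<Sum>x\<in>I. (cmod (v x))\<^sup>2)"
    and \<sigma>: "\<bar>\<sigma>\<bar> = 1" and r: "r \<ge> 0"
  shows "psd I (\<lambda>x y. of_real (r * (\<kappa> * of_bool (x = y) + \<sigma> * H x y)))"
  unfolding psd_def
proof
  fix v :: "'i \<Rightarrow> complex"
  define S where "S = (\<Sum>x\<in>I. (cmod (v x))\<^sup>2)"
  obtain q where q: "quad_form I H v = of_real q"
  proof -
    have "quad_form I H v \<in> \<real>" by (rule quad_form_real) (rule sym)
    then show ?thesis using that by (elim Reals_cases)
  qed
  have "\<bar>q\<bar> \<le> \<kappa> * S" using H[of v] by (simp add: q S_def)
  then have "\<bar>\<sigma> * q\<bar> \<le> \<kappa> * S" using \<sigma> by (simp add: abs_mult)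
  then have pos: "r * (\<kappa> * S + \<sigma> * q) \<ge> 0" using r by (intro mult_nonneg_nonneg) auto
  have diag: "(\<Sum>y\<in>I. cnj (v x) * of_bool (x = y) * v y) = of_real ((cmod (v x))\<^sup>2)" if "x \<in> I" for x
  proof -
    have "(\<Sum>y\<in>I. cnj (v x) * of_bool (x = y) * v y) = (\<Sum>y\<in>I. if y = x then v x * cnj (v x) else 0)"
      by (intro sum.cong) (auto simp: mult.commute)
    then show ?thesis using fin that by (simp add: complex_norm_square del: of_real_power)
  qed
  have "(\<Sum>x\<in>I. \<Sum>y\<in>I. cnj (v x) * of_real (r * (\<kappa> * of_bool (x = y) + \<sigma> * H x y)) * v y)
    = (\<Sum>x\<in>I. \<Sum>y\<in>I. of_real (r * \<kappa>) * (cnj (v x) * of_bool (x = y) * v y)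
        + of_real (r * \<sigma>) * (cnj (v x) * of_real (H x y) * v y))"
    by (intro sum.cong refl) (simp add: algebra_simps)
  also have "\<dots> = of_real (r * \<kappa>) * (\<Sum>x\<in>I. \<Sum>y\<in>I. cnj (v x) * of_bool (x = y) * v y)
      + of_real (r * \<sigma>) * quad_form I H v"
    unfolding quad_form_def sum.distrib sum_distrib_left ..
  also have "(\<Sum>x\<in>I. \<Sum>y\<in>I. cnj (v x) * of_bool (x = y) * v y) = of_real S"
    unfolding S_def of_real_sum by (intro sum.cong refl diag)
  also have "of_real (r * \<kappa>) * of_real S + of_real (r * \<sigma>) * quad_form I H v
      = complex_of_real (r * (\<kappa> * S + \<sigma> * q))"
    by (simp add: q algebra_simps)
  also have "\<dots> \<in> \<real>\<^sub>\<ge>\<^sub>0" using pos by (simp only: nonneg_Reals_of_real_iff)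
  finally show "(\<Sum>x\<in>I. \<Sum>y\<in>I. cnj (v x) * of_real (r * (\<kappa> * of_bool (x = y) + \<sigma> * H x y)) * v y) \<in> \<real>\<^sub>\<ge>\<^sub>0" .
qed

text \<open>Two equally likely questions, with states proportional to \<kappa> I + H and \<kappa> I
  - H and with opposite signs. The zero diagonal gives both the same trace. The scale
  \<open>K\<close> is left uncontrolled because it cancels in the ratio of the biases.\<close>

lemma game_of_symmetric:
  fixes H :: "(nat \<Rightarrow> nat) \<Rightarrow> (nat \<Rightarrow> nat) \<Rightarrow> real"
  assumes ne: "multi k n \<noteq> {}"
    and sym: "\<And>f g. f \<in> multi k n \<Longrightarrow> g \<in> multi k n \<Longrightarrow> H f g = H g f"
    and diag: "\<And>f. f \<in> multi k n \<Longrightarrow> H f f = 0"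
  obtains G K where "K > 0" "quantum_xor_game k n G"
    "\<And>f g. game_operator G f g = of_real (H f g / K)"
proof -
  let ?M = "multi k n"
  \<comment> \<open>A crude bound on the operator norm; the summand 1 keeps it positive.\<close>
  define \<kappa> where "\<kappa> = 1 + (\<Sum>f\<in>?M. \<Sum>g\<in>?M. \<bar>H f g\<bar>)"
  have \<kappa>: "\<kappa> > 0" unfolding \<kappa>_def by (intro add_pos_nonneg sum_nonneg) auto
  define N where "N = real (card ?M)"
  have N: "N > 0" using ne finite_multi by (simp add: N_def card_gt_0_iff)
  have Q: "cmod (quad_form ?M H v) \<le> \<kappa> * (\<Sum>f\<in>?M. (cmod (v f))\<^sup>2)" for v
  proof -
    define S where "S = (\<Sum>f\<in>?M. (cmod (v f))\<^sup>2)"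
    have S: "S \<ge> 0" by (auto simp: S_def intro: sum_nonneg)
    have le: "cmod (v f) \<le> sqrt S" if "f \<in> ?M" for f
      unfolding S_def using that finite_multi by (intro real_le_rsqrt member_le_sum) auto
    have "cmod (quad_form ?M H v) \<le> (\<Sum>f\<in>?M. \<Sum>g\<in>?M. cmod (v f) * \<bar>H f g\<bar> * cmod (v g))"
      unfolding quad_form_def by (intro sum_norm_le order.trans[OF sum_norm_le]) (auto simp: norm_mult)
    also have "\<dots> \<le> (\<Sum>f\<in>?M. \<Sum>g\<in>?M. sqrt S * \<bar>H f g\<bar> * sqrt S)"
      by (intro sum_mono mult_mono le) (auto simp: S)
    also have "\<dots> = (\<Sum>f\<in>?M. \<Sum>g\<in>?M. \<bar>H f g\<bar>) * S"
      using S unfolding sum_distrib_right by (intro sum.cong refl) (simp add: mult_ac)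
    also have "\<dots> \<le> \<kappa> * S" using S by (intro mult_right_mono) (auto simp: \<kappa>_def)
    finally show ?thesis by (simp add: S_def)
  qed
  define q where "q \<sigma> = (\<lambda>f g. complex_of_real (1 / (\<kappa> * N) * (\<kappa> * of_bool (f = g) + \<sigma> * H f g)))" for \<sigma>
  have q: "qstate ?M (q \<sigma>)" if "\<bar>\<sigma>\<bar> = 1" for \<sigma>
  proof -
    have "psd ?M (q \<sigma>)"
      unfolding q_def by (rule psd_identity_plus) (use finite_multi sym Q that \<kappa> N in auto)
    moreover have "op_trace ?M (q \<sigma>) = (\<Sum>f\<in>?M. of_real (1 / N))"
      unfolding op_trace_def q_def using \<kappa> by (intro sum.cong refl) (simp add: diag)
    moreover have "(\<Sum>f\<in>?M. complex_of_real (1 / N)) = 1" using N by (simp add: N_def)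
    ultimately show ?thesis by (simp add: qstate_def)
  qed
  define G where "G = \<lparr>num_questions = 2, question = (\<lambda>x. q (if x = 0 then 1 else - 1)),
    sign = (\<lambda>x. if x = 0 then 1 else - 1), prob = (\<lambda>x. 1 / 2)\<rparr>"
  show ?thesis
  proof (rule that[of "\<kappa> * N" G])
    show "\<kappa> * N > 0" using \<kappa> N by simp
    show "quantum_xor_game k n G"
      unfolding quantum_xor_game_def by (auto simp: G_def intro!: q)
    show "game_operator G f g = of_real (H f g / (\<kappa> * N))" for f g
    proof -
      have "{..<2 :: nat} = {0, 1}" by auto
      then have "game_operator G f g = of_real (1 / 2 * (1 / (\<kappa> * N) * (\<kappa> * of_bool (f = g) + 1 * H f g))
          + - 1 * (1 / 2 * (1 / (\<kappa> * N) * (\<kappa> * of_bool (f = g) + - 1 * H f g))))"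
        by (simp add: game_operator_def G_def q_def)
      also have "1 / 2 * (r * (y + 1 * h)) + - 1 * (1 / 2 * (r * (y + - 1 * h))) = r * h" for r y h :: real
        by (simp add: algebra_simps)
      finally show ?thesis by simp
    qed
  qed
qed

text \<open>\<open>S\<close> placed inside a larger matrix along two embeddings. When their images
  are disjoint, the symmetrised version has \<open>S\<close> and its transpose in two off-diagonal
  blocks.\<close>

definition block :: "('p \<Rightarrow> 'i) \<Rightarrow> ('q \<Rightarrow> 'i) \<Rightarrow> 'p set \<Rightarrow> 'q set \<Rightarrow> ('p \<Rightarrow> 'q \<Rightarrow> real) \<Rightarrow> 'i \<Rightarrow> 'i \<Rightarrow> real" where
  "block \<alpha> \<beta> P Q S x y = (if x \<in> \<alpha> ` P \<and> y \<in> \<beta> ` Q then S (inv_into P \<alpha> x) (inv_into Q \<beta> y) else 0)"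

definition sym_block :: "('p \<Rightarrow> 'i) \<Rightarrow> ('q \<Rightarrow> 'i) \<Rightarrow> 'p set \<Rightarrow> 'q set \<Rightarrow> ('p \<Rightarrow> 'q \<Rightarrow> real) \<Rightarrow> 'i \<Rightarrow> 'i \<Rightarrow> real" where
  "sym_block \<alpha> \<beta> P Q S x y = block \<alpha> \<beta> P Q S x y + block \<alpha> \<beta> P Q S y x"

lemma block_image:
  "inj_on \<alpha> P \<Longrightarrow> inj_on \<beta> Q \<Longrightarrow> p \<in> P \<Longrightarrow> q \<in> Q \<Longrightarrow> block \<alpha> \<beta> P Q S (\<alpha> p) (\<beta> q) = S p q"
  by (simp add: block_def)

lemma sym_block_commute: "sym_block \<alpha> \<beta> P Q S x y = sym_block \<alpha> \<beta> P Q S y x"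
  by (simp add: sym_block_def)

lemma sum_sym_block:
  fixes \<phi> :: "'i \<Rightarrow> 'i \<Rightarrow> 'c :: real_algebra_1"
  assumes fin: "finite I" and inj: "inj_on \<alpha> P" "inj_on \<beta> Q" and sub: "\<alpha> ` P \<subseteq> I" "\<beta> ` Q \<subseteq> I"
  shows "(\<Sum>x\<in>I. \<Sum>y\<in>I. \<phi> x y * of_real (sym_block \<alpha> \<beta> P Q S x y))
    = (\<Sum>p\<in>P. \<Sum>q\<in>Q. (\<phi> (\<alpha> p) (\<beta> q) + \<phi> (\<beta> q) (\<alpha> p)) * of_real (S p q))"
proof -
  have one: "(\<Sum>x\<in>I. \<Sum>y\<in>I. \<psi> x y * of_real (block \<alpha> \<beta> P Q S x y))
    = (\<Sum>p\<in>P. \<Sum>q\<in>Q. \<psi> (\<alpha> p) (\<beta> q) * of_real (S p q))" for \<psi> :: "'i \<Rightarrow> 'i \<Rightarrow> 'c"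
  proof -
    have "(\<Sum>x\<in>I. \<Sum>y\<in>I. \<psi> x y * of_real (block \<alpha> \<beta> P Q S x y))
      = (\<Sum>x\<in>\<alpha> ` P. \<Sum>y\<in>I. \<psi> x y * of_real (block \<alpha> \<beta> P Q S x y))"
      by (rule sum.mono_neutral_right) (use fin sub in \<open>auto simp: block_def\<close>)
    also have "\<dots> = (\<Sum>x\<in>\<alpha> ` P. \<Sum>y\<in>\<beta> ` Q. \<psi> x y * of_real (block \<alpha> \<beta> P Q S x y))"
      by (intro sum.cong refl sum.mono_neutral_right) (use fin sub in \<open>auto simp: block_def\<close>)
    also have "\<dots> = (\<Sum>p\<in>P. \<Sum>q\<in>Q. \<psi> (\<alpha> p) (\<beta> q) * of_real (block \<alpha> \<beta> P Q S (\<alpha> p) (\<beta> q)))"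
      by (simp only: sum.reindex[OF inj(1)] sum.reindex[OF inj(2)] o_def)
    also have "\<dots> = (\<Sum>p\<in>P. \<Sum>q\<in>Q. \<psi> (\<alpha> p) (\<beta> q) * of_real (S p q))"
      by (intro sum.cong refl) (simp add: block_image inj)
    finally show ?thesis .
  qed
  have "(\<Sum>x\<in>I. \<Sum>y\<in>I. \<phi> x y * of_real (sym_block \<alpha> \<beta> P Q S x y))
    = (\<Sum>x\<in>I. \<Sum>y\<in>I. \<phi> x y * of_real (block \<alpha> \<beta> P Q S x y))
      + (\<Sum>x\<in>I. \<Sum>y\<in>I. \<phi> x y * of_real (block \<alpha> \<beta> P Q S y x))"
    by (simp only: sym_block_def of_real_add ring_distribs sum.distrib)
  also have "(\<Sum>x\<in>I. \<Sum>y\<in>I. \<phi> x y * of_real (block \<alpha> \<beta> P Q S y x))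
    = (\<Sum>y\<in>I. \<Sum>x\<in>I. \<phi> x y * of_real (block \<alpha> \<beta> P Q S y x))" by (rule sum.swap)
  finally show ?thesis
    unfolding one[of \<phi>] one[of "\<lambda>y x. \<phi> x y"] by (simp only: ring_distribs sum.distrib)
qed

lemma quad_form_sym_block:
  assumes fin: "finite I" and inj: "inj_on \<alpha> P" "inj_on \<beta> Q" and sub: "\<alpha> ` P \<subseteq> I" "\<beta> ` Q \<subseteq> I"
  shows "quad_form I (sym_block \<alpha> \<beta> P Q S) v
    = of_real (\<Sum>p\<in>P. \<Sum>q\<in>Q. 2 * (Re (v (\<alpha> p)) * Re (v (\<beta> q)) + Im (v (\<alpha> p)) * Im (v (\<beta> q))) * S p q)"
proof -
  have "quad_form I (sym_block \<alpha> \<beta> P Q S) v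
    = (\<Sum>x\<in>I. \<Sum>y\<in>I. (cnj (v x) * v y) * of_real (sym_block \<alpha> \<beta> P Q S x y))"
    unfolding quad_form_def by (intro sum.cong refl) (simp only: mult_ac)
  also have "\<dots> = (\<Sum>p\<in>P. \<Sum>q\<in>Q. (cnj (v (\<alpha> p)) * v (\<beta> q) + cnj (v (\<beta> q)) * v (\<alpha> p)) * of_real (S p q))"
    by (rule sum_sym_block[OF assms])
  also have "\<dots> = (\<Sum>p\<in>P. \<Sum>q\<in>Q.
      of_real (2 * (Re (v (\<alpha> p)) * Re (v (\<beta> q)) + Im (v (\<alpha> p)) * Im (v (\<beta> q)))) * of_real (S p q))"
    by (intro sum.cong refl arg_cong2[of _ _ _ _ "(*)"]) (simp add: complex_eq_iff)
  finally show ?thesis by (simp only: of_real_sum of_real_mult)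
qed

text \<open>2 |x| |y| is at most |x|^2 + |y|^2, applied to the real and the imaginary parts
  separately; since the blocks are disjoint, the squared norms add up to at most that of
  \<open>v\<close>.\<close>

lemma quad_form_sym_block_le:
  assumes fin: "finite I" and inj: "inj_on \<alpha> P" "inj_on \<beta> Q" and sub: "\<alpha> ` P \<subseteq> I" "\<beta> ` Q \<subseteq> I"
    and disj: "\<alpha> ` P \<inter> \<beta> ` Q = {}" and \<kappa>: "\<kappa> \<ge> 0"
    and S: "\<And>x y. \<bar>\<Sum>p\<in>P. \<Sum>q\<in>Q. S p q * (x p * y q)\<bar> \<le> \<kappa> * (L2_set x P * L2_set y Q)"
  shows "cmod (quad_form I (sym_block \<alpha> \<beta> P Q S) v) \<le> \<kappa> * (\<Sum>x\<in>I. (cmod (v x))\<^sup>2)"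
proof -
  have two: "2 * \<bar>\<Sum>p\<in>P. \<Sum>q\<in>Q. S p q * (x p * y q)\<bar> \<le> \<kappa> * ((\<Sum>p\<in>P. (x p)\<^sup>2) + (\<Sum>q\<in>Q. (y q)\<^sup>2))" for x y
  proof -
    have "0 \<le> (L2_set x P - L2_set y Q)\<^sup>2" by simp
    then have "2 * (L2_set x P * L2_set y Q) \<le> (L2_set x P)\<^sup>2 + (L2_set y Q)\<^sup>2"
      by (simp add: power2_diff)
    then have "\<kappa> * (2 * (L2_set x P * L2_set y Q)) \<le> \<kappa> * ((\<Sum>p\<in>P. (x p)\<^sup>2) + (\<Sum>q\<in>Q. (y q)\<^sup>2))"
      using \<kappa> unfolding L2_set_power2 by (rule mult_left_mono)
    then show ?thesis using S[of x y] by linarith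
  qed
  define a where "a p = v (\<alpha> p)" for p
  define b where "b q = v (\<beta> q)" for q
  have "(\<Sum>p\<in>P. \<Sum>q\<in>Q. 2 * (Re (a p) * Re (b q) + Im (a p) * Im (b q)) * S p q)
    = 2 * (\<Sum>p\<in>P. \<Sum>q\<in>Q. S p q * (Re (a p) * Re (b q))) + 2 * (\<Sum>p\<in>P. \<Sum>q\<in>Q. S p q * (Im (a p) * Im (b q)))"
    by (simp add: sum_distrib_left sum.distrib[symmetric] algebra_simps)
  moreover have "\<bar>2 * A + 2 * B\<bar> \<le> 2 * \<bar>A\<bar> + 2 * \<bar>B\<bar>" for A B :: real by linarith
  ultimately have "cmod (quad_form I (sym_block \<alpha> \<beta> P Q S) v)
    \<le> 2 * \<bar>\<Sum>p\<in>P. \<Sum>q\<in>Q. S p q * (Re (a p) * Re (b q))\<bar> + 2 * \<bar>\<Sum>p\<in>P. \<Sum>q\<in>Q. S p q * (Im (a p) * Im (b q))\<bar>"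
    unfolding quad_form_sym_block[OF assms(1-5)] a_def[symmetric] b_def[symmetric] norm_of_real
    by (simp only:)
  also have "\<dots> \<le> \<kappa> * ((\<Sum>p\<in>P. (Re (a p))\<^sup>2) + (\<Sum>q\<in>Q. (Re (b q))\<^sup>2)) + \<kappa> * ((\<Sum>p\<in>P. (Im (a p))\<^sup>2) + (\<Sum>q\<in>Q. (Im (b q))\<^sup>2))"
    by (intro add_mono two)
  also have "\<dots> = \<kappa> * ((\<Sum>p\<in>P. (cmod (v (\<alpha> p)))\<^sup>2) + (\<Sum>q\<in>Q. (cmod (v (\<beta> q)))\<^sup>2))"
    by (simp add: cmod_power2 sum.distrib a_def b_def algebra_simps)
  also have "\<dots> = \<kappa> * ((\<Sum>x\<in>\<alpha> ` P. (cmod (v x))\<^sup>2) + (\<Sum>x\<in>\<beta> ` Q. (cmod (v x))\<^sup>2))"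
    by (simp only: sum.reindex[OF inj(1)] sum.reindex[OF inj(2)] o_def)
  also have "\<dots> = \<kappa> * (\<Sum>x\<in>\<alpha> ` P \<union> \<beta> ` Q. (cmod (v x))\<^sup>2)"
    using disj finite_subset[OF sub(1) fin] finite_subset[OF sub(2) fin] by (subst sum.union_disjoint) auto
  also have "\<dots> \<le> \<kappa> * (\<Sum>x\<in>I. (cmod (v x))\<^sup>2)"
    using sub fin \<kappa> by (intro mult_left_mono sum_mono2) auto
  finally show ?thesis .
qed

section \<open>Sums over tuples and tensor powers of almost orthogonal families\<close>

lemma sum_multi_pairs:
  fixes \<phi> :: "nat \<Rightarrow> nat \<Rightarrow> nat \<Rightarrow> 'c :: comm_semiring_1"
  shows "(\<Sum>f\<in>multi k n. \<Sum>g\<in>multi k n. \<Prod>j<k. \<phi> j (f j) (g j)) = (\<Prod>j<k. \<Sum>i<n j. \<Sum>i'<n j. \<phi> j i i')"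
proof -
  have "(\<Sum>f\<in>multi k n. \<Sum>g\<in>multi k n. \<Prod>j<k. \<phi> j (f j) (g j))
    = (\<Sum>f\<in>multi k n. \<Prod>j<k. \<Sum>i'<n j. \<phi> j (f j) i')"
    unfolding multi_def
    by (intro sum.cong refl prod_sum_PiE[symmetric, where f = "\<lambda>j i'. \<phi> j (_ j) i'"]) auto
  also have "\<dots> = (\<Prod>j<k. \<Sum>i<n j. \<Sum>i'<n j. \<phi> j i i')"
    unfolding multi_def by (rule prod_sum_PiE[symmetric, where f = "\<lambda>j i. \<Sum>i'<n j. \<phi> j i i'"]) auto
  finally show ?thesis .
qed

text \<open>A lower Riesz bound tensorizes. One slot is split off; the induction hypothesis is
  applied for each fixed index in that slot, then \<open>X\<close> for each fixed \<open>u\<close>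
  in the others.\<close>

lemma tensor_lower_bound:
  fixes X :: "'a \<Rightarrow> 'u \<Rightarrow> real"
  assumes fin: "finite J" and lam: "w \<ge> 0"
    and X: "\<And>b. w * (\<Sum>a\<in>A. (b a)\<^sup>2) \<le> (\<Sum>u\<in>U. (\<Sum>a\<in>A. b a * X a u)\<^sup>2)"
  shows "w ^ card J * (\<Sum>a\<in>(\<Pi>\<^sub>E j\<in>J. A). (t a)\<^sup>2)
    \<le> (\<Sum>u\<in>(\<Pi>\<^sub>E j\<in>J. U). (\<Sum>a\<in>(\<Pi>\<^sub>E j\<in>J. A). t a * (\<Prod>j\<in>J. X (a j) (u j)))\<^sup>2)"
  using fin
proof (induction J arbitrary: t rule: finite_induct)
  case empty
  show ?case by simp
next
  case (insert j J)
  let ?P = "\<lambda>a u. \<Prod>l\<in>J. X (a l) (u l)"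
  have upd: "(\<Prod>l\<in>insert j J. X ((a(j := \<alpha>)) l) ((u(j := r)) l)) = X \<alpha> r * ?P a u" for a u \<alpha> r
  proof -
    have "(\<Prod>l\<in>J. X ((a(j := \<alpha>)) l) ((u(j := r)) l)) = ?P a u"
      using insert.hyps by (intro prod.cong) auto
    then show ?thesis using insert.hyps by simp
  qed
  have "w ^ card (insert j J) * (\<Sum>a\<in>(\<Pi>\<^sub>E j\<in>insert j J. A). (t a)\<^sup>2)
    = w * (\<Sum>\<alpha>\<in>A. w ^ card J * (\<Sum>a\<in>(\<Pi>\<^sub>E j\<in>J. A). (t (a(j := \<alpha>)))\<^sup>2))"
  proof -
    have "(\<Sum>a\<in>(\<Pi>\<^sub>E j\<in>J. A). \<Sum>\<alpha>\<in>A. (t (a(j := \<alpha>)))\<^sup>2) = (\<Sum>\<alpha>\<in>A. \<Sum>a\<in>(\<Pi>\<^sub>E j\<in>J. A). (t (a(j := \<alpha>)))\<^sup>2)"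
      by (rule sum.swap)
    then show ?thesis
      using insert.hyps by (simp add: sum_PiE_insert sum_distrib_left mult.assoc)
  qed
  also have "\<dots> \<le> w * (\<Sum>\<alpha>\<in>A. \<Sum>u\<in>(\<Pi>\<^sub>E j\<in>J. U). (\<Sum>a\<in>(\<Pi>\<^sub>E j\<in>J. A). t (a(j := \<alpha>)) * ?P a u)\<^sup>2)"
    using lam by (intro mult_left_mono sum_mono insert.IH) auto
  also have "\<dots> = (\<Sum>u\<in>(\<Pi>\<^sub>E j\<in>J. U). w * (\<Sum>\<alpha>\<in>A. (\<Sum>a\<in>(\<Pi>\<^sub>E j\<in>J. A). t (a(j := \<alpha>)) * ?P a u)\<^sup>2))"
    by (subst sum.swap) (simp only: sum_distrib_left)
  also have "\<dots> \<le> (\<Sum>u\<in>(\<Pi>\<^sub>E j\<in>J. U). \<Sum>r\<in>U. (\<Sum>\<alpha>\<in>A. (\<Sum>a\<in>(\<Pi>\<^sub>E j\<in>J. A). t (a(j := \<alpha>)) * ?P a u) * X \<alpha> r)\<^sup>2)"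
    by (intro sum_mono X)
  also have "\<dots> = (\<Sum>u\<in>(\<Pi>\<^sub>E j\<in>J. U). \<Sum>r\<in>U. (\<Sum>a\<in>(\<Pi>\<^sub>E j\<in>J. A). \<Sum>\<alpha>\<in>A. t (a(j := \<alpha>)) * (X \<alpha> r * ?P a u))\<^sup>2)"
  proof (intro sum.cong refl arg_cong[of _ _ "\<lambda>z. z\<^sup>2"])
    fix u r
    have "(\<Sum>\<alpha>\<in>A. (\<Sum>a\<in>(\<Pi>\<^sub>E j\<in>J. A). t (a(j := \<alpha>)) * ?P a u) * X \<alpha> r)
      = (\<Sum>\<alpha>\<in>A. \<Sum>a\<in>(\<Pi>\<^sub>E j\<in>J. A). t (a(j := \<alpha>)) * (X \<alpha> r * ?P a u))"
      unfolding sum_distrib_right by (intro sum.cong refl) (simp only: mult_ac)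
    then show "(\<Sum>\<alpha>\<in>A. (\<Sum>a\<in>(\<Pi>\<^sub>E j\<in>J. A). t (a(j := \<alpha>)) * ?P a u) * X \<alpha> r)
      = (\<Sum>a\<in>(\<Pi>\<^sub>E j\<in>J. A). \<Sum>\<alpha>\<in>A. t (a(j := \<alpha>)) * (X \<alpha> r * ?P a u))"
      by (simp only: sum.swap[of _ A])
  qed
  also have "\<dots> = (\<Sum>u\<in>(\<Pi>\<^sub>E j\<in>insert j J. U).
      (\<Sum>a\<in>(\<Pi>\<^sub>E j\<in>insert j J. A). t a * (\<Prod>j\<in>insert j J. X (a j) (u j)))\<^sup>2)"
    unfolding sum_PiE_insert[OF insert.hyps(2)] upd ..
  finally show ?case .
qed

text \<open>Diagonal dominance of the Gram matrix: the off-diagonal part is at most e times the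
  squared sum of the |c_a|, hence at most e card A |c|^2 = (w / 2) |c|^2.\<close>

lemma almost_orthogonal_lower_bound:
  fixes X :: "'a \<Rightarrow> 'u \<Rightarrow> real"
  assumes fin: "finite A" "A \<noteq> {}"
    and norm: "\<And>a. a \<in> A \<Longrightarrow> (\<Sum>u\<in>U. X a u * X a u) = w"
    and off: "\<And>a b. a \<in> A \<Longrightarrow> b \<in> A \<Longrightarrow> a \<noteq> b \<Longrightarrow> \<bar>\<Sum>u\<in>U. X a u * X b u\<bar> \<le> w / (2 * real (card A))"
    and w: "w \<ge> 0"
  shows "w / 2 * (\<Sum>a\<in>A. (c a)\<^sup>2) \<le> (\<Sum>u\<in>U. (\<Sum>a\<in>A. c a * X a u)\<^sup>2)"
proof -
  define \<Gamma> where "\<Gamma> a b = (\<Sum>u\<in>U. X a u * X b u)" for a b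
  define e where "e = w / (2 * real (card A))"
  have card: "real (card A) > 0" using fin by (simp add: card_gt_0_iff)
  have e: "e \<ge> 0" using w by (simp add: e_def)
  have "(\<Sum>u\<in>U. (\<Sum>a\<in>A. c a * X a u)\<^sup>2) = (\<Sum>u\<in>U. \<Sum>a\<in>A. \<Sum>b\<in>A. c a * c b * (X a u * X b u))"
    unfolding power2_eq_square sum_product by (intro sum.cong refl) (simp only: mult_ac)
  also have "\<dots> = (\<Sum>a\<in>A. \<Sum>u\<in>U. \<Sum>b\<in>A. c a * c b * (X a u * X b u))" by (rule sum.swap)
  also have "\<dots> = (\<Sum>a\<in>A. \<Sum>b\<in>A. \<Sum>u\<in>U. c a * c b * (X a u * X b u))" by (intro sum.cong refl sum.swap)
  also have "\<dots> = (\<Sum>a\<in>A. \<Sum>b\<in>A. c a * c b * \<Gamma> a b)" unfolding \<Gamma>_def sum_distrib_left ..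
  finally have eq: "(\<Sum>u\<in>U. (\<Sum>a\<in>A. c a * X a u)\<^sup>2) = (\<Sum>a\<in>A. \<Sum>b\<in>A. c a * c b * \<Gamma> a b)" .
  have entry: "of_bool (a = b) * (w * (c a)\<^sup>2) - e * (\<bar>c a\<bar> * \<bar>c b\<bar>) \<le> c a * c b * \<Gamma> a b"
    if "a \<in> A" "b \<in> A" for a b
  proof (cases "a = b")
    case True
    then show ?thesis using norm[OF that(1)] e by (simp add: \<Gamma>_def power2_eq_square)
  next
    case False
    have "\<bar>c a * c b * \<Gamma> a b\<bar> \<le> \<bar>c a\<bar> * \<bar>c b\<bar> * e"
      unfolding abs_mult using off[OF that False] by (intro mult_left_mono) (auto simp: \<Gamma>_def e_def)
    then show ?thesis using False by (simp add: mult_ac)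
  qed
  have diag: "(\<Sum>a\<in>A. \<Sum>b\<in>A. of_bool (a = b) * (w * (c a)\<^sup>2) - e * (\<bar>c a\<bar> * \<bar>c b\<bar>))
    = w * (\<Sum>a\<in>A. (c a)\<^sup>2) - e * (\<Sum>a\<in>A. \<bar>c a\<bar>)\<^sup>2"
  proof -
    have "(\<Sum>b\<in>A. of_bool (a = b) * (w * (c a)\<^sup>2)) = w * (c a)\<^sup>2" if "a \<in> A" for a
      using fin that by (simp add: of_bool_def if_distrib[of "\<lambda>z. z * _"] cong: if_cong)
    then have "(\<Sum>a\<in>A. \<Sum>b\<in>A. of_bool (a = b) * (w * (c a)\<^sup>2)) = w * (\<Sum>a\<in>A. (c a)\<^sup>2)"
      unfolding sum_distrib_left by (intro sum.cong refl)
    moreover have "(\<Sum>a\<in>A. \<Sum>b\<in>A. e * (\<bar>c a\<bar> * \<bar>c b\<bar>)) = e * (\<Sum>a\<in>A. \<bar>c a\<bar>)\<^sup>2"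
    proof -
      have "(\<Sum>a\<in>A. \<bar>c a\<bar>)\<^sup>2 = (\<Sum>a\<in>A. \<Sum>b\<in>A. \<bar>c a\<bar> * \<bar>c b\<bar>)"
        by (simp only: power2_eq_square sum_product)
      then show ?thesis by (simp only: sum_distrib_left)
    qed
    ultimately show ?thesis by (simp only: sum_subtractf)
  qed
  have "e * (\<Sum>a\<in>A. \<bar>c a\<bar>)\<^sup>2 \<le> w / 2 * (\<Sum>a\<in>A. (c a)\<^sup>2)"
  proof -
    have "(\<Sum>a\<in>A. 1 * \<bar>c a\<bar>) \<le> L2_set (\<lambda>_. 1) A * L2_set c A"
      using L2_set_mult_ineq[of "\<lambda>_. 1" c A] by simp
    then have "(\<Sum>a\<in>A. \<bar>c a\<bar>)\<^sup>2 \<le> (L2_set (\<lambda>_. 1) A * L2_set c A)\<^sup>2"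
      by (intro power_mono) (auto intro: sum_nonneg)
    also have "\<dots> = real (card A) * (\<Sum>a\<in>A. (c a)\<^sup>2)"
      by (simp add: power_mult_distrib L2_set_power2)
    finally have "e * (\<Sum>a\<in>A. \<bar>c a\<bar>)\<^sup>2 \<le> e * (real (card A) * (\<Sum>a\<in>A. (c a)\<^sup>2))"
      using e by (rule mult_left_mono)
    then show ?thesis using card by (simp add: e_def)
  qed
  then have "w / 2 * (\<Sum>a\<in>A. (c a)\<^sup>2) \<le> (\<Sum>a\<in>A. \<Sum>b\<in>A. of_bool (a = b) * (w * (c a)\<^sup>2) - e * (\<bar>c a\<bar> * \<bar>c b\<bar>))"
    unfolding diag by simp
  also have "\<dots> \<le> (\<Sum>a\<in>A. \<Sum>b\<in>A. c a * c b * \<Gamma> a b)" by (intro sum_mono entry)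
  finally show ?thesis unfolding eq .
qed

section \<open>The game\<close>

text \<open>The squared norm of the sum of t_a X_a, expanded into Gram entries; the left side is
  what the entangled strategy computes.\<close>

lemma sum_pair_product_square:
  fixes X :: "'a \<Rightarrow> 'u \<Rightarrow> real"
  assumes fin: "finite J" "finite U"
  shows "(\<Sum>b\<in>(\<Pi>\<^sub>E j\<in>J. A). \<Sum>a\<in>(\<Pi>\<^sub>E j\<in>J. A). t b * t a * (\<Prod>j\<in>J. \<Sum>u\<in>U. X (a j) u * X (b j) u))
    = (\<Sum>u\<in>(\<Pi>\<^sub>E j\<in>J. U). (\<Sum>a\<in>(\<Pi>\<^sub>E j\<in>J. A). t a * (\<Prod>j\<in>J. X (a j) (u j)))\<^sup>2)"
proof -
  let ?A = "\<Pi>\<^sub>E j\<in>J. A" and ?U = "\<Pi>\<^sub>E j\<in>J. U"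
  let ?P = "\<lambda>a u. \<Prod>j\<in>J. X (a j) (u j)"
  have "(\<Prod>j\<in>J. \<Sum>u\<in>U. X (a j) u * X (b j) u) = (\<Sum>u\<in>?U. ?P a u * ?P b u)" for a b
  proof -
    have "(\<Prod>j\<in>J. \<Sum>u\<in>U. X (a j) u * X (b j) u) = (\<Sum>u\<in>?U. \<Prod>j\<in>J. X (a j) (u j) * X (b j) (u j))"
      by (rule prod_sum_PiE[where f = "\<lambda>j u. X (a j) u * X (b j) u"]) (use fin in auto)
    then show ?thesis by (simp only: prod.distrib)
  qed
  then have "(\<Sum>b\<in>?A. \<Sum>a\<in>?A. t b * t a * (\<Prod>j\<in>J. \<Sum>u\<in>U. X (a j) u * X (b j) u))
    = (\<Sum>b\<in>?A. \<Sum>a\<in>?A. \<Sum>u\<in>?U. (t b * ?P b u) * (t a * ?P a u))"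
    by (simp only: sum_distrib_left mult_ac)
  also have "\<dots> = (\<Sum>u\<in>?U. \<Sum>b\<in>?A. \<Sum>a\<in>?A. (t b * ?P b u) * (t a * ?P a u))"
    by (rule sum_rotate)
  finally show ?thesis by (simp only: power2_eq_square sum_product)
qed

text \<open>The random choices, frozen together with the properties they were selected for. Two
  blocks of size \<open>d\<close> fit into dimension \<open>D\<close>, and \<epsilon> bounds the
  injective norm of the coefficient tensor.\<close>

locale game_data =
  fixes k m d D :: nat
    and s :: "(nat \<times> nat) \<times> (nat \<times> nat) \<Rightarrow> real"
    and g g' :: "(nat \<Rightarrow> nat) \<Rightarrow> real" and \<epsilon> :: real
  fixes M A
  defines "M \<equiv> m\<^sup>2" and "A \<equiv> {..<m\<^sup>2} \<times> {..<m\<^sup>2}"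
  assumes k: "k \<ge> 1" and m: "m \<ge> 2" and d: "d \<ge> 1" and D: "2 * d \<le> D" "D \<le> 3 * d"
    and sq: "\<And>a u. a \<in> A \<Longrightarrow> u \<in> {..<d} \<times> {..<d} \<Longrightarrow> (s (a, u))\<^sup>2 = 1"
    and s3: "\<And>b x y. \<bar>\<Sum>a\<in>A. \<Sum>i<d. \<Sum>j<d. s (a, (i, j)) * (b a * (x i * y j))\<bar>
      \<le> 500 * sqrt (real d) * (L2_set b A * (L2_set x {..<d} * L2_set y {..<d}))"
    and s2: "\<And>x y. \<bar>\<Sum>p\<in>{..<M} \<times> {..<d}. \<Sum>q\<in>{..<M} \<times> {..<d}. s ((fst p, fst q), (snd p, snd q)) * (x p * y q)\<bar>
      \<le> 500 * (real m * sqrt (real d)) * (L2_set x ({..<M} \<times> {..<d}) * L2_set y ({..<M} \<times> {..<d}))"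
    and gram: "\<And>a b. a \<in> A \<Longrightarrow> b \<in> A \<Longrightarrow> a \<noteq> b \<Longrightarrow>
      \<bar>\<Sum>u\<in>{..<d} \<times> {..<d}. s (a, u) * s (b, u)\<bar> \<le> (real d)\<^sup>2 / (2 * real m ^ 4)"
    and g: "g \<in> signs (\<Pi>\<^sub>E j\<in>{..<k}. {..<M})" and g': "g' \<in> signs (\<Pi>\<^sub>E j\<in>{..<k}. {..<M})"
    and eps: "\<epsilon> \<ge> 0" "\<And>B. \<bar>mlf {..<k} (\<lambda>_. A) (pair_tensor {..<k} g g') B\<bar> \<le> \<epsilon> * (\<Prod>j<k. L2_set (B j) A)"
begin

definition t where "t = pair_tensor {..<k} g g'"

abbreviation "PA \<equiv> \<Pi>\<^sub>E j\<in>{..<k}. A"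
abbreviation "PM \<equiv> \<Pi>\<^sub>E j\<in>{..<k}. {..<M}"

definition X where "X a = sym_block (\<lambda>i. i) (\<lambda>j. d + j) {..<d} {..<d} (\<lambda>i j. s (a, (i, j)))"

definition H where "H f f' = (\<Sum>a\<in>PA. t a * (\<Prod>j<k. X (a j) (f j) (f' j)))"

lemma finA: "finite A" "A \<noteq> {}" and cardA: "real (card A) = real m ^ 4"
  using m by (auto simp: A_def lessThan_empty_iff card_cartesian_product power_add[symmetric]
      simp flip: of_nat_mult of_nat_power)

lemma inj: "inj_on (\<lambda>i::nat. i) {..<d}" "inj_on (\<lambda>j. d + j) {..<d}"
  and sub: "(\<lambda>i::nat. i) ` {..<d} \<subseteq> {..<D}" "(\<lambda>j. d + j) ` {..<d} \<subseteq> {..<D}"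
  and disj: "(\<lambda>i::nat. i) ` {..<d} \<inter> (\<lambda>j. d + j) ` {..<d} = {}"
  using D by (auto simp: inj_on_def)

lemma H_sym: "H f f' = H f' f"
  unfolding H_def X_def by (subst sym_block_commute) (rule refl)

lemma H_diag: "H f f = 0"
proof -
  have "X a i i = 0" for a i by (auto simp: X_def sym_block_def block_def)
  then show ?thesis using k by (auto simp: H_def intro!: sum.neutral exI[of _ 0] bexI[of _ 0])
qed

lemma quad_form_X:
  "quad_form {..<D} (X a) x = of_real (\<Sum>i<d. \<Sum>j<d.
    2 * (Re (x i) * Re (x (d + j)) + Im (x i) * Im (x (d + j))) * s (a, (i, j)))"
  unfolding X_def by (rule quad_form_sym_block[OF _ inj sub]) simp

text \<open>Self-testing: with coefficients B_a equal to the values themselves, the sum of B_a X_a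
  has value |B|^2 at \<open>x\<close>, while the trilinear norm bounds it by 500 sqrt d |B|
  |x|^2.\<close>

lemma L2_quad_form_X:
  "L2_set (\<lambda>a. Re (quad_form {..<D} (X a) x)) A \<le> 500 * sqrt (real d) * (\<Sum>i<D. (cmod (x i))\<^sup>2)"
proof -
  define B where "B = (\<lambda>a. Re (quad_form {..<D} (X a) x))"
  define \<kappa> where "\<kappa> = 500 * sqrt (real d) * L2_set B A"
  have "cmod (quad_form {..<D} (sym_block (\<lambda>i. i) (\<lambda>j. d + j) {..<d} {..<d} (\<lambda>i j. \<Sum>a\<in>A. B a * s (a, (i, j)))) x)
    \<le> \<kappa> * (\<Sum>i<D. (cmod (x i))\<^sup>2)"
  proof (rule quad_form_sym_block_le[OF _ inj sub disj])
    show "\<bar>\<Sum>i<d. \<Sum>j<d. (\<Sum>a\<in>A. B a * s (a, (i, j))) * (y i * z j)\<bar> \<le> \<kappa> * (L2_set y {..<d} * L2_set z {..<d})" for y z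
    proof -
      have "(\<Sum>i<d. \<Sum>j<d. (\<Sum>a\<in>A. B a * s (a, (i, j))) * (y i * z j))
        = (\<Sum>i<d. \<Sum>j<d. \<Sum>a\<in>A. s (a, (i, j)) * (B a * (y i * z j)))"
        unfolding sum_distrib_right by (intro sum.cong refl) (simp only: mult_ac)
      also have "\<dots> = (\<Sum>a\<in>A. \<Sum>i<d. \<Sum>j<d. s (a, (i, j)) * (B a * (y i * z j)))"
    by (rule sum_rotate)
      finally show ?thesis using s3[where b=B and x=y and y=z] by (simp only: \<kappa>_def mult.assoc)
    qed
  qed (auto simp: \<kappa>_def)
  moreover have "quad_form {..<D} (sym_block (\<lambda>i. i) (\<lambda>j. d + j) {..<d} {..<d} (\<lambda>i j. \<Sum>a\<in>A. B a * s (a, (i, j)))) x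
    = of_real ((L2_set B A)\<^sup>2)"
  proof -
    have "(\<Sum>i<d. \<Sum>j<d. 2 * (Re (x i) * Re (x (d + j)) + Im (x i) * Im (x (d + j))) * (\<Sum>a\<in>A. B a * s (a, (i, j))))
      = (\<Sum>i<d. \<Sum>j<d. \<Sum>a\<in>A. B a * (2 * (Re (x i) * Re (x (d + j)) + Im (x i) * Im (x (d + j))) * s (a, (i, j))))"
      unfolding sum_distrib_left by (intro sum.cong refl) (simp only: mult_ac)
    also have "\<dots> = (\<Sum>a\<in>A. \<Sum>i<d. \<Sum>j<d. B a * (2 * (Re (x i) * Re (x (d + j)) + Im (x i) * Im (x (d + j))) * s (a, (i, j))))"
    by (rule sum_rotate)
    also have "\<dots> = (\<Sum>a\<in>A. B a * B a)"
      unfolding sum_distrib_left[symmetric] by (simp only: B_def quad_form_X Re_complex_of_real)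
    also have "\<dots> = (L2_set B A)\<^sup>2" by (simp only: L2_set_power2) (simp only: power2_eq_square)
    finally show ?thesis
      by (subst quad_form_sym_block[OF _ inj sub]) simp_all
  qed
  ultimately have "(L2_set B A)\<^sup>2 \<le> \<kappa> * (\<Sum>i<D. (cmod (x i))\<^sup>2)" by (simp only: norm_of_real)
  then have "L2_set B A * L2_set B A \<le> (500 * sqrt (real d) * (\<Sum>i<D. (cmod (x i))\<^sup>2)) * L2_set B A"
    by (simp only: \<kappa>_def power2_eq_square mult_ac)
  moreover have "500 * sqrt (real d) * (\<Sum>i<D. (cmod (x i))\<^sup>2) \<ge> 0" by (intro mult_nonneg_nonneg sum_nonneg) auto
  ultimately have "L2_set B A \<le> 500 * sqrt (real d) * (\<Sum>i<D. (cmod (x i))\<^sup>2)"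
    by (cases "L2_set B A = 0") (simp_all add: order_less_le)
  then show ?thesis by (simp only: B_def)
qed

text \<open>On a product vector the form of \<open>H\<close> factors slot by slot and becomes the
  multilinear form of \<open>t\<close> at the vectors of values of the X_a, to which \<epsilon>
  applies.\<close>

lemma product_form_le:
  fixes x :: "nat \<Rightarrow> nat \<Rightarrow> complex"
  shows "cmod (\<Sum>f\<in>multi k (\<lambda>_. D). \<Sum>f'\<in>multi k (\<lambda>_. D).
      cnj (\<Prod>j<k. x j (f j)) * of_real (H f f') * (\<Prod>j<k. x j (f' j)))
    \<le> \<epsilon> * (500 * sqrt (real d)) ^ k * (\<Prod>j<k. \<Sum>i<D. (cmod (x j i))\<^sup>2)"
proof -
  let ?D = "multi k (\<lambda>_. D)"
  define B where "B j a = Re (quad_form {..<D} (X a) (x j))" for j a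
  have B: "quad_form {..<D} (X a) (x j) = of_real (B j a)" for j a
    by (simp add: B_def quad_form_X del: of_real_sum)
  have "(\<Sum>f\<in>?D. \<Sum>f'\<in>?D. cnj (\<Prod>j<k. x j (f j)) * of_real (H f f') * (\<Prod>j<k. x j (f' j)))
    = (\<Sum>f\<in>?D. \<Sum>f'\<in>?D. \<Sum>a\<in>PA. of_real (t a) * (\<Prod>j<k. cnj (x j (f j)) * of_real (X (a j) (f j) (f' j)) * x j (f' j)))"
    by (intro sum.cong refl)
       (simp add: H_def cnj_prod prod.distrib sum_distrib_left sum_distrib_right mult_ac)
  also have "\<dots> = (\<Sum>a\<in>PA. \<Sum>f\<in>?D. \<Sum>f'\<in>?D. of_real (t a) * (\<Prod>j<k. cnj (x j (f j)) * of_real (X (a j) (f j) (f' j)) * x j (f' j)))"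
    by (rule sum_rotate)
  also have "\<dots> = (\<Sum>a\<in>PA. of_real (t a) * (\<Prod>j<k. quad_form {..<D} (X (a j)) (x j)))"
  proof (rule sum.cong[OF refl])
    fix a
    have "(\<Sum>f\<in>?D. \<Sum>f'\<in>?D. \<Prod>j<k. cnj (x j (f j)) * of_real (X (a j) (f j) (f' j)) * x j (f' j))
      = (\<Prod>j<k. quad_form {..<D} (X (a j)) (x j))"
      unfolding quad_form_def
      by (rule sum_multi_pairs[where \<phi> = "\<lambda>j i i'. cnj (x j i) * of_real (X (a j) i i') * x j i'"])
    then show "(\<Sum>f\<in>?D. \<Sum>f'\<in>?D. of_real (t a) * (\<Prod>j<k. cnj (x j (f j)) * of_real (X (a j) (f j) (f' j)) * x j (f' j)))
      = of_real (t a) * (\<Prod>j<k. quad_form {..<D} (X (a j)) (x j))"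
      by (simp only: sum_distrib_left[symmetric])
  qed
  also have "\<dots> = of_real (mlf {..<k} (\<lambda>_. A) t B)"
    by (simp only: B mlf_def of_real_sum of_real_mult of_real_prod)
  finally have "cmod (\<Sum>f\<in>?D. \<Sum>f'\<in>?D. cnj (\<Prod>j<k. x j (f j)) * of_real (H f f') * (\<Prod>j<k. x j (f' j)))
    = \<bar>mlf {..<k} (\<lambda>_. A) t B\<bar>" by (simp only: norm_of_real)
  also have "\<dots> \<le> \<epsilon> * (\<Prod>j<k. L2_set (B j) A)" unfolding t_def by (rule eps)
  also have "\<dots> \<le> \<epsilon> * (\<Prod>j<k. 500 * sqrt (real d) * (\<Sum>i<D. (cmod (x j i))\<^sup>2))"
    using eps(1) L2_quad_form_X unfolding B_def by (intro mult_left_mono prod_mono) auto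
  finally show ?thesis by (simp only: prod.distrib prod_constant card_lessThan power_mult_distrib mult.assoc)
qed

section \<open>The observable and the shared state\<close>

definition local_basis where "local_basis = {..<D} \<times> {..<2 * M}"

text \<open>The sum over p, q of the sign block with index (p, q), tensored with the matrix unit at
  (p, M + q), plus the transpose. The auxiliary space has one half for p and one for q because the
  state is a direct sum.\<close>

definition R where "R = sym_block (\<lambda>(u, i). (i, u)) (\<lambda>(v, j). (d + j, M + v)) ({..<M} \<times> {..<d}) ({..<M} \<times> {..<d})
  (\<lambda>p q. s ((fst p, fst q), (snd p, snd q)))"

definition \<kappa> where "\<kappa> = 500 * (real m * sqrt (real d))"

lemma kappa_pos: "\<kappa> > 0" using m d by (simp add: \<kappa>_def)

lemma quad_form_R: "cmod (quad_form local_basis R v) \<le> \<kappa> * (\<Sum>x\<in>local_basis. (cmod (v x))\<^sup>2)"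
  unfolding R_def
proof (rule quad_form_sym_block_le)
  show "\<bar>\<Sum>p\<in>{..<M} \<times> {..<d}. \<Sum>q\<in>{..<M} \<times> {..<d}. s ((fst p, fst q), (snd p, snd q)) * (x p * y q)\<bar>
      \<le> \<kappa> * (L2_set x ({..<M} \<times> {..<d}) * L2_set y ({..<M} \<times> {..<d}))" for x y
    unfolding \<kappa>_def by (rule s2)
qed (use D kappa_pos in \<open>auto simp: local_basis_def inj_on_def\<close>)

text \<open>The POVM whose observable is R / \<kappa>.\<close>

definition E where "E (b :: int) = (\<lambda>x y. complex_of_real (1 / (2 * \<kappa>) * (\<kappa> * of_bool (x = y) + of_int b * R x y)))"

lemma povm_E: "povm local_basis E"
  unfolding povm_def
proof
  show "\<forall>a\<in>{-1, 1}. psd local_basis (E a)"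
  proof
    fix a :: int assume a: "a \<in> {-1, 1}"
    show "psd local_basis (E a)"
      unfolding E_def
    proof (rule psd_identity_plus)
      show "R x y = R y x" for x y unfolding R_def by (rule sym_block_commute)
    qed (use a quad_form_R kappa_pos in \<open>auto simp: local_basis_def\<close>)
  qed
  have "E (-1) x y + E 1 x y = op_id x y" for x y
  proof -
    have "E (-1) x y + E 1 x y = of_real (1 / (2 * \<kappa>) * (\<kappa> * of_bool (x = y) - R x y)
        + 1 / (2 * \<kappa>) * (\<kappa> * of_bool (x = y) + R x y))"
      by (simp add: E_def)
    also have "1 / (2 * \<kappa>) * (\<kappa> * of_bool (x = y) - R x y) + 1 / (2 * \<kappa>) * (\<kappa> * of_bool (x = y) + R x y) = of_bool (x = y)"
      using kappa_pos by (simp add: field_simps)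
    finally show ?thesis by (simp add: op_id_def)
  qed
  then show "op_eq_on local_basis (\<lambda>i j. \<Sum>a\<in>{-1, 1}. E a i j) op_id"
    by (simp add: op_eq_on_def)
qed

lemma E_diff: "E 1 x y - E (-1) x y = of_real (R x y / \<kappa>)"
proof -
  have "E 1 x y - E (-1) x y = of_real (1 / (2 * \<kappa>) * (\<kappa> * of_bool (x = y) + R x y)
      - 1 / (2 * \<kappa>) * (\<kappa> * of_bool (x = y) - R x y))"
    by (simp add: E_def)
  also have "1 / (2 * \<kappa>) * (\<kappa> * of_bool (x = y) + R x y) - 1 / (2 * \<kappa>) * (\<kappa> * of_bool (x = y) - R x y) = R x y / \<kappa>"
    using kappa_pos by (simp add: field_simps)
  finally show ?thesis .
qed

definition shift where "shift q = (\<lambda>j\<in>{..<k}. M + q j)"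

text \<open>The normalised direct sum of \<open>g\<close> and \<open>g'\<close>: \<open>g\<close> on
  the tuples with all entries in the first half, \<open>g'\<close> on those with all entries in the
  second. Each sign vector has squared norm M^k.\<close>

definition \<phi> where "\<phi> f = (1 / sqrt (2 * real M ^ k)) *
  ((\<Sum>p\<in>PM. g p * of_bool (f = p)) + (\<Sum>q\<in>PM. g' q * of_bool (f = shift q)))"

abbreviation "MM \<equiv> multi k (\<lambda>_. 2 * M)"

lemma finPM: "finite PM" by (intro finite_PiE) auto

lemma PM_sub: "p \<in> PM \<Longrightarrow> p \<in> MM" "q \<in> PM \<Longrightarrow> shift q \<in> MM"
proof -
  show "p \<in> PM \<Longrightarrow> p \<in> MM" unfolding multi_def by (rule subsetD[OF PiE_mono]) auto
  show "shift q \<in> MM" if "q \<in> PM"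
    unfolding multi_def shift_def by (rule PiE_I) (use PiE_mem[OF that] in auto)
qed

lemma sum_phi:
  "(\<Sum>f\<in>MM. \<phi> f * \<psi> f) = (1 / sqrt (2 * real M ^ k)) *
    ((\<Sum>p\<in>PM. g p * \<psi> p) + (\<Sum>q\<in>PM. g' q * \<psi> (shift q)))"
proof -
  have one: "(\<Sum>f\<in>MM. (\<Sum>p\<in>PM. h p * of_bool (f = e p)) * \<psi> f) = (\<Sum>p\<in>PM. h p * \<psi> (e p))"
    if "\<And>p. p \<in> PM \<Longrightarrow> e p \<in> MM" for h e
  proof -
    have "(\<Sum>f\<in>MM. (\<Sum>p\<in>PM. h p * of_bool (f = e p)) * \<psi> f)
      = (\<Sum>p\<in>PM. \<Sum>f\<in>MM. h p * of_bool (f = e p) * \<psi> f)"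
      unfolding sum_distrib_right by (rule sum.swap)
    also have "\<dots> = (\<Sum>p\<in>PM. \<Sum>f\<in>MM. if f = e p then h p * \<psi> (e p) else 0)"
      by (intro sum.cong refl) auto
    also have "\<dots> = (\<Sum>p\<in>PM. h p * \<psi> (e p))"
      by (intro sum.cong refl) (simp add: finite_multi that)
    finally show ?thesis .
  qed
  define a where "a f = (\<Sum>p\<in>PM. g p * of_bool (f = p))" for f
  define b where "b f = (\<Sum>q\<in>PM. g' q * of_bool (f = shift q))" for f
  have "\<phi> f * \<psi> f = (1 / sqrt (2 * real M ^ k)) * (a f * \<psi> f + b f * \<psi> f)" for f
    unfolding \<phi>_def a_def[symmetric] b_def[symmetric] by (simp only: ring_distribs mult.assoc)
  then have "(\<Sum>f\<in>MM. \<phi> f * \<psi> f) = (1 / sqrt (2 * real M ^ k)) * ((\<Sum>f\<in>MM. a f * \<psi> f) + (\<Sum>f\<in>MM. b f * \<psi> f))"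
    by (simp only: sum_distrib_left[symmetric] sum.distrib)
  moreover have "(\<Sum>f\<in>MM. a f * \<psi> f) = (\<Sum>p\<in>PM. g p * \<psi> p)"
    unfolding a_def by (rule one) (rule PM_sub)
  moreover have "(\<Sum>f\<in>MM. b f * \<psi> f) = (\<Sum>q\<in>PM. g' q * \<psi> (shift q))"
    unfolding b_def by (rule one) (rule PM_sub)
  ultimately show ?thesis by (simp only:)
qed

lemma shift_inj: "q \<in> PM \<Longrightarrow> q' \<in> PM \<Longrightarrow> shift q = shift q' \<Longrightarrow> q = q'"
proof (rule PiE_ext[of q "{..<k}" "\<lambda>_. {..<M}" q'])
  fix j assume eq: "shift q = shift q'" and j: "j \<in> {..<k}"
  show "q j = q' j" using fun_cong[OF eq, of j] j by (simp add: shift_def)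
qed

lemma shift_neq: "p \<in> PM \<Longrightarrow> shift q \<noteq> p"
proof
  assume p: "p \<in> PM" "shift q = p"
  have "shift q 0 = M + q 0" using k by (simp add: shift_def)
  moreover have "p 0 < M" using PiE_mem[OF p(1), of 0] k by simp
  ultimately show False using p(2) by simp
qed

lemma phi_values:
  "p \<in> PM \<Longrightarrow> \<phi> p = (1 / sqrt (2 * real M ^ k)) * g p"
  "q \<in> PM \<Longrightarrow> \<phi> (shift q) = (1 / sqrt (2 * real M ^ k)) * g' q"
proof -
  assume p: "p \<in> PM"
  have "(\<Sum>p'\<in>PM. g p' * of_bool (p = p')) = (\<Sum>p'\<in>PM. if p' = p then g p else 0)"
    by (intro sum.cong) auto
  moreover have "(\<Sum>q\<in>PM. g' q * of_bool (p = shift q)) = 0"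
    using shift_neq[OF p] by (intro sum.neutral) auto
  ultimately show "\<phi> p = (1 / sqrt (2 * real M ^ k)) * g p"
    using p finPM by (simp add: \<phi>_def)
next
  assume q: "q \<in> PM"
  have "(\<Sum>q'\<in>PM. g' q' * of_bool (shift q = shift q')) = (\<Sum>q'\<in>PM. if q' = q then g' q else 0)"
    using shift_inj q by (intro sum.cong) auto
  moreover have "(\<Sum>p\<in>PM. g p * of_bool (shift q = p)) = 0"
    using shift_neq by (intro sum.neutral) auto
  ultimately show "\<phi> (shift q) = (1 / sqrt (2 * real M ^ k)) * g' q"
    using q finPM by (simp add: \<phi>_def)
qed

lemma card_PM: "real (card PM) = real M ^ k" by (simp add: card_PiE)

lemma M_pos: "real M > 0" using m by (simp add: M_def)

lemma normalization: "(1 / sqrt (2 * real M ^ k)) * (1 / sqrt (2 * real M ^ k)) = 1 / (2 * real M ^ k)"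
  using M_pos by simp

lemma phi_norm: "(\<Sum>f\<in>MM. \<phi> f * \<phi> f) = 1"
proof -
  let ?c = "1 / sqrt (2 * real M ^ k)"
  have sqs: "(\<Sum>p\<in>PM. h p * h p) = real M ^ k" if "h \<in> signs PM" for h
  proof -
    have "(\<Sum>p\<in>PM. h p * h p) = (\<Sum>p\<in>PM. 1)"
      using signs_power2[OF that] by (intro sum.cong) (simp_all add: power2_eq_square)
    then show ?thesis using card_PM by simp
  qed
  have "(\<Sum>p\<in>PM. g p * \<phi> p) = ?c * (\<Sum>p\<in>PM. g p * g p)"
    unfolding sum_distrib_left by (intro sum.cong refl) (simp add: phi_values)
  moreover have "(\<Sum>q\<in>PM. g' q * \<phi> (shift q)) = ?c * (\<Sum>p\<in>PM. g' p * g' p)"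
    unfolding sum_distrib_left by (intro sum.cong refl) (simp add: phi_values)
  ultimately have "(\<Sum>f\<in>MM. \<phi> f * \<phi> f) = (?c * ?c) * (2 * real M ^ k)"
    unfolding sum_phi using sqs[OF g] sqs[OF g'] by (simp add: algebra_simps)
  then show ?thesis unfolding normalization using M_pos by simp
qed

lemma qstate_phi: "qstate MM (\<lambda>f f'. of_real (\<phi> f * \<phi> f'))"
proof -
  have "psd MM (\<lambda>f f'. of_real (\<phi> f * \<phi> f'))"
    by (rule psd_of_sum_rank_one[of "{0 :: nat}" _ _ "\<lambda>_ f. of_real (\<phi> f)"]) auto
  moreover have "op_trace MM (\<lambda>f f'. of_real (\<phi> f * \<phi> f')) = of_real (\<Sum>f\<in>MM. \<phi> f * \<phi> f)"
    unfolding op_trace_def of_real_sum ..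
  ultimately show ?thesis by (simp only: qstate_def phi_norm of_real_1)
qed

section \<open>Value of the entangled strategy\<close>

definition \<Gamma> where "\<Gamma> a b = (\<Sum>u\<in>{..<d} \<times> {..<d}. s (a, u) * s (b, u))"

text \<open>The contribution of one player: the trace over the player's own space of X_a against the
  block of \<open>R\<close> with auxiliary indices u, v.\<close>

definition Z where "Z a u v = (\<Sum>i<D. \<Sum>i'<D. R (i, u) (i', v) * X a i' i)"

lemma R_value:
  assumes "i < d" "j < d" "v < 2 * M"
  shows "R (i, u) (d + j, v) = (if u < M \<and> M \<le> v then s ((u, v - M), (i, j)) else 0)"
proof -
  let ?\<alpha> = "\<lambda>(u, i). (i :: nat, u :: nat)" and ?\<beta> = "\<lambda>(v, j). (d + j, M + v)"
  let ?P = "{..<M} \<times> {..<d}"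
  have zero: "block ?\<alpha> ?\<beta> ?P ?P S (d + j, v) (i, u) = 0" for S
    by (auto simp: block_def)
  have injs: "inj_on ?\<alpha> ?P" "inj_on ?\<beta> ?P" by (auto simp: inj_on_def)
  show ?thesis
  proof (cases "u < M \<and> M \<le> v")
    case True
    then have "block ?\<alpha> ?\<beta> ?P ?P S (?\<alpha> (u, i)) (?\<beta> (v - M, j)) = S (u, i) (v - M, j)" for S
      using assms by (intro block_image injs) auto
    then show ?thesis using True unfolding R_def sym_block_def zero by simp
  next
    case False
    then have "(i, u) \<notin> ?\<alpha> ` ?P \<or> (d + j, v) \<notin> ?\<beta> ` ?P" by auto
    then have "block ?\<alpha> ?\<beta> ?P ?P S (i, u) (d + j, v) = 0" for S by (auto simp: block_def)
    then show ?thesis using False by (auto simp: R_def sym_block_def zero)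
  qed
qed

text \<open>Each of the two blocks of \<open>R\<close> meets one block of X_a, and the trace is a
  Gram entry of the sign matrices.\<close>

lemma Z_value:
  assumes "u < 2 * M" "v < 2 * M"
  shows "Z a u v = (if u < M \<and> M \<le> v then \<Gamma> a (u, v - M) else 0) + (if v < M \<and> M \<le> u then \<Gamma> a (v, u - M) else 0)"
proof -
  have "Z a u v = (\<Sum>i'<D. \<Sum>i<D. R (i, u) (i', v) * of_real (X a i' i))"
    unfolding Z_def by (subst sum.swap) simp
  also have "\<dots> = (\<Sum>i<d. \<Sum>j<d. (R (d + j, u) (i, v) + R (i, u) (d + j, v)) * of_real (s (a, (i, j))))"
    unfolding X_def by (rule sum_sym_block[OF _ inj sub, where \<phi> = "\<lambda>i' i. R (i, u) (i', v)"]) simp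
  also have "\<dots> = (\<Sum>i<d. \<Sum>j<d. (if u < M \<and> M \<le> v then s (a, (i, j)) * s ((u, v - M), (i, j)) else 0)
      + (if v < M \<and> M \<le> u then s (a, (i, j)) * s ((v, u - M), (i, j)) else 0))"
  proof (intro sum.cong refl)
    fix i j assume "i \<in> {..<d}" "j \<in> {..<d}"
    moreover have "R (d + j, u) (i, v) = R (i, v) (d + j, u)" unfolding R_def by (rule sym_block_commute)
    ultimately show "(R (d + j, u) (i, v) + R (i, u) (d + j, v)) * of_real (s (a, (i, j)))
      = (if u < M \<and> M \<le> v then s (a, (i, j)) * s ((u, v - M), (i, j)) else 0)
      + (if v < M \<and> M \<le> u then s (a, (i, j)) * s ((v, u - M), (i, j)) else 0)"
      using assms by (auto simp: R_value)
  qed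
  also have "\<dots> = (if u < M \<and> M \<le> v then \<Gamma> a (u, v - M) else 0) + (if v < M \<and> M \<le> u then \<Gamma> a (v, u - M) else 0)"
    by (auto simp: \<Gamma>_def sum_Times sum.distrib)
  finally show ?thesis .
qed

definition W where "W f f' = (\<Sum>a\<in>PA. t a * (\<Prod>j<k. Z (a j) (f j) (f' j)))"

lemma W_zero:
  assumes "\<And>a. Z a (f 0) (f' 0) = 0"
  shows "W f f' = 0"
proof -
  have "(\<Prod>j<k. Z (a j) (f j) (f' j)) = 0" for a
    by (rule prod_zero[OF finite_lessThan], rule bexI[of _ 0], rule assms) (use k in simp)
  then show ?thesis by (simp only: W_def mult_zero_right sum.neutral_const)
qed

lemma W_value:
  assumes p: "p \<in> PM" and q: "q \<in> PM"
  shows "W p (shift q) = (\<Sum>a\<in>PA. t a * (\<Prod>j<k. \<Gamma> (a j) (p j, q j)))"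
    and "W (shift q) p = (\<Sum>a\<in>PA. t a * (\<Prod>j<k. \<Gamma> (a j) (p j, q j)))"
proof -
  have lt: "p j < M" "q j < M" "shift q j = M + q j" if "j < k" for j
    using PiE_mem[OF p, of j] PiE_mem[OF q, of j] that by (auto simp: shift_def)
  have "Z a (p j) (shift q j) = \<Gamma> a (p j, q j)" "Z a (shift q j) (p j) = \<Gamma> a (p j, q j)" if "j < k" for a j
    using lt[OF that] by (simp_all add: Z_value)
  then show "W p (shift q) = (\<Sum>a\<in>PA. t a * (\<Prod>j<k. \<Gamma> (a j) (p j, q j)))"
    "W (shift q) p = (\<Sum>a\<in>PA. t a * (\<Prod>j<k. \<Gamma> (a j) (p j, q j)))"
    unfolding W_def by simp_all
qed

text \<open>\<open>R\<close> vanishes between auxiliary indices from the same half, so slot 0 alone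
  makes the product zero.\<close>

lemma W_diag: "p \<in> PM \<Longrightarrow> p' \<in> PM \<Longrightarrow> W p p' = 0" "q \<in> PM \<Longrightarrow> q' \<in> PM \<Longrightarrow> W (shift q) (shift q') = 0"
proof -
  have lt: "p 0 < M" if "p \<in> PM" for p using PiE_mem[OF that, of 0] k by simp
  show "W p p' = 0" if "p \<in> PM" "p' \<in> PM"
    by (rule W_zero) (use lt[OF that(1)] lt[OF that(2)] in \<open>simp add: Z_value\<close>)
  have shift0: "shift q 0 = M + q 0" for q using k by (simp add: shift_def)
  show "W (shift q) (shift q') = 0" if "q \<in> PM" "q' \<in> PM"
    by (rule W_zero) (use lt[OF that(1)] lt[OF that(2)] in \<open>simp add: Z_value shift0\<close>)
qed

text \<open>Only the cross terms between \<open>g\<close> and \<open>g'\<close> survive; there are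
  two equal ones, which cancels the 2 in the normalisation. The signs g_p g'_q recombine to t_b, so
  that the value becomes a squared norm.\<close>

lemma sum_W: "(\<Sum>f\<in>MM. \<Sum>f'\<in>MM. \<phi> f * \<phi> f' * W f f')
  = 1 / real M ^ k * (\<Sum>u\<in>(\<Pi>\<^sub>E j\<in>{..<k}. {..<d} \<times> {..<d}). (\<Sum>a\<in>PA. t a * (\<Prod>j<k. s (a j, u j)))\<^sup>2)"
proof -
  let ?c = "1 / sqrt (2 * real M ^ k)"
  define T where "T p q = (\<Sum>a\<in>PA. t a * (\<Prod>j<k. \<Gamma> (a j) (p j, q j)))" for p q
  have inner: "(\<Sum>f'\<in>MM. \<phi> f' * W f f') = ?c * ((\<Sum>p\<in>PM. g p * W f p) + (\<Sum>q\<in>PM. g' q * W f (shift q)))" for f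
    by (rule sum_phi)
  have in1: "(\<Sum>f'\<in>MM. \<phi> f' * W p f') = ?c * (\<Sum>q\<in>PM. g' q * T p q)" if "p \<in> PM" for p
    unfolding inner T_def using that by (simp add: W_diag W_value cong: sum.cong)
  have in2: "(\<Sum>f'\<in>MM. \<phi> f' * W (shift q) f') = ?c * (\<Sum>p\<in>PM. g p * T p q)" if "q \<in> PM" for q
    unfolding inner T_def using that by (simp add: W_diag W_value cong: sum.cong)
  have "(\<Sum>f\<in>MM. \<Sum>f'\<in>MM. \<phi> f * \<phi> f' * W f f') = (\<Sum>f\<in>MM. \<phi> f * (\<Sum>f'\<in>MM. \<phi> f' * W f f'))"
    by (simp only: sum_distrib_left mult.assoc)
  also have "\<dots> = ?c * ((\<Sum>p\<in>PM. g p * (\<Sum>f'\<in>MM. \<phi> f' * W p f')) + (\<Sum>q\<in>PM. g' q * (\<Sum>f'\<in>MM. \<phi> f' * W (shift q) f')))"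
    by (rule sum_phi)
  also have "(\<Sum>p\<in>PM. g p * (\<Sum>f'\<in>MM. \<phi> f' * W p f')) = ?c * (\<Sum>p\<in>PM. \<Sum>q\<in>PM. g p * g' q * T p q)"
  proof -
    have "(\<Sum>p\<in>PM. g p * (\<Sum>f'\<in>MM. \<phi> f' * W p f')) = (\<Sum>p\<in>PM. g p * (?c * (\<Sum>q\<in>PM. g' q * T p q)))"
      by (intro sum.cong refl) (simp only: in1)
    then show ?thesis by (simp only: sum_distrib_left mult_ac)
  qed
  also have "(\<Sum>q\<in>PM. g' q * (\<Sum>f'\<in>MM. \<phi> f' * W (shift q) f')) = ?c * (\<Sum>q\<in>PM. \<Sum>p\<in>PM. g p * g' q * T p q)"
  proof -
    have "(\<Sum>q\<in>PM. g' q * (\<Sum>f'\<in>MM. \<phi> f' * W (shift q) f')) = (\<Sum>q\<in>PM. g' q * (?c * (\<Sum>p\<in>PM. g p * T p q)))"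
      by (intro sum.cong refl) (simp only: in2)
    then show ?thesis by (simp only: sum_distrib_left mult_ac)
  qed
  also have "(\<Sum>q\<in>PM. \<Sum>p\<in>PM. g p * g' q * T p q) = (\<Sum>p\<in>PM. \<Sum>q\<in>PM. g p * g' q * T p q)" by (rule sum.swap)
  also have "?c * (?c * Y + ?c * Y) = (?c * ?c) * (2 * Y)" for Y by (simp only: ring_distribs mult_ac mult_2)
  also have "(?c * ?c) * (2 * (\<Sum>p\<in>PM. \<Sum>q\<in>PM. g p * g' q * T p q)) = 1 / real M ^ k * (\<Sum>p\<in>PM. \<Sum>q\<in>PM. g p * g' q * T p q)"
    unfolding normalization by simp
  also have "(\<Sum>p\<in>PM. \<Sum>q\<in>PM. g p * g' q * T p q) = (\<Sum>b\<in>PA. t b * (\<Sum>a\<in>PA. t a * (\<Prod>j<k. \<Gamma> (a j) (b j))))"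
  proof -
    have "(\<Sum>b\<in>PA. t b * (\<Sum>a\<in>PA. t a * (\<Prod>j<k. \<Gamma> (a j) (b j))))
      = (\<Sum>p\<in>PM. \<Sum>q\<in>PM. t (\<lambda>j\<in>{..<k}. (p j, q j)) * (\<Sum>a\<in>PA. t a * (\<Prod>j<k. \<Gamma> (a j) ((\<lambda>j\<in>{..<k}. (p j, q j)) j))))"
      unfolding A_def M_def by (rule sum_PiE_pairs)
    also have "\<dots> = (\<Sum>p\<in>PM. \<Sum>q\<in>PM. g p * g' q * T p q)"
    proof (intro sum.cong refl)
      fix p q assume "p \<in> PM" "q \<in> PM"
      then have "(\<lambda>j\<in>{..<k}. fst ((\<lambda>j\<in>{..<k}. (p j, q j)) j)) = p" "(\<lambda>j\<in>{..<k}. snd ((\<lambda>j\<in>{..<k}. (p j, q j)) j)) = q"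
        by (auto simp: fun_eq_iff PiE_iff extensional_def)
      then show "t (\<lambda>j\<in>{..<k}. (p j, q j)) * (\<Sum>a\<in>PA. t a * (\<Prod>j<k. \<Gamma> (a j) ((\<lambda>j\<in>{..<k}. (p j, q j)) j)))
        = g p * g' q * T p q"
        by (simp add: t_def pair_tensor_def T_def)
    qed
    finally show ?thesis ..
  qed
  also have "\<dots> = (\<Sum>b\<in>PA. \<Sum>a\<in>PA. t b * t a * (\<Prod>j<k. \<Sum>u\<in>{..<d} \<times> {..<d}. s (a j, u) * s (b j, u)))"
    by (simp only: sum_distrib_left \<Gamma>_def mult.assoc)
  also have "\<dots> = (\<Sum>u\<in>(\<Pi>\<^sub>E j\<in>{..<k}. {..<d} \<times> {..<d}). (\<Sum>a\<in>PA. t a * (\<Prod>j<k. s (a j, u j)))\<^sup>2)"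
    by (rule sum_pair_product_square[where X = "\<lambda>a u. s (a, u)"]) auto
  finally show ?thesis .
qed

text \<open>All entries of \<open>t\<close> are signs, so its squared norm is M^(2k); one factor M^k
  goes to the normalisation of the state.\<close>

lemma sum_W_ge: "((real d)\<^sup>2 / 2) ^ k * real M ^ k \<le> (\<Sum>f\<in>MM. \<Sum>f'\<in>MM. \<phi> f * \<phi> f' * W f f')"
proof -
  have "(real d)\<^sup>2 / 2 * (\<Sum>a\<in>A. (b a)\<^sup>2) \<le> (\<Sum>u\<in>{..<d} \<times> {..<d}. (\<Sum>a\<in>A. b a * s (a, u))\<^sup>2)" for b
  proof (rule almost_orthogonal_lower_bound[OF finA])
    show "(\<Sum>u\<in>{..<d} \<times> {..<d}. s (a, u) * s (a, u)) = (real d)\<^sup>2" if "a \<in> A" for a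
    proof -
      have "(\<Sum>u\<in>{..<d} \<times> {..<d}. s (a, u) * s (a, u)) = (\<Sum>u\<in>{..<d} \<times> {..<d}. 1)"
        using sq[OF that] by (intro sum.cong refl) (simp add: power2_eq_square)
      then show ?thesis by (simp add: card_cartesian_product power2_eq_square)
    qed
    show "\<bar>\<Sum>u\<in>{..<d} \<times> {..<d}. s (a, u) * s (b, u)\<bar> \<le> (real d)\<^sup>2 / (2 * real (card A))"
      if "a \<in> A" "b \<in> A" "a \<noteq> b" for a b
      unfolding cardA by (rule gram[OF that])
  qed simp
  then have "((real d)\<^sup>2 / 2) ^ card {..<k} * (\<Sum>a\<in>PA. (t a)\<^sup>2)
    \<le> (\<Sum>u\<in>(\<Pi>\<^sub>E j\<in>{..<k}. {..<d} \<times> {..<d}). (\<Sum>a\<in>PA. t a * (\<Prod>j<k. s (a j, u j)))\<^sup>2)"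
    by (intro tensor_lower_bound[where X = "\<lambda>a u. s (a, u)"]) auto
  moreover have "(\<Sum>a\<in>PA. (t a)\<^sup>2) = real M ^ k * real M ^ k"
  proof -
    have "(t a)\<^sup>2 = 1" if "a \<in> PA" for a
    proof -
      have "(\<lambda>j\<in>{..<k}. fst (a j)) \<in> PM" "(\<lambda>j\<in>{..<k}. snd (a j)) \<in> PM"
        using that by (auto simp: A_def M_def PiE_iff mem_Times_iff)
      then show ?thesis using signs_power2[OF g] signs_power2[OF g']
        by (simp add: t_def pair_tensor_def power_mult_distrib)
    qed
    then have "(\<Sum>a\<in>PA. (t a)\<^sup>2) = real (card PA)" by simp
    moreover have "card PA = (M * M) ^ k" by (simp add: card_PiE A_def M_def card_cartesian_product)
    ultimately show ?thesis by (simp only: of_nat_power of_nat_mult power_mult_distrib)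
  qed
  ultimately have "1 / real M ^ k * (((real d)\<^sup>2 / 2) ^ k * (real M ^ k * real M ^ k)) \<le> (\<Sum>f\<in>MM. \<Sum>f'\<in>MM. \<phi> f * \<phi> f' * W f f')"
    unfolding sum_W by (intro mult_left_mono) auto
  then show ?thesis using M_pos by (simp add: field_simps)
qed

text \<open>Exchange of sums: those over the players' own indices factor over the slots into
  \<open>Z\<close>, leaving \<open>W\<close> on auxiliary tuples.\<close>

lemma strategy_value:
  "(\<Sum>f\<in>multi k (\<lambda>_. D). \<Sum>h\<in>multi k (\<lambda>_. D). (\<Sum>f'\<in>MM. \<Sum>h'\<in>MM.
      (\<Prod>j<k. E 1 (f j, f' j) (h j, h' j) - E (-1) (f j, f' j) (h j, h' j)) * of_real (\<phi> h' * \<phi> f')) * of_real (H h f / K))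
    = of_real (1 / (\<kappa> ^ k * K) * (\<Sum>f'\<in>MM. \<Sum>h'\<in>MM. \<phi> f' * \<phi> h' * W f' h'))"
proof -
  let ?D = "multi k (\<lambda>_. D)"
  have "(\<Sum>f\<in>?D. \<Sum>h\<in>?D. (\<Sum>f'\<in>MM. \<Sum>h'\<in>MM.
      (\<Prod>j<k. E 1 (f j, f' j) (h j, h' j) - E (-1) (f j, f' j) (h j, h' j)) * of_real (\<phi> h' * \<phi> f')) * of_real (H h f / K))
    = of_real (\<Sum>f\<in>?D. \<Sum>h\<in>?D. (\<Sum>f'\<in>MM. \<Sum>h'\<in>MM. (\<Prod>j<k. R (f j, f' j) (h j, h' j) / \<kappa>) * (\<phi> h' * \<phi> f')) * (H h f / K))"
    by (simp only: E_diff of_real_sum of_real_mult of_real_prod)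
  also have "(\<Sum>f\<in>?D. \<Sum>h\<in>?D. (\<Sum>f'\<in>MM. \<Sum>h'\<in>MM. (\<Prod>j<k. R (f j, f' j) (h j, h' j) / \<kappa>) * (\<phi> h' * \<phi> f')) * (H h f / K))
    = 1 / (\<kappa> ^ k * K) * (\<Sum>f'\<in>MM. \<Sum>h'\<in>MM. \<phi> f' * \<phi> h' * W f' h')"
  proof -
    have "(\<Sum>f\<in>?D. \<Sum>h\<in>?D. (\<Sum>f'\<in>MM. \<Sum>h'\<in>MM. (\<Prod>j<k. R (f j, f' j) (h j, h' j) / \<kappa>) * (\<phi> h' * \<phi> f')) * (H h f / K))
      = (\<Sum>z\<in>?D \<times> ?D. \<Sum>z'\<in>MM \<times> MM. 1 / (\<kappa> ^ k * K) * (\<phi> (fst z') * \<phi> (snd z')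
          * ((\<Prod>j<k. R (fst z j, fst z' j) (snd z j, snd z' j)) * H (snd z) (fst z))))"
      unfolding sum_Times sum_distrib_right
      by (intro sum.cong refl) (simp add: prod_dividef mult_ac)
    also have "\<dots> = (\<Sum>z'\<in>MM \<times> MM. \<Sum>z\<in>?D \<times> ?D. 1 / (\<kappa> ^ k * K) * (\<phi> (fst z') * \<phi> (snd z')
          * ((\<Prod>j<k. R (fst z j, fst z' j) (snd z j, snd z' j)) * H (snd z) (fst z))))"
      by (rule sum.swap)
    also have "\<dots> = (\<Sum>z'\<in>MM \<times> MM. 1 / (\<kappa> ^ k * K) * (\<phi> (fst z') * \<phi> (snd z') * W (fst z') (snd z')))"
    proof (rule sum.cong[OF refl])
      fix z'
      have "(\<Sum>z\<in>?D \<times> ?D. (\<Prod>j<k. R (fst z j, fst z' j) (snd z j, snd z' j)) * H (snd z) (fst z))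
        = (\<Sum>z\<in>?D \<times> ?D. \<Sum>a\<in>PA. t a * (\<Prod>j<k. R (fst z j, fst z' j) (snd z j, snd z' j) * X (a j) (snd z j) (fst z j)))"
        unfolding H_def sum_distrib_left prod.distrib by (intro sum.cong refl) (simp only: mult_ac)
      also have "\<dots> = (\<Sum>a\<in>PA. \<Sum>z\<in>?D \<times> ?D. t a * (\<Prod>j<k. R (fst z j, fst z' j) (snd z j, snd z' j) * X (a j) (snd z j) (fst z j)))"
        by (rule sum.swap)
      also have "\<dots> = (\<Sum>a\<in>PA. t a * (\<Sum>f\<in>?D. \<Sum>h\<in>?D. \<Prod>j<k. R (f j, fst z' j) (h j, snd z' j) * X (a j) (h j) (f j)))"
        by (simp only: sum_distrib_left sum_Times fst_conv snd_conv)
      also have "\<dots> = W (fst z') (snd z')"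
        unfolding W_def Z_def
        by (intro sum.cong refl arg_cong2[of _ _ _ _ "(*)"]
            sum_multi_pairs[where n = "\<lambda>_. D" and \<phi> = "\<lambda>j i i'. R (i, fst z' j) (i', snd z' j) * X (_ j) i' i"])
      finally show "(\<Sum>z\<in>?D \<times> ?D. 1 / (\<kappa> ^ k * K) * (\<phi> (fst z') * \<phi> (snd z')
          * ((\<Prod>j<k. R (fst z j, fst z' j) (snd z j, snd z' j)) * H (snd z) (fst z))))
        = 1 / (\<kappa> ^ k * K) * (\<phi> (fst z') * \<phi> (snd z') * W (fst z') (snd z'))"
        by (simp only: sum_distrib_left[symmetric])
    qed
    finally show ?thesis by (simp only: sum_Times fst_conv snd_conv sum_distrib_left)
  qed
  finally show ?thesis .
qed

text \<open>The factor 1 / K is common to both bounds. Per player, 1500 d sqrt d is 500 sqrt d times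
  a dimension of at most 3 d, and 1000 comes from the factor 1/2 in the Gram bound and from \<kappa>
  = 500 m sqrt d.\<close>

lemma game_exists:
  obtains G K where "K > 0" "quantum_xor_game k (\<lambda>_. D) G"
    "\<not> op_eq_on (multi k (\<lambda>_. D)) (game_operator G) (\<lambda>_ _. 0)"
    "separable_bias k (\<lambda>_. D) G \<le> 1 / K * (\<epsilon> * (1500 * (real d * sqrt (real d))) ^ k)"
    "entangled_bias k (\<lambda>_. D) G \<ge> 1 / K * (real m * (real d * sqrt (real d)) / 1000) ^ k"
proof -
  let ?D = "multi k (\<lambda>_. D)"
  have "?D \<noteq> {}" using D d by (auto simp: multi_def PiE_eq_empty_iff lessThan_empty_iff)
  then obtain G K where K: "K > 0" and G: "quantum_xor_game k (\<lambda>_. D) G"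
    and op: "\<And>f f'. game_operator G f f' = of_real (H f f' / K)"
    using game_of_symmetric[of k "\<lambda>_. D" H] H_sym H_diag by metis
  have sep: "separable_bias k (\<lambda>_. D) G \<le> \<epsilon> * (500 * sqrt (real d)) ^ k / K * (\<Prod>j<k. real D)"
  proof (rule separable_bias_le)
    show "0 \<le> \<epsilon> * (500 * sqrt (real d)) ^ k / K" using eps(1) K by simp
    fix x :: "nat \<Rightarrow> nat \<Rightarrow> complex"
    have "(\<Sum>f\<in>?D. \<Sum>f'\<in>?D. cnj (\<Prod>j<k. x j (f j)) * game_operator G f f' * (\<Prod>j<k. x j (f' j)))
      = of_real (1 / K) * (\<Sum>f\<in>?D. \<Sum>f'\<in>?D. cnj (\<Prod>j<k. x j (f j)) * of_real (H f f') * (\<Prod>j<k. x j (f' j)))"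
      unfolding op sum_distrib_left by (intro sum.cong refl) simp
    then have "cmod (\<Sum>f\<in>?D. \<Sum>f'\<in>?D. cnj (\<Prod>j<k. x j (f j)) * game_operator G f f' * (\<Prod>j<k. x j (f' j)))
      = 1 / K * cmod (\<Sum>f\<in>?D. \<Sum>f'\<in>?D. cnj (\<Prod>j<k. x j (f j)) * of_real (H f f') * (\<Prod>j<k. x j (f' j)))"
      using K by (simp only: norm_mult norm_of_real) simp
    also have "\<dots> \<le> 1 / K * (\<epsilon> * (500 * sqrt (real d)) ^ k * (\<Prod>j<k. \<Sum>i<D. (cmod (x j i))\<^sup>2))"
      using K by (intro mult_left_mono product_form_le) auto
    finally show "cmod (\<Sum>f\<in>?D. \<Sum>f'\<in>?D. cnj (\<Prod>j<k. x j (f j)) * game_operator G f f' * (\<Prod>j<k. x j (f' j)))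
      \<le> \<epsilon> * (500 * sqrt (real d)) ^ k / K * (\<Prod>j<k. \<Sum>i<D. (cmod (x j i))\<^sup>2)"
      by simp
  qed
  have "\<epsilon> * (500 * sqrt (real d)) ^ k / K * (\<Prod>j<k. real D) = 1 / K * (\<epsilon> * ((500 * sqrt (real d)) ^ k * real D ^ k))"
    by simp
  also have "\<dots> \<le> 1 / K * (\<epsilon> * ((500 * sqrt (real d)) ^ k * (3 * real d) ^ k))"
    using K eps(1) D by (intro mult_left_mono power_mono) auto
  also have "(500 * sqrt (real d)) ^ k * (3 * real d) ^ k = (1500 * (real d * sqrt (real d))) ^ k"
    unfolding power_mult_distrib[symmetric] by (rule arg_cong[of _ _ "\<lambda>z. z ^ k"]) simp
  finally have sep': "separable_bias k (\<lambda>_. D) G \<le> 1 / K * (\<epsilon> * (1500 * (real d * sqrt (real d))) ^ k)"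
    using sep by linarith
  define V where "V = 1 / (\<kappa> ^ k * K) * (\<Sum>f'\<in>MM. \<Sum>h'\<in>MM. \<phi> f' * \<phi> h' * W f' h')"
  have povms: "j < k \<Longrightarrow> povm ({..<(\<lambda>_. D) j} \<times> {..<(\<lambda>_. 2 * M) j}) E" for j
    using povm_E by (simp add: local_basis_def)
  have val: "(\<Sum>f\<in>?D. \<Sum>h\<in>?D. (\<Sum>f'\<in>MM. \<Sum>h'\<in>MM.
      (\<Prod>j<k. E 1 (f j, f' j) (h j, h' j) - E (-1) (f j, f' j) (h j, h' j)) * of_real (\<phi> h' * \<phi> f')) * game_operator G h f)
    = of_real V"
    unfolding op V_def by (rule strategy_value)
  have "V \<le> entangled_bias k (\<lambda>_. D) G"
    using entangled_bias_ge[where n = "\<lambda>_. D" and d = "\<lambda>_. 2 * M" and E = "\<lambda>_. E", OF G qstate_phi povms]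
    unfolding val by simp
  moreover have "1 / K * (real m * (real d * sqrt (real d)) / 1000) ^ k \<le> V"
  proof -
    have "(real d)\<^sup>2 / 2 * real M / \<kappa> = real m * (real d * sqrt (real d)) / 1000"
    proof -
      have "real d = sqrt (real d) * sqrt (real d)" by simp
      then show ?thesis using m d by (simp add: M_def \<kappa>_def power2_eq_square field_simps)
    qed
    then have "(real m * (real d * sqrt (real d)) / 1000) ^ k = ((real d)\<^sup>2 / 2 * real M / \<kappa>) ^ k"
      by (simp only:)
    also have "\<dots> = 1 / \<kappa> ^ k * (((real d)\<^sup>2 / 2) ^ k * real M ^ k)"
      by (simp add: power_mult_distrib power_divide)
    also have "\<dots> \<le> 1 / \<kappa> ^ k * (\<Sum>f'\<in>MM. \<Sum>h'\<in>MM. \<phi> f' * \<phi> h' * W f' h')"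
      using kappa_pos by (intro mult_left_mono sum_W_ge) auto
    finally have "1 / K * (real m * (real d * sqrt (real d)) / 1000) ^ k
      \<le> 1 / K * (1 / \<kappa> ^ k * (\<Sum>f'\<in>MM. \<Sum>h'\<in>MM. \<phi> f' * \<phi> h' * W f' h'))"
      using K by (intro mult_left_mono) auto
    then show ?thesis by (simp add: V_def mult.commute)
  qed
  moreover have "1 / K * (real m * (real d * sqrt (real d)) / 1000) ^ k > 0" using K m d by simp
  \<comment> \<open>A zero operator would force V = 0, but \<open>V\<close> has just been bounded
    below by a positive number.\<close>
  moreover have "\<not> op_eq_on ?D (game_operator G) (\<lambda>_ _. 0)"
  proof
    assume "op_eq_on ?D (game_operator G) (\<lambda>_ _. 0)"
    then have zero: "\<And>h f. h \<in> ?D \<Longrightarrow> f \<in> ?D \<Longrightarrow> game_operator G h f = 0" by (simp add: op_eq_on_def)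
    have "(\<Sum>f\<in>?D. \<Sum>h\<in>?D. (\<Sum>f'\<in>MM. \<Sum>h'\<in>MM.
      (\<Prod>j<k. E 1 (f j, f' j) (h j, h' j) - E (-1) (f j, f' j) (h j, h' j)) * of_real (\<phi> h' * \<phi> f')) * game_operator G h f) = 0"
      by (intro sum.neutral ballI) (simp add: zero)
    then have "V = 0" unfolding val by simp
    then show False using calculation(2,3) by linarith
  qed
  ultimately show ?thesis using that[OF K G _ sep'] by linarith
qed

end

theorem theorem1p1:
  shows "\<exists>c::real. c > 0 \<and> (\<forall>k::nat. k \<ge> 3 \<longrightarrow> (\<exists>C::real. C > 0 \<and>
    (\<forall>(D::nat) (m::nat). m \<ge> 2 \<and> real D \<ge> c * real m ^ 4 * sqrt (ln (real m)) \<longrightarrow>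
      (\<exists>G. quantum_xor_game k (\<lambda>_. D) G \<and>
        \<not> op_eq_on (multi k (\<lambda>_. D)) (game_operator G) (\<lambda>_ _. 0) \<and>
        entangled_bias k (\<lambda>_. D) G \<ge>
          C * real m powr (real k / 2 - 1) * ln (real m) powr (- (real k / 2)) *
            separable_bias k (\<lambda>_. D) G))))"
proof (rule exI[of _ 30], intro conjI allI impI)
  fix k :: nat assume k3: "k \<ge> 3"
  then obtain C1 where C1: "C1 > 0" and tens: "\<forall>m\<ge>2. \<exists>g\<in>signs (\<Pi>\<^sub>E j\<in>{..<k}. {..<m\<^sup>2}). \<exists>g'\<in>signs (\<Pi>\<^sub>E j\<in>{..<k}. {..<m\<^sup>2}). \<forall>B.
    \<bar>mlf {..<k} (\<lambda>_. {..<m\<^sup>2} \<times> {..<m\<^sup>2}) (pair_tensor {..<k} g g') B\<bar>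
      \<le> C1 * (real m * sqrt (real m ^ 3 * ln (real m))) * (\<Prod>j<k. L2_set (B j) ({..<m\<^sup>2} \<times> {..<m\<^sup>2}))"
    using exists_pair_tensor[of k] by auto
  \<comment> \<open>1500000 is 1500 from the separable bound times 1000 from the entangled one; 2^k
    absorbs negative powers of log m, which may be below 1.\<close>
  define C where "C = 1 / (C1 * 1500000 ^ k * 2 ^ k)"
  have C: "C > 0" using C1 by (simp add: C_def)
  show "\<exists>C::real. C > 0 \<and>
    (\<forall>(D::nat) (m::nat). m \<ge> 2 \<and> real D \<ge> 30 * real m ^ 4 * sqrt (ln (real m)) \<longrightarrow>
      (\<exists>G. quantum_xor_game k (\<lambda>_. D) G \<and>
        \<not> op_eq_on (multi k (\<lambda>_. D)) (game_operator G) (\<lambda>_ _. 0) \<and>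
        entangled_bias k (\<lambda>_. D) G \<ge>
          C * real m powr (real k / 2 - 1) * ln (real m) powr (- (real k / 2)) *
            separable_bias k (\<lambda>_. D) G))"
  proof (intro exI[of _ C] conjI allI impI C)
    fix D m :: nat
    assume Dm: "m \<ge> 2 \<and> real D \<ge> 30 * real m ^ 4 * sqrt (ln (real m))"
    then have m: "m \<ge> 2" by simp
    define L where "L = ln (real m)"
    have L: "L \<ge> 1 / 2" unfolding L_def by (rule half_le_ln[OF m])
    define x where "x = real m ^ 4 * sqrt L"
    have x: "x \<ge> 1"
    proof -
      have "2 ^ 4 * (1 / 2) \<le> real m ^ 4 * sqrt L"
        using m L by (intro mult_mono power_mono real_le_rsqrt) (auto simp: power2_eq_square)
      then show ?thesis by (simp add: x_def)
    qed
    have Dx: "real D \<ge> 30 * x" using Dm by (simp add: x_def L_def)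
    \<comment> \<open>The constant 30 leaves room for halving: as x is at least 1, \<open>D\<close>
      at least 30 x gives \<open>d\<close> at least 9 x, as the sign matrices require.\<close>
    define d where "d = D div 2"
    have d2: "2 * d \<le> D" "D \<le> 2 * d + 1" by (auto simp: d_def)
    then have "real D \<le> 2 * real d + 1" by linarith
    then have dx: "real d \<ge> 9 * x" using Dx x by linarith
    then have d1: "d \<ge> 1" using x by linarith
    have "real d \<ge> 9 * real m ^ 4 * sqrt (ln (real m))" using dx by (simp add: x_def L_def)
    from exists_sign_matrices[OF m this]
    obtain s :: "(nat \<times> nat) \<times> (nat \<times> nat) \<Rightarrow> real" where s:
      "\<And>a u. a \<in> {..<m\<^sup>2} \<times> {..<m\<^sup>2} \<Longrightarrow> u \<in> {..<d} \<times> {..<d} \<Longrightarrow> (s (a, u))\<^sup>2 = 1"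
      "\<And>b x y. \<bar>\<Sum>a\<in>{..<m\<^sup>2} \<times> {..<m\<^sup>2}. \<Sum>i<d. \<Sum>j<d. s (a, (i, j)) * (b a * (x i * y j))\<bar>
        \<le> 500 * sqrt (real d) * (L2_set b ({..<m\<^sup>2} \<times> {..<m\<^sup>2}) * (L2_set x {..<d} * L2_set y {..<d}))"
      "\<And>x y. \<bar>\<Sum>p\<in>{..<m\<^sup>2} \<times> {..<d}. \<Sum>q\<in>{..<m\<^sup>2} \<times> {..<d}. s ((fst p, fst q), (snd p, snd q)) * (x p * y q)\<bar>
        \<le> 500 * (real m * sqrt (real d)) * (L2_set x ({..<m\<^sup>2} \<times> {..<d}) * L2_set y ({..<m\<^sup>2} \<times> {..<d}))"
      "\<And>a b. a \<in> {..<m\<^sup>2} \<times> {..<m\<^sup>2} \<Longrightarrow> b \<in> {..<m\<^sup>2} \<times> {..<m\<^sup>2} \<Longrightarrow> a \<noteq> b \<Longrightarrow>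
        \<bar>\<Sum>u\<in>{..<d} \<times> {..<d}. s (a, u) * s (b, u)\<bar> \<le> (real d)\<^sup>2 / (2 * real m ^ 4)"
      by blast
    define \<epsilon> where "\<epsilon> = C1 * (real m * sqrt (real m ^ 3 * L))"
    have eps: "\<epsilon> \<ge> 0" using C1 L by (simp add: \<epsilon>_def)
    obtain g g' where g: "g \<in> signs (\<Pi>\<^sub>E j\<in>{..<k}. {..<m\<^sup>2})" "g' \<in> signs (\<Pi>\<^sub>E j\<in>{..<k}. {..<m\<^sup>2})"
      and gB: "\<And>B. \<bar>mlf {..<k} (\<lambda>_. {..<m\<^sup>2} \<times> {..<m\<^sup>2}) (pair_tensor {..<k} g g') B\<bar>
        \<le> \<epsilon> * (\<Prod>j<k. L2_set (B j) ({..<m\<^sup>2} \<times> {..<m\<^sup>2}))"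
      using tens m unfolding \<epsilon>_def L_def by blast
    interpret game_data k m d D s g g' \<epsilon> "m\<^sup>2" "{..<m\<^sup>2} \<times> {..<m\<^sup>2}"
    proof -
      have "k \<ge> 1" "D \<le> 3 * d" using k3 d1 d2 by auto
      then show "game_data k m d D s g g' \<epsilon>"
        by unfold_locales (rule m d1 d2(1) s g gB eps | assumption)+
    qed
    obtain G K where K: "K > 0" and G: "quantum_xor_game k (\<lambda>_. D) G"
      "\<not> op_eq_on (multi k (\<lambda>_. D)) (game_operator G) (\<lambda>_ _. 0)"
      and sep: "separable_bias k (\<lambda>_. D) G \<le> 1 / K * (\<epsilon> * (1500 * (real d * sqrt (real d))) ^ k)"
      and ent: "entangled_bias k (\<lambda>_. D) G \<ge> 1 / K * (real m * (real d * sqrt (real d)) / 1000) ^ k"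
      by (rule game_exists)
    \<comment> \<open>The ratio to be reached, up to \<open>C\<close>. The biases compare as (m /
      1000)^k to \<epsilon> 1500^k, so it remains to bound \<rho> \<epsilon> by a multiple of
      m^k.\<close>
    define \<rho> where "\<rho> = real m powr (real k / 2 - 1) * L powr (- (real k / 2))"
    have "C * \<rho> * \<epsilon> * 1500 ^ k \<le> (real m / 1000) ^ k"
    proof -
      have L0: "L > 0" and m0: "real m > 0" using L m by auto
      have eps_powr: "\<epsilon> = C1 * (real m powr (5 / 2) * L powr (1 / 2))"
      proof -
        have "sqrt (real m ^ 3 * L) = real m powr (3 / 2) * L powr (1 / 2)"
        proof (rule real_sqrt_unique)
          have "real m powr (3 / 2) * real m powr (3 / 2) = real m ^ 3" "L powr (1 / 2) * L powr (1 / 2) = L"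
            using L0 m0 by (simp_all add: powr_add[symmetric])
          then show "(real m powr (3 / 2) * L powr (1 / 2))\<^sup>2 = real m ^ 3 * L"
            by (simp add: power2_eq_square mult_ac)
        qed simp
        then show ?thesis using m0 by (simp add: \<epsilon>_def powr_mult_base)
      qed
      have "\<rho> * \<epsilon> = C1 * (real m powr (real k / 2 + 3 / 2) * L powr (- ((real k - 1) / 2)))"
      proof -
        have e: "real k / 2 + 3 / 2 = (real k / 2 - 1) + 5 / 2" "- ((real k - 1) / 2) = - (real k / 2) + 1 / 2"
          by (simp_all add: field_simps)
        show ?thesis unfolding e powr_add by (simp only: \<rho>_def eps_powr mult_ac)
      qed
      also have "\<dots> \<le> C1 * (real m powr real k * 2 ^ k)"
      proof (intro mult_left_mono mult_mono)
        \<comment> \<open>Here k at least 3 enters: k/2 + 3/2 is at most k.\<close>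
        show "real m powr (real k / 2 + 3 / 2) \<le> real m powr real k"
          using k3 m by (intro powr_mono) auto
        \<comment> \<open>The exponent is negative and log m is at least 1/2, so the power is
          largest at 1/2.\<close>
        have "L powr (- ((real k - 1) / 2)) \<le> (1 / 2) powr (- ((real k - 1) / 2))"
          using L k3 by (intro powr_mono2') auto
        also have "\<dots> = 2 powr ((real k - 1) / 2)" by (simp add: powr_minus powr_divide)
        also have "\<dots> \<le> 2 powr real k" using k3 by (intro powr_mono) auto
        finally show "L powr (- ((real k - 1) / 2)) \<le> 2 ^ k" by (simp add: powr_realpow)
      qed (use C1 in auto)
      also have "real m powr real k = real m ^ k" using m0 by (rule powr_realpow)
      finally have "\<rho> * \<epsilon> \<le> C1 * (real m ^ k * 2 ^ k)" .
      then have "C * 1500 ^ k * (\<rho> * \<epsilon>) \<le> C * 1500 ^ k * (C1 * (real m ^ k * 2 ^ k))"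
        using C by (intro mult_left_mono) auto
      also have "\<dots> = (real m / 1000) ^ k"
      proof -
        have "(1500000 :: real) ^ k = 1500 ^ k * 1000 ^ k" by (simp add: power_mult_distrib[symmetric])
        then show ?thesis using C1 by (simp add: C_def power_divide)
      qed
      finally show ?thesis by (simp only: mult_ac)
    qed
    then have main: "1 / K * (real d * sqrt (real d)) ^ k * (C * \<rho> * \<epsilon> * 1500 ^ k)
        \<le> 1 / K * (real d * sqrt (real d)) ^ k * (real m / 1000) ^ k"
      using K by (intro mult_left_mono) auto
    have "C * \<rho> * separable_bias k (\<lambda>_. D) G \<le> C * \<rho> * (1 / K * (\<epsilon> * (1500 * (real d * sqrt (real d))) ^ k))"
      using C by (intro mult_left_mono sep) (auto simp: \<rho>_def)
    also have "\<dots> = 1 / K * (real d * sqrt (real d)) ^ k * (C * \<rho> * \<epsilon> * 1500 ^ k)"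
      by (simp add: power_mult_distrib mult_ac)
    also note main
    also have "1 / K * (real d * sqrt (real d)) ^ k * (real m / 1000) ^ k
        = 1 / K * (real m * (real d * sqrt (real d)) / 1000) ^ k"
      by (simp add: power_mult_distrib power_divide mult_ac)
    also note ent
    finally show "\<exists>G. quantum_xor_game k (\<lambda>_. D) G \<and>
        \<not> op_eq_on (multi k (\<lambda>_. D)) (game_operator G) (\<lambda>_ _. 0) \<and>
        entangled_bias k (\<lambda>_. D) G \<ge>
          C * real m powr (real k / 2 - 1) * ln (real m) powr (- (real k / 2)) *
            separable_bias k (\<lambda>_. D) G"
      using G unfolding \<rho>_def L_def by (auto simp: mult.assoc)
  qed
qed simp

end
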